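(* Let $m\ge 2$ be an integer, let $n_1,\dots,n_m$ be positive integers, let $N=\prod_{i=1}^m n_i$, let $k$ be an integer with $1\le k\le N$, and let $\phi: M_N\to M_N$ be a (complex-)linear map. The following are equivalent. (a) $\|\phi(A_1\otimes\cdots\otimes A_m)\|_{(k)}=\|A_1\otimes\cdots\otimes A_m\|_{(k)}$ for all $A_i\in M_{n_i}$, $i=1,\dots,m$. (b) There are unitary matrices $U,V\in M_N$, and maps $\varphi_s: M_{n_s}\to M_{n_s}$ for $s=1,\dots,m$, each of which is either the identity map $X\mapsto X$ or the transposition map $X\mapsto X^t$, such that $$\phi(A_1\otimes\cdots\otimes A_m)=U(\varphi_1(A_1)\otimes\cdots\otimes\varphi_m(A_m))V\quad\text{for all } A_i\in M_{n_i},\ i=1,\dots,m.$$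
   Context: $M_n$ denotes the set of $n\times n$ complex matrices. $A_1\otimes\cdots\otimes A_m\in M_N$ is the tensor (Kronecker) product; $M_{n_1}\otimes\cdots\otimes M_{n_m}$ is identified with $M_N$, $N=n_1\cdots n_m$. For $X\in M_N$ with singular values $s_1(X)\ge\cdots\ge s_N(X)$ and $1\le k\le N$, the Ky Fan $k$-norm is $\|X\|_{(k)}=s_1(X)+\cdots+s_k(X)$. $X^t$ is the transpose of $X$ (without conjugation). *)

theory Defs
  imports
    "Jordan_Normal_Form.Schur_Decomposition"
    "Jordan_Normal_Form.VS_Connect"
    "HOL-Computational_Algebra.Fundamental_Theorem_Algebra"
begin

definition unitary_mat :: "nat \<Rightarrow> complex mat \<Rightarrow> bool" where
  "unitary_mat n U \<longleftrightarrow>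
     U \<in> carrier_mat n n \<and> mat_adjoint U * U = 1\<^sub>m n \<and> U * mat_adjoint U = 1\<^sub>m n"

definition kronecker :: "complex mat \<Rightarrow> complex mat \<Rightarrow> complex mat" where
  "kronecker A B = mat (dim_row A * dim_row B) (dim_col A * dim_col B)
     (\<lambda>(i, j). A $$ (i div dim_row B, j div dim_col B) * B $$ (i mod dim_row B, j mod dim_col B))"

text \<open>A family of matrices is indexed by \<open>0, \<dots>, m - 1\<close>; its Kronecker product is bracketed
  to the left, starting from the empty product, the 1 x 1 identity matrix.\<close>

fun kronecker_prod :: "nat \<Rightarrow> (nat \<Rightarrow> complex mat) \<Rightarrow> complex mat" where
  "kronecker_prod 0 A = 1\<^sub>m 1"
| "kronecker_prod (Suc m) A = kronecker (kronecker_prod m A) (A m)"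

lemma kronecker_carrier:
  "A \<in> carrier_mat r c \<Longrightarrow> B \<in> carrier_mat r' c' \<Longrightarrow> kronecker A B \<in> carrier_mat (r * r') (c * c')"
  by (auto simp: kronecker_def)

lemma kronecker_prod_carrier:
  "(\<And>i. i < m \<Longrightarrow> A i \<in> carrier_mat (n i) (n i)) \<Longrightarrow>
     kronecker_prod m A \<in> carrier_mat (\<Prod>i<m. n i) (\<Prod>i<m. n i)"
  by (induction m) (auto intro: kronecker_carrier)

lemma kronecker_prod_Suc_0: "kronecker_prod (Suc 0) A = A 0"
  by (intro eq_matI) (auto simp: kronecker_def)

text \<open>The singular values of a square matrix \<open>X\<close> are the square roots of the eigenvalues of
  \<open>X\<^sup>*X\<close>, repeated by algebraic multiplicity and sorted in decreasing order. These eigenvalues are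
  real and nonnegative, so taking the real part only changes the type.\<close>

definition singular_values :: "complex mat \<Rightarrow> real list" where
  "singular_values X = rev (sorted_list_of_multiset
     (image_mset (\<lambda>z. sqrt (Re z)) (proots (char_poly (mat_adjoint X * X)))))"

lemma length_singular_values:
  assumes "X \<in> carrier_mat n n"
  shows "length (singular_values X) = n"
proof -
  have "mat_adjoint X * X \<in> carrier_mat n n"
    using assms by (auto simp: mat_adjoint_def)
  from degree_monic_char_poly[OF this] show ?thesis
    by (metis singular_values_def length_rev size_mset mset_sorted_list_of_multiset
        size_image_mset size_proots_complex)
qed

text \<open>Lists count from 0, so this is the sum of the \<open>k\<close> largest singular values.\<close>

definition ky_fan_norm :: "nat \<Rightarrow> complex mat \<Rightarrow> real" where
  "ky_fan_norm k X = (\<Sum>i<k. singular_values X ! i)"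

end

theory Submission
  imports Defs "Jordan_Normal_Form.Spectral_Radius"
begin

text \<open>Since \<open>diag(1, z, \<dots>, z ^ (N - 1))\<close> is a Kronecker product of diagonal matrices, the norm of
  \<open>f z = (\<Sum>a<N. z ^ a P\<^sub>a)\<close> is known, where \<open>P\<^sub>a\<close> is the image of the \<open>a\<close>-th diagonal matrix unit. Letting \<open>z\<close> tend
  to 0 along a generic ray (for \<open>k = 1\<close>: averaging over roots of unity) one finds that \<open>P\<^sub>0\<close> has rank one, and, by
  singular value decompositions of the factors, that \<open>\<phi>\<close> maps every rank one Kronecker product to a matrix of rank at
  most one. Such a product is a decomposable tensor with two slots, a column and a row vector, per factor. Changing a
  single slot changes either only the column factor or only the row factor of the image, and which of the two happens
  does not depend on the other slots. The two slots of one factor behave in opposite ways because the norm does not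
  satisfy the parallelogram law. So, up to transpositions of factors, \<open>\<phi>\<close> acts on products as \<open>X \<mapsto> Y X Z\<close>, and
  polarisation in each factor shows that \<open>Y\<close> and \<open>Z\<close> are unitary up to scalars.\<close>

section \<open>Unitary and positive semidefinite matrices\<close>

text \<open>The norm is controlled only on Kronecker products, and a sum of two products is rarely a
  product, so the images of two orthogonal units cannot in general be compared through the norm of
  their sum. The family diag(1, z, ..., z^(N-1)) repairs this: it is a product for every z, and its
  image is a polynomial in z whose coefficients are the images of all diagonal units. For 0 < |z| <
  1 its k largest singular values are 1, |z|, ..., |z|^(k-1), so the first k coefficients enter with
  different orders of magnitude as z tends to 0; this is what makes one pair of unitary matrices
  optimal for all of them. For k = 1 the limit sees a single coefficient, whereas on |z| = 1 all
  coefficients carry equal weight; hence the separate argument. Only the corner unit needs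
  treatment, because composition with unitary Kronecker products moves every rank one product to a
  multiple of it. On rank one matrices all Ky Fan norms equal the Frobenius norm, so afterwards the
  norm of an image is a product over slots, and the value of k matters only for E_00 + t E_11 in one
  factor, whose norm min k 2 is never the square root of 2.\<close>

lemma dim_mat_adjoint [simp]: "dim_row (mat_adjoint A) = dim_col A" "dim_col (mat_adjoint A) = dim_row A"
  by (auto simp: mat_adjoint_def)

lemma mat_adjoint_carrier [simp, intro]: "A \<in> carrier_mat n m \<Longrightarrow> mat_adjoint A \<in> carrier_mat m n"
  by (rule carrier_matI) simp_all

lemma mat_adjoint_index [simp]:
  fixes A :: "complex mat"
  assumes "i < dim_col A" "j < dim_row A"
  shows "mat_adjoint A $$ (i, j) = cnj (A $$ (j, i))"
  using assms by (auto simp: mat_adjoint_def mat_of_rows_def)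

lemma mult_mat_index:
  assumes "A \<in> carrier_mat a b" "B \<in> carrier_mat b c" "i < a" "j < c"
  shows "(A * B) $$ (i, j) = (\<Sum>l<b. A $$ (i, l) * B $$ (l, j))"
  using assms by (auto simp: scalar_prod_def lessThan_atLeast0 intro!: sum.cong)

lemma mult_carrier_mat_square [simp, intro]:
  "A \<in> carrier_mat n n \<Longrightarrow> B \<in> carrier_mat n n \<Longrightarrow> A * B \<in> carrier_mat n n"
  by (rule mult_carrier_mat)

lemma mult_mat_vec_index:
  assumes "A \<in> carrier_mat a b" "v \<in> carrier_vec b" "i < a"
  shows "(A *\<^sub>v v) $ i = (\<Sum>l<b. A $$ (i, l) * v $ l)"
  using assms by (auto simp: scalar_prod_def lessThan_atLeast0 intro!: sum.cong)

declare index_mult_mat(1) [simp del] index_mult_mat_vec [simp del]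

lemma mat_adjoint_adjoint [simp]: "mat_adjoint (mat_adjoint A) = (A :: complex mat)"
  by (intro eq_matI) auto

lemma mat_adjoint_mult:
  fixes A B :: "complex mat"
  assumes "A \<in> carrier_mat a b" "B \<in> carrier_mat b c"
  shows "mat_adjoint (A * B) = mat_adjoint B * mat_adjoint A"
proof (intro eq_matI)
  fix i j assume "i < dim_row (mat_adjoint B * mat_adjoint A)" "j < dim_col (mat_adjoint B * mat_adjoint A)"
  with assms have ij: "i < c" "j < a" by auto
  have "mat_adjoint (A * B) $$ (i, j) = cnj (\<Sum>l<b. A $$ (j, l) * B $$ (l, i))"
    using assms ij by (subst mat_adjoint_index) (auto simp: mult_mat_index[OF assms])
  also have "\<dots> = (\<Sum>l<b. mat_adjoint B $$ (i, l) * mat_adjoint A $$ (l, j))"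
    using assms ij by (auto intro!: sum.cong simp: mult.commute)
  also have "\<dots> = (mat_adjoint B * mat_adjoint A) $$ (i, j)"
    using assms ij by (subst mult_mat_index[where a=c and b=b and c=a]) auto
  finally show "mat_adjoint (A * B) $$ (i, j) = (mat_adjoint B * mat_adjoint A) $$ (i, j)" .
qed (use assms in auto)

section \<open>Hermitian inner product and unitary matrices\<close>

definition ip :: "complex vec \<Rightarrow> complex vec \<Rightarrow> complex" where
  "ip x y = (\<Sum>i<dim_vec y. cnj (x $ i) * y $ i)"

lemma ip_carrier: "y \<in> carrier_vec n \<Longrightarrow> ip x y = (\<Sum>i<n. cnj (x $ i) * y $ i)"
  by (auto simp: ip_def)

lemma ip_adjoint:
  assumes "A \<in> carrier_mat a b" "x \<in> carrier_vec a" "y \<in> carrier_vec b"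
  shows "ip x (A *\<^sub>v y) = ip (mat_adjoint A *\<^sub>v x) y"
proof -
  have "ip x (A *\<^sub>v y) = (\<Sum>i<a. \<Sum>l<b. cnj (x $ i) * (A $$ (i, l) * y $ l))"
    using assms by (auto simp: ip_carrier[where n=a] mult_mat_vec_index[OF assms(1,3)] sum_distrib_left)
  also have "\<dots> = (\<Sum>l<b. \<Sum>i<a. cnj (x $ i) * (A $$ (i, l) * y $ l))" by (rule sum.swap)
  also have "\<dots> = ip (mat_adjoint A *\<^sub>v x) y"
    using assms by (auto simp: ip_carrier[where n=b] mult_mat_vec_index[where a=b and b=a] sum_distrib_right
        intro!: sum.cong)
  finally show ?thesis .
qed

lemma ip_self: "ip x x = complex_of_real (\<Sum>i<dim_vec x. (cmod (x $ i))\<^sup>2)"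
  by (auto simp: ip_def complex_norm_square mult.commute simp del: of_real_power intro!: sum.cong)

lemma ip_self_eq_0: "x \<in> carrier_vec n \<Longrightarrow> ip x x = 0 \<longleftrightarrow> x = 0\<^sub>v n"
  by (auto simp: ip_self simp del: of_real_sum simp flip: of_real_sum intro!: eq_vecI)
     (subst (asm) sum_nonneg_eq_0_iff; auto)+

lemma ip_cnj: "dim_vec x = dim_vec y \<Longrightarrow> cnj (ip x y) = ip y x"
  by (auto simp: ip_def mult.commute)

lemma ip_add_right: "\<lbrakk>y \<in> carrier_vec n; z \<in> carrier_vec n\<rbrakk> \<Longrightarrow> ip x (y + z) = ip x y + ip x z"
  by (auto simp: ip_def sum.distrib algebra_simps)

lemma ip_smult_right: "ip x (c \<cdot>\<^sub>v y) = c * ip x y"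
  by (auto simp: ip_def sum_distrib_left algebra_simps)

lemma ip_add_left: "\<lbrakk>x \<in> carrier_vec n; x' \<in> carrier_vec n; y \<in> carrier_vec n\<rbrakk> \<Longrightarrow> ip (x + x') y = ip x y + ip x' y"
  by (auto simp: ip_def sum.distrib algebra_simps)

lemma ip_smult_left: "\<lbrakk>x \<in> carrier_vec n; y \<in> carrier_vec n\<rbrakk> \<Longrightarrow> ip (c \<cdot>\<^sub>v x) y = cnj c * ip x y"
  by (auto simp: ip_def sum_distrib_left algebra_simps)

lemma ip_unit_left: "\<lbrakk>i < n; y \<in> carrier_vec n\<rbrakk> \<Longrightarrow> ip (unit_vec n i) y = y $ i"
proof -
  assume a: "i < n" "y \<in> carrier_vec n"
  have "ip (unit_vec n i) y = (\<Sum>l<n. if l = i then y $ l else 0)"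
    unfolding ip_carrier[OF a(2)] using a by (intro sum.cong) (auto simp: unit_vec_def)
  thus ?thesis using a by (simp)
qed

lemma unitary_matD:
  assumes "unitary_mat n U"
  shows "U \<in> carrier_mat n n" "mat_adjoint U * U = 1\<^sub>m n" "U * mat_adjoint U = 1\<^sub>m n"
  using assms by (auto simp: unitary_mat_def)

lemma unitary_matI:
  assumes "U \<in> carrier_mat n n" "mat_adjoint U * U = 1\<^sub>m n"
  shows "unitary_mat n U"
  using assms mat_mult_left_right_inverse[of "mat_adjoint U" n U] by (auto simp: unitary_mat_def)

lemma unitary_one [simp, intro]: "unitary_mat n (1\<^sub>m n)"
  by (auto simp: unitary_mat_def)

lemma unitary_adjoint: "unitary_mat n U \<Longrightarrow> unitary_mat n (mat_adjoint U)"
  by (auto simp: unitary_mat_def)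

lemma unitary_mult:
  assumes "unitary_mat n U" "unitary_mat n V"
  shows "unitary_mat n (U * V)"
proof (rule unitary_matI)
  note c = unitary_matD(1)[OF assms(1)] unitary_matD(1)[OF assms(2)]
  have "mat_adjoint (U * V) * (U * V) = mat_adjoint V * ((mat_adjoint U * U) * V)"
    using c by (simp add: mat_adjoint_mult[of _ n n _ n] assoc_mult_mat[of _ n n _ n _ n])
  also have "\<dots> = 1\<^sub>m n" using c assms by (simp add: unitary_mat_def)
  finally show "mat_adjoint (U * V) * (U * V) = 1\<^sub>m n" .
qed (use unitary_matD(1)[OF assms(1)] unitary_matD(1)[OF assms(2)] in auto)

lemma smult_smult: "a \<cdot>\<^sub>m (b \<cdot>\<^sub>m A) = (a * b :: complex) \<cdot>\<^sub>m A"
  by (intro eq_matI) auto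

lemma unitary_smult:
  assumes "unitary_mat n U" "cmod z = 1"
  shows "unitary_mat n (z \<cdot>\<^sub>m U)"
proof (rule unitary_matI)
  note c = unitary_matD[OF assms(1)]
  have "mat_adjoint (z \<cdot>\<^sub>m U) = cnj z \<cdot>\<^sub>m mat_adjoint U"
    using c by (intro eq_matI) auto
  moreover have "cnj z * z = 1" using assms(2) by (metis complex_norm_square mult.commute of_real_1 power_one)
  ultimately show "mat_adjoint (z \<cdot>\<^sub>m U) * (z \<cdot>\<^sub>m U) = 1\<^sub>m n"
    using c by (simp add: mult_smult_distrib[of _ n n] mult_smult_assoc_mat[of _ n n] smult_smult mult.commute) (intro eq_matI, auto)
qed (use unitary_matD(1)[OF assms(1)] in auto)

lemma unitary_transpose:
  assumes "unitary_mat n U"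
  shows "unitary_mat n (transpose_mat U)"
proof (rule unitary_matI)
  note c = unitary_matD[OF assms(1)]
  have "mat_adjoint (transpose_mat U) = transpose_mat (mat_adjoint U)"
    using c by (intro eq_matI) auto
  thus "mat_adjoint (transpose_mat U) * (transpose_mat U) = 1\<^sub>m n"
    using c by (simp flip: transpose_mult[of U n n "mat_adjoint U" n])
qed (use unitary_matD(1)[OF assms(1)] in auto)

lemma unitary_ip:
  assumes "unitary_mat n U" "x \<in> carrier_vec n" "y \<in> carrier_vec n"
  shows "ip (U *\<^sub>v x) (U *\<^sub>v y) = ip x y"
proof -
  note c = unitary_matD[OF assms(1)]
  show ?thesis using c assms
    by (subst ip_adjoint[of _ n n]) (auto simp flip: assoc_mult_mat_vec[of _ n n _ n])
qed

lemma unitary_col_sum: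
  assumes "unitary_mat n U" "j < n"
  shows "(\<Sum>l<n. (cmod (U $$ (l, j)))\<^sup>2) = 1"
proof -
  note c = unitary_matD[OF assms(1)]
  have "1 = (mat_adjoint U * U) $$ (j, j)" using c assms by simp
  also have "\<dots> = (\<Sum>l<n. cnj (U $$ (l, j)) * U $$ (l, j))"
    using c assms by (subst mult_mat_index[of _ n n _ n]) auto
  also have "\<dots> = complex_of_real (\<Sum>l<n. (cmod (U $$ (l, j)))\<^sup>2)"
    by (auto simp: complex_norm_square mult.commute simp del: of_real_power)
  finally show ?thesis by (metis of_real_1 of_real_eq_iff)
qed

lemma unitary_row_sum:
  assumes "unitary_mat n U" "i < n"
  shows "(\<Sum>l<n. (cmod (U $$ (i, l)))\<^sup>2) = 1"
  using unitary_col_sum[OF unitary_transpose[OF assms(1)] assms(2)] unitary_matD(1)[OF assms(1)] assms(2)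
  by simp

lemma unitary_entry_bound:
  assumes "unitary_mat n U" "i < n" "j < n"
  shows "cmod (U $$ (i, j)) \<le> 1"
proof -
  have "(cmod (U $$ (i, j)))\<^sup>2 \<le> (\<Sum>l<n. (cmod (U $$ (l, j)))\<^sup>2)"
    using assms by (intro member_le_sum) auto
  thus ?thesis using unitary_col_sum[OF assms(1,3)] by (simp add: abs_square_le_1)
qed

text \<open>The complex reflection I - (1 - z) x x^*: for a unit vector x it multiplies x by z and
  fixes the orthogonal complement. These matrices are the variations used in all optimality
  arguments.\<close>

definition refl_mat :: "nat \<Rightarrow> complex vec \<Rightarrow> complex \<Rightarrow> complex mat" where
  "refl_mat n x z = mat n n (\<lambda>(i, j). (if i = j then 1 else 0) - (1 - z) * x $ i * cnj (x $ j))"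

lemma refl_mat_carrier [simp]: "refl_mat n x z \<in> carrier_mat n n"
  by (simp add: refl_mat_def)

text \<open>The correction terms cancel because (1 - z) + (1 - cnj z) = |1 - z|^2 on the unit
  circle.\<close>

lemma unitary_refl_mat:
  assumes x: "x \<in> carrier_vec n" "ip x x = 1" and z: "cmod z = 1"
  shows "unitary_mat n (refl_mat n x z)"
proof (rule unitary_matI)
  let ?G = "refl_mat n x z"
  have zz: "cnj z * z = 1" using z by (metis complex_norm_square mult.commute of_real_1 power_one)
  show "mat_adjoint ?G * ?G = 1\<^sub>m n"
  proof (intro eq_matI)
    fix i j assume "i < dim_row (1\<^sub>m n :: complex mat)" "j < dim_col (1\<^sub>m n :: complex mat)"
    hence ij: "i < n" "j < n" by auto
    have "(mat_adjoint ?G * ?G) $$ (i, j) = (\<Sum>l<n. mat_adjoint ?G $$ (i,l) * ?G $$ (l, j))"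
      using ij by (subst mult_mat_index[of _ n n _ n]) auto
    also have "\<dots> = (\<Sum>l<n. (if l = i then (if i = j then 1 else 0) else 0) 
          - (if l = i then (1 - z) * x $ l * cnj (x $ j) else 0)
          - (if l = j then (1 - cnj z) * cnj (x $ l) * x $ i else 0)
          + (1 - cnj z) * (1 - z) * x $ i * cnj (x $ j) * (cnj (x $ l) * x $ l))"
      using ij by (intro sum.cong) (auto simp: refl_mat_def algebra_simps)
    also have "\<dots> = (if i = j then 1 else 0) - (1 - z) * x $ i * cnj (x $ j)
          - (1 - cnj z) * cnj (x $ j) * x $ i + (1 - cnj z) * (1 - z) * x $ i * cnj (x $ j) * ip x x"
      using ij by (simp add: sum.distrib sum_subtractf ip_carrier[OF x(1)] flip: sum_distrib_left)
    also have "\<dots> = (if i = j then 1 else 0) + (cnj z * z - 1) * (x $ i * cnj (x $ j))"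
      unfolding x(2) by (simp add: algebra_simps)
    finally show "(mat_adjoint ?G * ?G) $$ (i, j) = 1\<^sub>m n $$ (i, j)"
      using ij zz by simp
  qed (auto simp: refl_mat_def)
qed simp

text \<open>The trace of D Y for the real diagonal matrix D with entries \<open>w\<close>. Strictly
  decreasing weights lead to singular value decompositions, the weights \<open>topw k\<close> to Ky
  Fan norms.\<close>

definition weighted_trace :: "nat \<Rightarrow> (nat \<Rightarrow> real) \<Rightarrow> complex mat \<Rightarrow> complex" where
  "weighted_trace n w Y = (\<Sum>i<n. of_real (w i) * Y $$ (i, i))"

text \<open>The order on complex numbers makes each value of the quadratic form real; that the
  matrix is Hermitian is then a consequence, \<open>psd_herm\<close>.\<close>

definition psd :: "nat \<Rightarrow> complex mat \<Rightarrow> bool" where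
  "psd n M \<longleftrightarrow> M \<in> carrier_mat n n \<and> (\<forall>x \<in> carrier_vec n. 0 \<le> ip x (M *\<^sub>v x))"

lemma refl_nonneg:
  fixes c :: complex
  assumes "\<And>z. cmod z = 1 \<Longrightarrow> 0 \<le> Re ((1 - z) * c)"
  shows "0 \<le> c"
proof -
  have re: "0 \<le> Re c" using assms[of "-1"] by simp
  have *: "0 \<le> s\<^sup>2 * Re c + s * Im c" for s :: real
  proof -
    \<comment> \<open>Rational parametrisation of the unit circle. To first order 1 - z is -2 i s,
      so the sign of s probes the imaginary part of c.\<close>
    define z where "z = Complex (1 - s\<^sup>2) (2 * s) / of_real (1 + s\<^sup>2)"
    have p: "1 + s\<^sup>2 > 0" by (simp add: add_pos_nonneg)
    have "(1 - s\<^sup>2)\<^sup>2 + (2*s)\<^sup>2 = (1 + s\<^sup>2)\<^sup>2" by (simp add: power2_eq_square algebra_simps)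
    hence "cmod (Complex (1 - s\<^sup>2) (2 * s)) = 1 + s\<^sup>2"
      using p by (simp add: cmod_def)
    hence "cmod z = 1" using p unfolding z_def norm_divide norm_of_real by simp
    from assms[OF this] have "0 \<le> Re ((1 - z) * c) * (1 + s\<^sup>2)" using p by simp
    also have "\<dots> = Re (((1 - z) * of_real (1 + s\<^sup>2)) * c)" by (simp add: algebra_simps)
    also have "(1 - z) * of_real (1 + s\<^sup>2) = Complex (2 * s\<^sup>2) (- 2 * s)"
    proof -
      have "z * of_real (1 + s\<^sup>2) = Complex (1 - s\<^sup>2) (2 * s)" 
        using p unfolding z_def by (metis less_irrefl nonzero_eq_divide_eq of_real_eq_0_iff)
      thus ?thesis by (simp add: left_diff_distrib complex_eq_iff)
    qed
    finally show ?thesis by (simp add: algebra_simps)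
  qed
  have "Im c = 0"
  proof (rule ccontr)
    assume ne: "Im c \<noteq> 0"
    \<comment> \<open>Close to the minimiser of the quadratic in s; the \<open>+ 1\<close> keeps the
      denominator positive when Re c = 0.\<close>
    define s where "s = - Im c / (2 * (Re c + 1))"
    have p: "Re c + 1 > 0" using re by simp
    have "s\<^sup>2 * Re c + s * Im c = (Im c)\<^sup>2 * (Re c / (4 * (Re c + 1)\<^sup>2) - 1 / (2 * (Re c + 1)))"
      by (simp add: s_def power2_eq_square algebra_simps)
    also have "Re c / (4 * (Re c + 1)\<^sup>2) - 1 / (2 * (Re c + 1)) = (- Re c - 2) / (4 * (Re c + 1)\<^sup>2)"
      using p by (simp add: divide_simps power2_eq_square) (simp add: algebra_simps)
    also have "(Im c)\<^sup>2 * \<dots> < 0" using p re ne by (intro mult_pos_neg divide_neg_pos) auto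
    finally show False using *[of s] by simp
  qed
  thus ?thesis using re by (simp add: less_eq_complex_def)
qed

definition diagm :: "nat \<Rightarrow> (nat \<Rightarrow> complex) \<Rightarrow> complex mat" where
  "diagm n d = mat n n (\<lambda>(i, j). if i = j then d i else 0)"

lemma diagm_carrier [simp]: "diagm n d \<in> carrier_mat n n"
  by (simp add: diagm_def)

lemma dim_diagm [simp]: "dim_row (diagm n d) = n" "dim_col (diagm n d) = n"
  by (simp_all add: diagm_def)

lemma diagm_index [simp]: "i < n \<Longrightarrow> j < n \<Longrightarrow> diagm n d $$ (i, j) = (if i = j then d i else 0)"
  by (simp add: diagm_def)

lemma diagm_mult_left:
  assumes "Y \<in> carrier_mat n m" "i < n" "j < m"
  shows "(diagm n d * Y) $$ (i, j) = d i * Y $$ (i, j)"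
proof -
  have "(diagm n d * Y) $$ (i, j) = (\<Sum>l<n. diagm n d $$ (i, l) * Y $$ (l, j))"
    using assms by (intro mult_mat_index[of _ n n _ m]) auto
  also have "\<dots> = (\<Sum>l<n. if l = i then d i * Y $$ (i, j) else 0)"
    using assms by (intro sum.cong) auto
  finally show ?thesis using assms by simp
qed

lemma diagm_mult_right:
  assumes "Y \<in> carrier_mat m n" "i < m" "j < n"
  shows "(Y * diagm n d) $$ (i, j) = Y $$ (i, j) * d j"
proof -
  have "(Y * diagm n d) $$ (i, j) = (\<Sum>l<n. Y $$ (i, l) * diagm n d $$ (l, j))"
    using assms by (intro mult_mat_index[of _ m n _ n]) auto
  also have "\<dots> = (\<Sum>l<n. if l = j then Y $$ (i, j) * d j else 0)"
    using assms by (intro sum.cong) auto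
  finally show ?thesis using assms by simp
qed

lemma ip_mult_mat:
  assumes "M \<in> carrier_mat n n" "x \<in> carrier_vec n" "y \<in> carrier_vec n"
  shows "ip x (M *\<^sub>v y) = (\<Sum>i<n. \<Sum>j<n. cnj (x $ i) * (M $$ (i, j) * y $ j))"
  using assms by (auto simp: ip_carrier[where n=n] mult_mat_vec_index[of _ n n] sum_distrib_left)

lemma psdD: "psd n M \<Longrightarrow> M \<in> carrier_mat n n" "psd n M \<Longrightarrow> x \<in> carrier_vec n \<Longrightarrow> 0 \<le> ip x (M *\<^sub>v x)"
  by (auto simp: psd_def)

text \<open>Reflections are unitary only along unit vectors, so optimality yields information about
  those; scaling does the rest.\<close>

lemma psdI_unit:
  assumes M: "M \<in> carrier_mat n n"
    and unit: "\<And>x. \<lbrakk>x \<in> carrier_vec n; ip x x = 1\<rbrakk> \<Longrightarrow> 0 \<le> ip x (M *\<^sub>v x)"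
  shows "psd n M"
  unfolding psd_def
proof (intro conjI ballI M)
  fix x :: "complex vec" assume x: "x \<in> carrier_vec n"
  define s where "s = sqrt (\<Sum>i<dim_vec x. (cmod (x $ i))\<^sup>2)"
  have s2: "ip x x = of_real (s\<^sup>2)"
    unfolding ip_self s_def by (subst real_sqrt_pow2) (auto intro: sum_nonneg)
  show "0 \<le> ip x (M *\<^sub>v x)"
  proof (cases "s = 0")
    case True
    hence "x = 0\<^sub>v n" using ip_self_eq_0[OF x] s2 by simp
    thus ?thesis using M x by (simp add: ip_mult_mat[OF M])
  next
    case False
    define y where "y = of_real (1 / s) \<cdot>\<^sub>v x"
    have y: "y \<in> carrier_vec n" using x by (simp add: y_def)
    have xy: "x = of_real s \<cdot>\<^sub>v y" using x False by (auto simp: y_def smult_smult_assoc simp flip: of_real_mult)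
    have "of_real (s\<^sup>2) * ip y y = ip x x"
      by (subst (1 2) xy) (use y in \<open>simp add: ip_smult_right ip_smult_left[of _ n] power2_eq_square\<close>)
    hence "ip y y = 1" using s2 False by simp
    from unit[OF y this] have "0 \<le> ip y (M *\<^sub>v y)" .
    moreover have "ip x (M *\<^sub>v x) = of_real (s\<^sup>2) * ip y (M *\<^sub>v y)"
      using y M by (subst (1 2) xy)
        (simp add: mult_mat_vec[OF M] ip_smult_right ip_smult_left[of _ n] power2_eq_square)
    ultimately show ?thesis by (simp add: less_eq_complex_def)
  qed
qed

text \<open>Cyclicity of the trace: a reflection on the left of \<open>Y\<close> tests the matrix Y
  D, one on the right tests D Y.\<close>

lemma weighted_trace_refl_left:
  assumes Y: "Y \<in> carrier_mat n n" and x: "x \<in> carrier_vec n"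
  shows "weighted_trace n w (refl_mat n x z * Y) = weighted_trace n w Y - (1 - z) * ip x ((Y * diagm n (\<lambda>i. of_real (w i))) *\<^sub>v x)"
proof -
  have e: "(refl_mat n x z * Y) $$ (i, i) = Y $$ (i, i) - (1 - z) * (\<Sum>l<n. x $ i * cnj (x $ l) * Y $$ (l, i))"
    if i: "i < n" for i
  proof -
    have "(refl_mat n x z * Y) $$ (i, i) = (\<Sum>l<n. (if l = i then Y $$ (i, i) else 0) - (1 - z) * (x $ i * cnj (x $ l) * Y $$ (l, i)))"
      using i Y by (subst mult_mat_index[of _ n n _ n]) (auto simp: refl_mat_def algebra_simps intro!: sum.cong)
    thus ?thesis using i by (simp add: sum_subtractf flip: sum_distrib_left)
  qed
  have "weighted_trace n w (refl_mat n x z * Y) = weighted_trace n w Y - (1 - z) * (\<Sum>i<n. \<Sum>l<n. of_real (w i) * (x $ i * cnj (x $ l) * Y $$ (l, i)))"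
    by (simp add: weighted_trace_def e sum_subtractf sum_distrib_left algebra_simps)
  also have "(\<Sum>i<n. \<Sum>l<n. of_real (w i) * (x $ i * cnj (x $ l) * Y $$ (l, i))) = ip x ((Y * diagm n (\<lambda>i. of_real (w i))) *\<^sub>v x)"
    using x Y by (subst sum.swap, subst ip_mult_mat[of _ n])
      (auto simp: diagm_mult_right[of _ n] algebra_simps intro!: sum.cong)
  finally show ?thesis .
qed

lemma weighted_trace_refl_right:
  assumes Y: "Y \<in> carrier_mat n n" and x: "x \<in> carrier_vec n"
  shows "weighted_trace n w (Y * refl_mat n x z) = weighted_trace n w Y - (1 - z) * ip x ((diagm n (\<lambda>i. of_real (w i)) * Y) *\<^sub>v x)"
proof -
  have e: "(Y * refl_mat n x z) $$ (i, i) = Y $$ (i, i) - (1 - z) * (\<Sum>l<n. cnj (x $ i) * x $ l * Y $$ (i, l))"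
    if i: "i < n" for i
  proof -
    have "(Y * refl_mat n x z) $$ (i, i) = (\<Sum>l<n. (if l = i then Y $$ (i, i) else 0) - (1 - z) * (cnj (x $ i) * x $ l * Y $$ (i, l)))"
      using i Y by (subst mult_mat_index[of _ n n _ n]) (auto simp: refl_mat_def algebra_simps intro!: sum.cong)
    thus ?thesis using i by (simp add: sum_subtractf flip: sum_distrib_left)
  qed
  have "weighted_trace n w (Y * refl_mat n x z) = weighted_trace n w Y - (1 - z) * (\<Sum>i<n. \<Sum>l<n. of_real (w i) * (cnj (x $ i) * x $ l * Y $$ (i, l)))"
    by (simp add: weighted_trace_def e sum_subtractf sum_distrib_left algebra_simps)
  also have "(\<Sum>i<n. \<Sum>l<n. of_real (w i) * (cnj (x $ i) * x $ l * Y $$ (i, l))) = ip x ((diagm n (\<lambda>i. of_real (w i)) * Y) *\<^sub>v x)"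
    using x Y by (subst ip_mult_mat[of _ n])
      (auto simp: diagm_mult_left[of _ n] algebra_simps intro!: sum.cong mult_carrier_mat[of _ n n])
  finally show ?thesis .
qed

text \<open>Optimality against the reflections \<open>I - (1 - z) x x\<^sup>*\<close> says \<open>Re ((1 - z) x\<^sup>* M x) \<ge> 0\<close> for all
  \<open>|z| = 1\<close>, which forces \<open>x\<^sup>* M x \<ge> 0\<close>.\<close>

lemma opt_psd_left:
  assumes Y: "Y \<in> carrier_mat n n"
    and opt: "\<And>G. unitary_mat n G \<Longrightarrow> Re (weighted_trace n w (G * Y)) \<le> Re (weighted_trace n w Y)"
  shows "psd n (Y * diagm n (\<lambda>i. of_real (w i)))"
proof (rule psdI_unit)
  fix x :: "complex vec" assume x: "x \<in> carrier_vec n" "ip x x = 1"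
  show "0 \<le> ip x ((Y * diagm n (\<lambda>i. of_real (w i))) *\<^sub>v x)"
  proof (rule refl_nonneg)
    fix z :: complex assume "cmod z = 1"
    from opt[OF unitary_refl_mat[OF x this]]
    show "0 \<le> Re ((1 - z) * ip x ((Y * diagm n (\<lambda>i. of_real (w i))) *\<^sub>v x))"
      unfolding weighted_trace_refl_left[OF Y x(1)] by simp
  qed
qed (use Y in \<open>auto intro!: mult_carrier_mat[of _ n n]\<close>)

lemma opt_psd_right:
  assumes Y: "Y \<in> carrier_mat n n"
    and opt: "\<And>G. unitary_mat n G \<Longrightarrow> Re (weighted_trace n w (Y * G)) \<le> Re (weighted_trace n w Y)"
  shows "psd n (diagm n (\<lambda>i. of_real (w i)) * Y)"
proof (rule psdI_unit)
  fix x :: "complex vec" assume x: "x \<in> carrier_vec n" "ip x x = 1"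
  show "0 \<le> ip x ((diagm n (\<lambda>i. of_real (w i)) * Y) *\<^sub>v x)"
  proof (rule refl_nonneg)
    fix z :: complex assume "cmod z = 1"
    from opt[OF unitary_refl_mat[OF x this]]
    show "0 \<le> Re ((1 - z) * ip x ((diagm n (\<lambda>i. of_real (w i)) * Y) *\<^sub>v x))"
      unfolding weighted_trace_refl_right[OF Y x(1)] by simp
  qed
qed (use Y in \<open>auto intro!: mult_carrier_mat[of _ n n]\<close>)

lemma mult_unit_vec:
  fixes M :: "complex mat"
  assumes "M \<in> carrier_mat a b" "j < b"
  shows "M *\<^sub>v unit_vec b j = col M j"
proof (intro eq_vecI)
  fix i assume "i < dim_vec (col M j)"
  hence i: "i < a" using assms by simp
  have "(M *\<^sub>v unit_vec b j) $ i = (\<Sum>l<b. M $$ (i, l) * unit_vec b j $ l)"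
    using assms i by (intro mult_mat_vec_index[of _ a b]) auto
  also have "\<dots> = (\<Sum>l<b. if l = j then M $$ (i, j) else 0)"
    using assms i by (intro sum.cong) (auto simp: unit_vec_def)
  finally show "(M *\<^sub>v unit_vec b j) $ i = col M j $ i" using assms i by simp
qed (use assms in auto)

lemma psd_diag:
  assumes "psd n M" "i < n"
  shows "0 \<le> M $$ (i, i)"
  using psdD(2)[OF assms(1), of "unit_vec n i"] psdD(1)[OF assms(1)] assms(2)
  by (simp add: mult_unit_vec[of _ n] ip_unit_left)

lemma psd_herm:
  assumes "psd n M" "i < n" "j < n"
  shows "M $$ (j, i) = cnj (M $$ (i, j))"
proof -
  note M = psdD(1)[OF assms(1)]
  have ex: "ip (unit_vec n i + t \<cdot>\<^sub>v unit_vec n j) (M *\<^sub>v (unit_vec n i + t \<cdot>\<^sub>v unit_vec n j))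
      = M $$ (i,i) + t * M $$ (i, j) + cnj t * M $$ (j, i) + cnj t * t * M $$ (j, j)" for t
    using M assms
    by (simp add: mult_add_distrib_mat_vec[of _ n n] mult_mat_vec[of _ n n] mult_unit_vec[of _ n]
        ip_add_right[of _ n] ip_add_left[of _ n] ip_smult_left[of _ n] ip_smult_right ip_unit_left algebra_simps)
  have nn: "0 \<le> M $$ (i,i) + t * M $$ (i, j) + cnj t * M $$ (j, i) + cnj t * t * M $$ (j, j)" for t
    using psdD(2)[OF assms(1), of "unit_vec n i + t \<cdot>\<^sub>v unit_vec n j"] unfolding ex by simp
  have d: "Im (M $$ (i, i)) = 0" "Im (M $$ (j, j)) = 0"
    using psd_diag[OF assms(1,2)] psd_diag[OF assms(1,3)] by (simp_all add: less_eq_complex_def)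
  \<comment> \<open>The values t = 1 and t = i give the two real equations Im (m_ij + m_ji) = 0 and
    Re (m_ij - m_ji) = 0.\<close>
  have "Im (M $$ (i,i) + 1 * M $$ (i, j) + cnj 1 * M $$ (j, i) + cnj 1 * 1 * M $$ (j, j)) = 0"
    using nn[of 1] unfolding less_eq_complex_def by (metis zero_complex.simps(2))
  moreover have "Im (M $$ (i,i) + \<i> * M $$ (i, j) + cnj \<i> * M $$ (j, i) + cnj \<i> * \<i> * M $$ (j, j)) = 0"
    using nn[of \<i>] unfolding less_eq_complex_def by (metis zero_complex.simps(2))
  ultimately show ?thesis using d by (simp add: complex_eq_iff)
qed

lemma psd_adjoint:
  assumes "psd n M"
  shows "mat_adjoint M = M"
proof (intro eq_matI)
  fix i j assume "i < dim_row M" "j < dim_col M"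
  thus "mat_adjoint M $$ (i, j) = M $$ (i, j)"
    using psdD(1)[OF assms] psd_herm[OF assms, of j i] by simp
qed (use psdD(1)[OF assms] in auto)

text \<open>Along x + t M x the form equals 2 t |M x|^2 plus a term of second order, so a small
  negative t would make it negative unless M x = 0.\<close>

lemma psd_ip_zero:
  assumes M: "psd n M" and x: "x \<in> carrier_vec n" and z: "ip x (M *\<^sub>v x) = 0"
  shows "M *\<^sub>v x = 0\<^sub>v n"
proof -
  note Mc = psdD(1)[OF M]
  define y where "y = M *\<^sub>v x"
  have y: "y \<in> carrier_vec n" using Mc x by (simp add: y_def)
  have xy: "ip x (M *\<^sub>v y) = ip y y"
    using Mc x y psd_adjoint[OF M] by (subst ip_adjoint[of _ n n]) (auto simp: y_def)
  have ex: "ip (x + of_real t \<cdot>\<^sub>v y) (M *\<^sub>v (x + of_real t \<cdot>\<^sub>v y)) = 2 * of_real t * ip y y + of_real (t\<^sup>2) * ip y (M *\<^sub>v y)" for t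
    using Mc x y z xy
    by (simp add: mult_add_distrib_mat_vec[of _ n n] mult_mat_vec[of _ n n]
        ip_add_right[of _ n] ip_add_left[of _ n] ip_smult_left[of _ n] ip_smult_right algebra_simps power2_eq_square)
       (simp add: y_def)
  define a where "a = Re (ip y y)"
  define b where "b = Re (ip y (M *\<^sub>v y))"
  have b: "b \<ge> 0" using psdD(2)[OF M y] by (simp add: b_def less_eq_complex_def)
  have a: "a \<ge> 0" by (simp add: a_def ip_self sum_nonneg)
  have "0 \<le> 2 * t * a + t\<^sup>2 * b" for t
    using psdD(2)[OF M, of "x + of_real t \<cdot>\<^sub>v y"] x y unfolding ex a_def b_def by (simp add: less_eq_complex_def)
  note nonneg = this
  have "a = 0"
  proof (rule ccontr)
    assume "a \<noteq> 0"
    hence a0: "a > 0" using a by simp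
    \<comment> \<open>Nearly the minimiser -a / b of the quadratic, with \<open>+ 1\<close> to allow
      b = 0.\<close>
    define t where "t = - a / (b + 1)"
    have t: "t * (b + 1) = - a" "t < 0" using a0 b by (auto simp: t_def divide_neg_pos)
    have "2 * t * a + t\<^sup>2 * b = t * (2 * a + (t * (b + 1) - t))" by (simp add: algebra_simps power2_eq_square)
    also have "\<dots> = t * (a - t)" unfolding t(1) by simp
    also have "\<dots> < 0" using t a0 by (intro mult_neg_pos) auto
    finally show False using nonneg[of t] by simp
  qed
  hence "ip y y = 0" unfolding a_def ip_self by simp
  thus ?thesis using ip_self_eq_0[OF y] by (simp add: y_def)
qed

section \<open>Sequential compactness of the unitary group\<close>

lemma real_bounded_subseq:
  fixes f :: "nat \<Rightarrow> real"
  assumes "\<And>n. \<bar>f n\<bar> \<le> B"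
  shows "\<exists>r l. strict_mono r \<and> (\<lambda>n. f (r n)) \<longlonglongrightarrow> l"
proof -
  obtain g where g: "strict_mono g" "monoseq (\<lambda>n. f (g n))" using seq_monosub by metis
  have "Bseq (\<lambda>n. f (g n))" using assms by (intro BseqI'[of _ B]) auto
  with g show ?thesis using Bseq_monoseq_convergent unfolding convergent_def by blast
qed

lemma complex_bounded_subseq:
  fixes f :: "nat \<Rightarrow> complex"
  assumes "\<And>n. cmod (f n) \<le> B"
  shows "\<exists>r l. strict_mono r \<and> (\<lambda>n. f (r n)) \<longlonglongrightarrow> l"
proof -
  have "\<bar>Re (f n)\<bar> \<le> B" "\<bar>Im (f n)\<bar> \<le> B" for n
    using abs_Re_le_cmod[of "f n"] abs_Im_le_cmod[of "f n"] assms[of n] by linarith+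
  then obtain r a where r: "strict_mono r" "(\<lambda>n. Re (f (r n))) \<longlonglongrightarrow> a"
    using real_bounded_subseq[of "\<lambda>n. Re (f n)"] by blast
  from \<open>\<And>n. \<bar>Im (f n)\<bar> \<le> B\<close> obtain q b where q: "strict_mono q" "(\<lambda>n. Im (f (r (q n)))) \<longlonglongrightarrow> b"
    using real_bounded_subseq[of "\<lambda>n. Im (f (r n))" B] by blast
  have "(\<lambda>n. Re (f (r (q n)))) \<longlonglongrightarrow> a" using LIMSEQ_subseq_LIMSEQ[OF r(2) q(1)] by (simp add: o_def)
  hence "(\<lambda>n. f (r (q n))) \<longlonglongrightarrow> Complex a b" using q(2) by (intro tendsto_complex_iff[THEN iffD2]) auto
  moreover have "strict_mono (r \<circ> q)" using r q by (simp add: strict_mono_o)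
  ultimately show ?thesis by (auto simp: o_def)
qed

text \<open>All entries of a matrix have to converge along one and the same subsequence, so
  subsequences are extracted successively, one index at a time.\<close>

lemma family_bounded_subseq:
  fixes f :: "'i \<Rightarrow> nat \<Rightarrow> complex"
  assumes "finite I" "\<And>i n. i \<in> I \<Longrightarrow> cmod (f i n) \<le> B"
  shows "\<exists>r l. strict_mono r \<and> (\<forall>i\<in>I. (\<lambda>n. f i (r n)) \<longlonglongrightarrow> l i)"
  using assms
proof (induction I rule: finite_induct)
  case empty
  show ?case by (intro exI[of _ id]) (auto simp: strict_mono_def)
next
  case (insert a I)
  then obtain r l where r: "strict_mono r" "\<forall>i\<in>I. (\<lambda>n. f i (r n)) \<longlonglongrightarrow> l i" by auto
  obtain q b where q: "strict_mono q" "(\<lambda>n. f a (r (q n))) \<longlonglongrightarrow> b"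
    using complex_bounded_subseq[of "\<lambda>n. f a (r n)" B] insert.prems by blast
  have "(\<lambda>n. f i (r (q n))) \<longlonglongrightarrow> l i" if "i \<in> I" for i
    using LIMSEQ_subseq_LIMSEQ[OF _ q(1), of "\<lambda>n. f i (r n)"] r that by (auto simp: o_def)
  hence "\<forall>i\<in>insert a I. (\<lambda>n. f i ((r \<circ> q) n)) \<longlonglongrightarrow> (l(a := b)) i"
    using q insert.hyps by auto
  moreover have "strict_mono (r \<circ> q)" using r q by (simp add: strict_mono_o)
  ultimately show ?case by blast
qed

definition mat_lim :: "nat \<Rightarrow> (nat \<Rightarrow> complex mat) \<Rightarrow> complex mat \<Rightarrow> bool" where
  "mat_lim n S L \<longleftrightarrow> (\<forall>k. S k \<in> carrier_mat n n) \<and> L \<in> carrier_mat n n \<and>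
     (\<forall>i<n. \<forall>j<n. (\<lambda>k. S k $$ (i, j)) \<longlonglongrightarrow> L $$ (i, j))"

lemma mat_lim_const: "X \<in> carrier_mat n n \<Longrightarrow> mat_lim n (\<lambda>_. X) X"
  by (auto simp: mat_lim_def)

lemma mat_lim_mult:
  assumes "mat_lim n S L" "mat_lim n S' L'"
  shows "mat_lim n (\<lambda>k. S k * S' k) (L * L')"
proof -
  have c: "S k \<in> carrier_mat n n" "S' k \<in> carrier_mat n n" "L \<in> carrier_mat n n" "L' \<in> carrier_mat n n" for k
    using assms by (auto simp: mat_lim_def)
  show ?thesis unfolding mat_lim_def
  proof (intro conjI allI impI)
    fix i j assume ij: "i < n" "j < n"
    show "(\<lambda>k. (S k * S' k) $$ (i, j)) \<longlonglongrightarrow> (L * L') $$ (i, j)"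
      unfolding mult_mat_index[OF c(1,2) ij] mult_mat_index[OF c(3,4) ij]
      using assms ij by (intro tendsto_sum tendsto_mult) (auto simp: mat_lim_def)
  qed (use c in auto)
qed

lemma mat_lim_adjoint: "mat_lim n S L \<Longrightarrow> mat_lim n (\<lambda>k. mat_adjoint (S k)) (mat_adjoint L)"
  unfolding mat_lim_def by (auto intro!: tendsto_cnj simp: carrier_matD[of _ n n])

lemma mat_lim_subseq:
  assumes "mat_lim n S L" "strict_mono r"
  shows "mat_lim n (\<lambda>k. S (r k)) L"
  using assms LIMSEQ_subseq_LIMSEQ[OF _ assms(2)] unfolding mat_lim_def by (fastforce simp: o_def)

lemma unitary_lim:
  assumes "mat_lim n S L" "\<And>k. unitary_mat n (S k)"
  shows "unitary_mat n L"
proof (rule unitary_matI)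
  show L: "L \<in> carrier_mat n n" using assms by (auto simp: mat_lim_def)
  have *: "mat_lim n (\<lambda>k. mat_adjoint (S k) * S k) (mat_adjoint L * L)"
    using assms by (intro mat_lim_mult mat_lim_adjoint)
  show "mat_adjoint L * L = 1\<^sub>m n"
  proof (intro eq_matI)
    fix i j assume ij: "i < dim_row (1\<^sub>m n :: complex mat)" "j < dim_col (1\<^sub>m n :: complex mat)"
    hence "(\<lambda>k. (mat_adjoint (S k) * S k) $$ (i, j)) \<longlonglongrightarrow> (mat_adjoint L * L) $$ (i, j)"
      using * by (auto simp: mat_lim_def)
    moreover have "(\<lambda>k. (mat_adjoint (S k) * S k) $$ (i, j)) \<longlonglongrightarrow> 1\<^sub>m n $$ (i, j)"
      using unitary_matD(2)[OF assms(2)] by simp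
    ultimately show "(mat_adjoint L * L) $$ (i, j) = 1\<^sub>m n $$ (i, j)" by (rule LIMSEQ_unique)
  qed (use L in auto)
qed

lemma unitary_subseq:
  fixes S :: "nat \<Rightarrow> complex mat"
  assumes "\<And>k. unitary_mat n (S k)"
  shows "\<exists>r L. strict_mono r \<and> unitary_mat n L \<and> mat_lim n (\<lambda>k. S (r k)) L"
proof -
  have "\<exists>r l. strict_mono r \<and> (\<forall>p\<in>{..<n}\<times>{..<n}. (\<lambda>k. S (r k) $$ p) \<longlonglongrightarrow> l p)"
    by (rule family_bounded_subseq[of _ "\<lambda>p k. S k $$ p" 1]) (auto intro: unitary_entry_bound[OF assms])
  then obtain r l where r: "strict_mono r" "\<forall>p\<in>{..<n}\<times>{..<n}. (\<lambda>k. S (r k) $$ p) \<longlonglongrightarrow> l p" by blast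
  have "mat_lim n (\<lambda>k. S (r k)) (mat n n l)"
    using r unitary_matD(1)[OF assms] unfolding mat_lim_def by auto
  with unitary_lim[OF this assms] r show ?thesis by blast
qed

lemma unitary_pair_subseq:
  fixes S T :: "nat \<Rightarrow> complex mat"
  assumes "\<And>k. unitary_mat n (S k)" "\<And>k. unitary_mat n (T k)"
  shows "\<exists>r L M. strict_mono r \<and> unitary_mat n L \<and> unitary_mat n M \<and> mat_lim n (\<lambda>k. S (r k)) L \<and> mat_lim n (\<lambda>k. T (r k)) M"
proof -
  obtain r L where r: "strict_mono r" "unitary_mat n L" "mat_lim n (\<lambda>k. S (r k)) L" using unitary_subseq[of n S] assms by blast
  obtain q M where q: "strict_mono q" "unitary_mat n M" "mat_lim n (\<lambda>k. T (r (q k))) M"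
    using unitary_subseq[of n "\<lambda>k. T (r k)"] assms by blast
  have "mat_lim n (\<lambda>k. S (r (q k))) L" by (rule mat_lim_subseq[OF r(3) q(1)])
  moreover have "strict_mono (\<lambda>k. r (q k))" using r q by (simp add: strict_mono_def)
  ultimately show ?thesis using r q by blast
qed

lemma weighted_trace_lim: "mat_lim n S L \<Longrightarrow> (\<lambda>k. weighted_trace n w (S k)) \<longlonglongrightarrow> weighted_trace n w L"
  unfolding weighted_trace_def mat_lim_def by (intro tendsto_sum tendsto_mult) auto

text \<open>A crude bound that does not depend on \<open>U\<close> and \<open>V\<close>; it makes
  the supremum in the next lemma finite.\<close>

lemma cmod_mult3_le:
  assumes U: "unitary_mat n U" and V: "unitary_mat n V" and X: "X \<in> carrier_mat n n" and ij: "i < n" "j < n"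
  shows "cmod ((U * X * V) $$ (i, j)) \<le> (\<Sum>l<n. \<Sum>k<n. cmod (X $$ (k, l)))"
proof -
  note c = unitary_matD(1)[OF U] unitary_matD(1)[OF V] X
  have "(U * X * V) $$ (i, j) = (\<Sum>l<n. (\<Sum>k<n. U $$ (i, k) * X $$ (k, l)) * V $$ (l, j))"
    using c ij by (subst mult_mat_index[of _ n n _ n]) (auto simp: mult_mat_index[of _ n n _ n] intro!: mult_carrier_mat[of _ n n])
  also have "cmod \<dots> \<le> (\<Sum>l<n. \<Sum>k<n. cmod (X $$ (k, l)))"
  proof (intro order.trans[OF norm_sum] sum_mono)
    fix l assume l: "l \<in> {..<n}"
    have "cmod ((\<Sum>k<n. U $$ (i, k) * X $$ (k, l)) * V $$ (l, j)) \<le> cmod (\<Sum>k<n. U $$ (i, k) * X $$ (k, l)) * 1"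
      unfolding norm_mult using unitary_entry_bound[OF V, of l j] l ij by (intro mult_left_mono) auto
    also have "\<dots> \<le> (\<Sum>k<n. cmod (X $$ (k, l)))"
      unfolding mult_1_right
    proof (intro order.trans[OF norm_sum] sum_mono)
      fix k assume "k \<in> {..<n}"
      thus "cmod (U $$ (i, k) * X $$ (k, l)) \<le> cmod (X $$ (k, l))"
        using unitary_entry_bound[OF U, of i k] ij by (simp add: norm_mult mult_left_le_one_le)
    qed
    finally show "cmod ((\<Sum>k<n. U $$ (i, k) * X $$ (k, l)) * V $$ (l, j)) \<le> (\<Sum>k<n. cmod (X $$ (k, l)))" .
  qed
  finally show ?thesis .
qed

text \<open>A continuous function on the compact set of pairs of unitary matrices attains its
  supremum: a limit of a maximising sequence is a maximiser.\<close>

lemma weighted_trace_max_exists: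
  assumes X: "X \<in> carrier_mat n n"
  shows "\<exists>U V. unitary_mat n U \<and> unitary_mat n V \<and>
     (\<forall>U' V'. unitary_mat n U' \<longrightarrow> unitary_mat n V' \<longrightarrow> Re (weighted_trace n w (U' * X * V')) \<le> Re (weighted_trace n w (U * X * V)))"
proof -
  define S where "S = {Re (weighted_trace n w (U * X * V)) | U V. unitary_mat n U \<and> unitary_mat n V}"
  define C where "C = (\<Sum>l<n. \<Sum>k<n. cmod (X $$ (k, l)))"
  have ne: "S \<noteq> {}" using unitary_one by (auto simp: S_def)
  have "s \<le> (\<Sum>i<n. \<bar>w i\<bar> * C)" if "s \<in> S" for s
  proof -
    from that obtain U V where UV: "s = Re (weighted_trace n w (U * X * V))" "unitary_mat n U" "unitary_mat n V" by (auto simp: S_def)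
    have "s \<le> cmod (weighted_trace n w (U * X * V))" unfolding UV by (rule complex_Re_le_cmod)
    also have "\<dots> \<le> (\<Sum>i<n. \<bar>w i\<bar> * C)" unfolding weighted_trace_def C_def
      using cmod_mult3_le[OF UV(2,3) X]
      by (intro order.trans[OF norm_sum] sum_mono) (auto simp: norm_mult intro!: mult_left_mono)
    finally show ?thesis .
  qed
  hence bdd: "bdd_above S" by (rule bdd_aboveI)
  have "\<exists>U V. unitary_mat n U \<and> unitary_mat n V \<and> Sup S - 1 / real (Suc k) < Re (weighted_trace n w (U * X * V))" for k
  proof -
    have "Sup S - 1 / real (Suc k) < Sup S" by simp
    then obtain s where "s \<in> S" "Sup S - 1 / real (Suc k) < s" using less_cSup_iff[OF ne bdd] by blast
    thus ?thesis by (auto simp: S_def)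
  qed
  then obtain A B where AB: "\<And>k. unitary_mat n (A k)" "\<And>k. unitary_mat n (B k)"
    "\<And>k. Sup S - 1 / real (Suc k) < Re (weighted_trace n w (A k * X * B k))" by metis
  obtain r U V where r: "strict_mono r" "unitary_mat n U" "unitary_mat n V"
    "mat_lim n (\<lambda>k. A (r k)) U" "mat_lim n (\<lambda>k. B (r k)) V"
    using unitary_pair_subseq[of n A B] AB by blast
  have lim: "(\<lambda>k. Re (weighted_trace n w (A (r k) * X * B (r k)))) \<longlonglongrightarrow> Re (weighted_trace n w (U * X * V))"
    by (intro tendsto_Re weighted_trace_lim mat_lim_mult mat_lim_const r X)
  have "(\<lambda>k. Sup S - 1 / real (Suc k)) \<longlonglongrightarrow> Sup S - 0"
    by (intro tendsto_diff tendsto_const LIMSEQ_Suc[OF lim_1_over_n])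
  from LIMSEQ_subseq_LIMSEQ[OF this r(1)] have "(\<lambda>k. Sup S - 1 / real (Suc (r k))) \<longlonglongrightarrow> Sup S" by (simp add: o_def)
  from LIMSEQ_le[OF this lim] have le: "Sup S \<le> Re (weighted_trace n w (U * X * V))"
    using AB(3) less_imp_le by blast
  show ?thesis
  proof (intro exI conjI allI impI)
    fix U' V' assume "unitary_mat n U'" "unitary_mat n V'"
    hence "Re (weighted_trace n w (U' * X * V')) \<in> S" by (auto simp: S_def)
    from cSup_upper[OF this bdd] le show "Re (weighted_trace n w (U' * X * V')) \<le> Re (weighted_trace n w (U * X * V))" by simp
  qed (use r in auto)
qed

section \<open>Singular values and Ky Fan norms\<close>

text \<open>A permutation matrix. Here \<open>transpose a b\<close> exchanges two indices; the
  transpose of a matrix is \<open>transpose_mat\<close>.\<close>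

definition swap_mat :: "nat \<Rightarrow> nat \<Rightarrow> nat \<Rightarrow> complex mat" where
  "swap_mat n a b = mat n n (\<lambda>(i, j). if i = transpose a b j then 1 else 0)"

lemma swap_mat_carrier [simp]: "swap_mat n a b \<in> carrier_mat n n"
  by (simp add: swap_mat_def)

lemma transpose_less: "a < n \<Longrightarrow> b < n \<Longrightarrow> i < n \<Longrightarrow> transpose a b i < (n :: nat)"
  by (auto simp: transpose_def)

lemma swap_mat_mult_left:
  assumes "Y \<in> carrier_mat n n" "a < n" "b < n" "i < n" "j < n"
  shows "(swap_mat n a b * Y) $$ (i, j) = Y $$ (transpose a b i, j)"
proof -
  have "(swap_mat n a b * Y) $$ (i, j) = (\<Sum>l<n. swap_mat n a b $$ (i, l) * Y $$ (l, j))"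
    using assms by (intro mult_mat_index[of _ n n _ n]) auto
  also have "\<dots> = (\<Sum>l<n. if l = transpose a b i then Y $$ (l, j) else 0)"
    using assms by (intro sum.cong) (auto simp: swap_mat_def)
  finally show ?thesis using transpose_less[OF assms(2,3,4)] by simp
qed

lemma swap_mat_mult_right:
  assumes "Y \<in> carrier_mat n n" "a < n" "b < n" "i < n" "j < n"
  shows "(Y * swap_mat n a b) $$ (i, j) = Y $$ (i, transpose a b j)"
proof -
  have "(Y * swap_mat n a b) $$ (i, j) = (\<Sum>l<n. Y $$ (i, l) * swap_mat n a b $$ (l, j))"
    using assms by (intro mult_mat_index[of _ n n _ n]) auto
  also have "\<dots> = (\<Sum>l<n. if l = transpose a b j then Y $$ (i, l) else 0)"
    using assms by (intro sum.cong) (auto simp: swap_mat_def)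
  finally show ?thesis using transpose_less[OF assms(2,3,5)] by simp
qed

lemma unitary_swap_mat:
  assumes "a < n" "b < n"
  shows "unitary_mat n (swap_mat n a b)"
proof (rule unitary_matI)
  have "mat_adjoint (swap_mat n a b) = swap_mat n a b"
    by (intro eq_matI) (auto simp: swap_mat_def)
  moreover have "swap_mat n a b * swap_mat n a b = 1\<^sub>m n"
    using assms
    by (intro eq_matI) (auto simp: swap_mat_mult_left[OF swap_mat_carrier] transpose_less,
      auto simp: swap_mat_def transpose_less dest: transpose_eq_imp_eq)
  ultimately show "mat_adjoint (swap_mat n a b) * swap_mat n a b = 1\<^sub>m n" by simp
qed simp

text \<open>The unitary factors stand beside X and not beside the diagonal matrix, because they
  arise as maximisers of a weighted trace of U X V.\<close>

definition is_svd :: "nat \<Rightarrow> complex mat \<Rightarrow> complex mat \<Rightarrow> complex mat \<Rightarrow> (nat \<Rightarrow> real) \<Rightarrow> bool" where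
  "is_svd n X U V \<sigma> \<longleftrightarrow> unitary_mat n U \<and> unitary_mat n V \<and> U * X * V = diagm n (\<lambda>i. complex_of_real (\<sigma> i))
     \<and> (\<forall>i<n. 0 \<le> \<sigma> i) \<and> (\<forall>i j. i \<le> j \<longrightarrow> j < n \<longrightarrow> \<sigma> j \<le> \<sigma> i)"

lemma is_svdD:
  assumes "is_svd n X U V \<sigma>"
  shows "unitary_mat n U" "unitary_mat n V" "U * X * V = diagm n (\<lambda>i. complex_of_real (\<sigma> i))"
    "i < n \<Longrightarrow> 0 \<le> \<sigma> i" "\<lbrakk>i \<le> j; j < n\<rbrakk> \<Longrightarrow> \<sigma> j \<le> \<sigma> i"
  using assms by (simp_all add: is_svd_def)

text \<open>A maximiser \<open>(U, V)\<close> of \<open>Re (tr (D U X V))\<close>, for a diagonal matrix \<open>D\<close> with strictly decreasing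
  positive entries, makes both \<open>U X V D\<close> and \<open>D U X V\<close> positive semidefinite. Hence \<open>U X V\<close> is
  diagonal, and swapping two entries shows that its diagonal is decreasing.\<close>

theorem singular_value_decomposition:
  assumes X: "X \<in> carrier_mat n n"
  shows "\<exists>U V \<sigma>. is_svd n X U V \<sigma>"
proof -
  \<comment> \<open>The weights n, n - 1, ..., 1: being distinct kills the off-diagonal entries,
    being positive makes the diagonal nonnegative, and being decreasing sorts it.\<close>
  define w where "w i = real (n - i)" for i
  define D where "D = diagm n (\<lambda>i. complex_of_real (w i))"
  obtain U V where UV: "unitary_mat n U" "unitary_mat n V"
    and opt: "\<And>U' V'. unitary_mat n U' \<Longrightarrow> unitary_mat n V' \<Longrightarrow> Re (weighted_trace n w (U' * X * V')) \<le> Re (weighted_trace n w (U * X * V))"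
    using weighted_trace_max_exists[OF X, of w] by blast
  define Y where "Y = U * X * V"
  note c = unitary_matD(1)[OF UV(1)] unitary_matD(1)[OF UV(2)] X
  have Y: "Y \<in> carrier_mat n n" using c by (simp add: Y_def)
  have opt2: "Re (weighted_trace n w (G * Y * H)) \<le> Re (weighted_trace n w Y)" if "unitary_mat n G" "unitary_mat n H" for G H
  proof -
    have "G * Y * H = (G * U) * X * (V * H)"
      using c unitary_matD(1)[OF that(1)] unitary_matD(1)[OF that(2)]
      by (simp add: Y_def assoc_mult_mat[of _ n n _ n _ n])
    thus ?thesis using opt[OF unitary_mult[OF that(1) UV(1)] unitary_mult[OF UV(2) that(2)]] by (simp add: Y_def)
  qed
  have L: "psd n (Y * D)" unfolding D_def
  proof (rule opt_psd_left[OF Y])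
    fix G assume G: "unitary_mat n G"
    show "Re (weighted_trace n w (G * Y)) \<le> Re (weighted_trace n w Y)"
      using opt2[OF G unitary_one] unitary_matD(1)[OF G] Y right_mult_one_mat[of "G * Y" n n] by simp
  qed
  have R: "psd n (D * Y)" unfolding D_def
  proof (rule opt_psd_right[OF Y])
    fix G assume G: "unitary_mat n G"
    show "Re (weighted_trace n w (Y * G)) \<le> Re (weighted_trace n w Y)"
      using opt2[OF unitary_one G] unitary_matD(1)[OF G] Y by simp
  qed
  have eL: "Y $$ (j, i) * of_real (w i) = cnj (Y $$ (i, j) * of_real (w j))" if "i < n" "j < n" for i j
    using psd_herm[OF L that] Y that by (simp add: D_def diagm_mult_right)
  have eR: "of_real (w j) * Y $$ (j, i) = cnj (of_real (w i) * Y $$ (i, j))" if "i < n" "j < n" for i j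
    using psd_herm[OF R that] Y that by (simp add: D_def diagm_mult_left)
  have off: "Y $$ (j, i) = 0" if "i < n" "j < n" "i \<noteq> j" for i j
  proof -
    \<comment> \<open>Elimination of the entry (i, j) from the two symmetry conditions leaves Y_ji
      w_i^2 = Y_ji w_j^2.\<close>
    have "Y $$ (j, i) * of_real (w i) * of_real (w i) = of_real (w j) * Y $$ (j, i) * of_real (w j)"
      using eL[OF that(1,2)] eR[OF that(1,2)] by simp
    hence "Y $$ (j, i) * of_real ((w i)\<^sup>2 - (w j)\<^sup>2) = 0" by (simp add: power2_eq_square algebra_simps)
    moreover have "(w i)\<^sup>2 - (w j)\<^sup>2 \<noteq> 0"
      using that by (auto simp: w_def power2_eq_iff_nonneg)
    ultimately show ?thesis by (simp del: of_real_diff)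
  qed
  have digit: "0 \<le> Y $$ (i, i)" if "i < n" for i
  proof -
    have "0 \<le> Y $$ (i, i) * of_real (w i)" using psd_diag[OF L that] Y that by (simp add: D_def diagm_mult_right)
    thus ?thesis using that by (auto simp: less_eq_complex_def w_def zero_le_mult_iff)
  qed
  define \<sigma> where "\<sigma> i = Re (Y $$ (i, i))" for i
  have Yd: "Y = diagm n (\<lambda>i. complex_of_real (\<sigma> i))"
  proof (intro eq_matI)
    fix i j assume "i < dim_row (diagm n (\<lambda>i. complex_of_real (\<sigma> i)))" "j < dim_col (diagm n (\<lambda>i. complex_of_real (\<sigma> i)))"
    thus "Y $$ (i, j) = diagm n (\<lambda>i. complex_of_real (\<sigma> i)) $$ (i, j)"
      using off[of j i] digit[of i] by (auto simp: \<sigma>_def less_eq_complex_def complex_eq_iff)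
  qed (use Y in auto)
  have dec: "\<sigma> b \<le> \<sigma> a" if ab: "a < b" "b < n" for a b
  proof -
    let ?P = "swap_mat n a b"
    have "a < n" using ab by simp
    have P: "(?P * Y * ?P) $$ (i, i) = Y $$ (transpose a b i, transpose a b i)" if "i < n" for i
      using that \<open>a < n\<close> ab Y transpose_less[OF \<open>a < n\<close> ab(2) that]
      by (simp add: swap_mat_mult_right swap_mat_mult_left)
    have "Re (weighted_trace n w (?P * Y * ?P)) \<le> Re (weighted_trace n w Y)"
      using ab by (intro opt2 unitary_swap_mat) auto
    hence "(\<Sum>i<n. w i * \<sigma> (transpose a b i)) \<le> (\<Sum>i<n. w i * \<sigma> i)"
      by (simp add: weighted_trace_def P \<sigma>_def)
    hence "(\<Sum>i<n. w i * (\<sigma> (transpose a b i) - \<sigma> i)) \<le> 0"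
      by (simp add: sum_subtractf algebra_simps)
    also have "(\<Sum>i<n. w i * (\<sigma> (transpose a b i) - \<sigma> i)) = (\<Sum>i\<in>{a, b}. w i * (\<sigma> (transpose a b i) - \<sigma> i))"
      using ab by (intro sum.mono_neutral_right) auto
    also have "\<dots> = (w a - w b) * (\<sigma> b - \<sigma> a)" using ab by (simp add: algebra_simps)
    finally show ?thesis using ab by (simp add: mult_le_0_iff w_def)
  qed
  have "is_svd n X U V \<sigma>" unfolding is_svd_def
  proof (intro conjI allI impI UV)
    show "U * X * V = diagm n (\<lambda>i. complex_of_real (\<sigma> i))" using Yd by (simp only: Y_def)
    show "0 \<le> \<sigma> i" if "i < n" for i using digit[OF that] by (simp add: \<sigma>_def less_eq_complex_def)
    show "\<sigma> j \<le> \<sigma> i" if "i \<le> j" "j < n" for i j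
      using dec[of i j] that by (cases "i = j") auto
  qed
  thus ?thesis by blast
qed

section \<open>Singular values of diagonal matrices and unitary invariance\<close>

lemma char_poly_diagm: "char_poly (diagm n d) = (\<Prod>i<n. [:- d i, 1:])"
proof -
  have "diag_mat (diagm n d) = map d [0..<n]" by (auto simp: diag_mat_def diagm_def intro!: map_cong)
  moreover have "upper_triangular (diagm n d)" by (auto simp: upper_triangular_def diagm_def)
  ultimately show ?thesis
    by (subst char_poly_upper_triangular[of _ n]) (auto simp: prod.list_conv_set_nth lessThan_atLeast0)
qed

lemma adjoint_diagm: "mat_adjoint (diagm n d) = diagm n (\<lambda>i. cnj (d i))"
  by (intro eq_matI) (auto simp: diagm_def)

lemma diagm_mult: "diagm n c * diagm n d = diagm n (\<lambda>i. c i * d i)"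
proof (intro eq_matI)
  fix i j assume "i < dim_row (diagm n (\<lambda>i. c i * d i))" "j < dim_col (diagm n (\<lambda>i. c i * d i))"
  hence "i < n" "j < n" by (auto simp: diagm_def)
  thus "(diagm n c * diagm n d) $$ (i, j) = diagm n (\<lambda>i. c i * d i) $$ (i, j)"
    by (simp add: diagm_mult_left[OF diagm_carrier])
qed (auto simp: diagm_def)

text \<open>As a multiset the singular values do not depend on the order of the diagonal, which is
  what \<open>ky_fan_diagm_transpose\<close> uses.\<close>

lemma singular_values_diagm_mset:
  "singular_values (diagm n d) = rev (sorted_list_of_multiset (image_mset (\<lambda>i. cmod (d i)) (mset_set {..<n})))"
proof -
  have "mat_adjoint (diagm n d) * diagm n d = diagm n (\<lambda>i. complex_of_real ((cmod (d i))\<^sup>2))"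
    unfolding adjoint_diagm diagm_mult complex_norm_square by (simp add: mult.commute)
  hence "proots (char_poly (mat_adjoint (diagm n d) * diagm n d))
      = (\<Sum>i<n. proots [:- complex_of_real ((cmod (d i))\<^sup>2), 1:])"
    by (simp only: char_poly_diagm) (subst proots_prod; simp)
  also have "\<dots> = image_mset (\<lambda>i. complex_of_real ((cmod (d i))\<^sup>2)) (mset_set {..<n})"
    by (induction n) (auto simp: lessThan_Suc)
  finally show ?thesis by (simp add: singular_values_def multiset.map_comp o_def)
qed

lemma singular_values_diagm:
  assumes "\<And>i j. i \<le> j \<Longrightarrow> j < n \<Longrightarrow> cmod (d j) \<le> cmod (d i)"
  shows "singular_values (diagm n d) = map (\<lambda>i. cmod (d i)) [0..<n]"
proof -
  let ?l = "map (\<lambda>i. cmod (d i)) [0..<n]"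
  have "image_mset (\<lambda>i. cmod (d i)) (mset_set {..<n}) = mset (rev ?l)"
    by (simp add: lessThan_atLeast0)
  moreover have "sorted (rev ?l)"
    using assms by (auto simp: sorted_iff_nth_mono rev_nth)
  ultimately show ?thesis
    by (simp add: singular_values_diagm_mset sorted_list_of_multiset_mset sorted_sort_id del: mset_rev)
qed

text \<open>The Gram matrices of \<open>U * X * V\<close> and of \<open>X\<close> are similar
  through \<open>V\<close>, hence have the same characteristic polynomial.\<close>

lemma singular_values_unitary:
  assumes U: "unitary_mat n U" and V: "unitary_mat n V" and X: "X \<in> carrier_mat n n"
  shows "singular_values (U * X * V) = singular_values X"
proof -
  note c = unitary_matD(1)[OF U] unitary_matD(1)[OF V] X
  have "mat_adjoint (U * X * V) * (U * X * V) = mat_adjoint V * (mat_adjoint X * ((mat_adjoint U * U) * X)) * V"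
    using c by (simp add: mat_adjoint_mult[of _ n n _ n] assoc_mult_mat[of _ n n _ n _ n])
  also have "\<dots> = mat_adjoint V * (mat_adjoint X * X) * V"
    using c unitary_matD(2)[OF U] by simp
  finally have e: "mat_adjoint (U * X * V) * (U * X * V) = mat_adjoint V * (mat_adjoint X * X) * V" .
  have "similar_mat (mat_adjoint (U * X * V) * (U * X * V)) (mat_adjoint X * X)"
    by (rule similar_matI[of _ _ "mat_adjoint V" V n]) (use c e unitary_matD[OF V] in auto)
  from char_poly_similar[OF this] show ?thesis by (simp add: singular_values_def)
qed

lemma ky_fan_unitary:
  assumes "unitary_mat n U" "unitary_mat n V" "X \<in> carrier_mat n n"
  shows "ky_fan_norm k (U * X * V) = ky_fan_norm k X"
  using singular_values_unitary[OF assms] by (simp add: ky_fan_norm_def)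

lemma ky_fan_diagm:
  assumes "k \<le> n" "\<And>i j. i \<le> j \<Longrightarrow> j < n \<Longrightarrow> cmod (d j) \<le> cmod (d i)"
  shows "ky_fan_norm k (diagm n d) = (\<Sum>i<k. cmod (d i))"
proof -
  have "singular_values (diagm n d) = map (\<lambda>i. cmod (d i)) [0..<n]"
    using assms(2) by (rule singular_values_diagm)
  thus ?thesis using assms(1) unfolding ky_fan_norm_def by (auto intro!: sum.cong)
qed

lemma ky_fan_diagm_transpose:
  assumes "a < n" "b < n"
  shows "ky_fan_norm k (diagm n (\<lambda>i. d (transpose a b i))) = ky_fan_norm k (diagm n d)"
proof -
  have inj: "inj_on (transpose a b) {..<n}" by (rule inj_on_subset[OF inj_transpose]) simp
  have im: "transpose a b ` {..<n} = {..<n}"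
    using assms by (intro transpose_image_eq) auto
  have "image_mset (\<lambda>i. cmod (d (transpose a b i))) (mset_set {..<n})
      = image_mset (\<lambda>i. cmod (d i)) (image_mset (transpose a b) (mset_set {..<n}))"
    by (simp add: multiset.map_comp o_def)
  also have "image_mset (transpose a b) (mset_set {..<n}) = mset_set {..<n}"
    using image_mset_mset_set[OF inj] im by simp
  finally show ?thesis by (simp add: ky_fan_norm_def singular_values_diagm_mset)
qed

section \<open>Ky Fan's variational principle\<close>

abbreviation topw :: "nat \<Rightarrow> nat \<Rightarrow> real" where
  "topw k i \<equiv> (if i < k then 1 else 0)"

lemma ky_fan_svd:
  assumes X: "X \<in> carrier_mat n n" and svd: "is_svd n X U V \<sigma>" and k: "k \<le> n"
  shows "ky_fan_norm k X = (\<Sum>i<k. \<sigma> i)"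
proof -
  note * = is_svdD[OF svd]
  have "ky_fan_norm k X = ky_fan_norm k (diagm n (\<lambda>i. complex_of_real (\<sigma> i)))"
    using ky_fan_unitary[OF *(1,2) X, of k] unfolding *(3) by simp
  also have "\<dots> = (\<Sum>i<k. cmod (complex_of_real (\<sigma> i)))"
  proof (rule ky_fan_diagm[OF k])
    fix i j assume "i \<le> j" "j < n"
    with *(4)[of i] *(4)[of j] *(5)[of i j]
    show "cmod (complex_of_real (\<sigma> j)) \<le> cmod (complex_of_real (\<sigma> i))" by simp
  qed
  also have "\<dots> = (\<Sum>i<k. \<sigma> i)" using *(4) k by (intro sum.cong) auto
  finally show ?thesis .
qed

lemma ky_fan_attained:
  assumes X: "X \<in> carrier_mat n n" and k: "k \<le> n"
  obtains U V where "unitary_mat n U" "unitary_mat n V" "weighted_trace n (topw k) (U * X * V) = of_real (ky_fan_norm k X)"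
proof -
  obtain U V \<sigma> where svd: "is_svd n X U V \<sigma>" using singular_value_decomposition[OF X] by blast
  note * = is_svdD(1-3)[OF svd] ky_fan_svd[OF X svd k]
  have "weighted_trace n (topw k) (U * X * V) = (\<Sum>i<n. if i < k then of_real (\<sigma> i) else 0)"
    unfolding weighted_trace_def * by (intro sum.cong) auto
  also have "\<dots> = (\<Sum>i<k. of_real (\<sigma> i))"
    using k by (intro sum.mono_neutral_cong_right) auto
  finally have "weighted_trace n (topw k) (U * X * V) = of_real (ky_fan_norm k X)" unfolding *(4) by simp
  with *(1,2) show ?thesis by (rule that)
qed

text \<open>After a singular value decomposition the truncated trace is the sum over j of sigma_j
  times a sum of k products P_ij Q_ji. By the inequality of arithmetic and geometric means the
  latter is at most \<open>w j\<close> in modulus, where 0 <= w_j <= 1 and the w_j add up to k. Such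
  weights are best placed on the k largest sigma_j.\<close>

lemma ky_fan_upper:
  assumes X: "X \<in> carrier_mat n n" and k: "k \<le> n" and U: "unitary_mat n U" and V: "unitary_mat n V"
  shows "cmod (weighted_trace n (topw k) (U * X * V)) \<le> ky_fan_norm k X"
proof (cases "k = 0")
  case True
  thus ?thesis by (simp add: weighted_trace_def ky_fan_norm_def)
next
  case False
  obtain A B \<sigma> where svd: "is_svd n X A B \<sigma>" using singular_value_decomposition[OF X] by blast
  note * = is_svdD[OF svd] ky_fan_svd[OF X svd]
  define S where "S = diagm n (\<lambda>i. complex_of_real (\<sigma> i))"
  define P where "P = U * mat_adjoint A"
  define Q where "Q = mat_adjoint B * V"
  have P: "unitary_mat n P" and Q: "unitary_mat n Q"
    using * U V by (auto simp: P_def Q_def intro!: unitary_mult unitary_adjoint)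
  note c = unitary_matD(1)[OF U] unitary_matD(1)[OF V] X unitary_matD(1)[OF *(1)] unitary_matD(1)[OF *(2)]
    unitary_matD(1)[OF P] unitary_matD(1)[OF Q]
  have "P * S * Q = U * (mat_adjoint A * A) * X * (B * mat_adjoint B) * V"
    unfolding S_def *(3)[symmetric] P_def Q_def using c by (simp add: assoc_mult_mat[of _ n n _ n _ n])
  hence UXV: "U * X * V = P * S * Q" using unitary_matD(2)[OF *(1)] unitary_matD(3)[OF *(2)] c by simp
  have e: "(P * S * Q) $$ (i, i) = (\<Sum>j<n. of_real (\<sigma> j) * (P $$ (i, j) * Q $$ (j, i)))" if "i < n" for i
    using that c by (subst mult_mat_index[of _ n n _ n]) (auto simp: S_def diagm_mult_right[of _ n] algebra_simps)
  define w where "w j = (\<Sum>i<k. ((cmod (P $$ (i, j)))\<^sup>2 + (cmod (Q $$ (j, i)))\<^sup>2) / 2)" for j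
  have w1: "w j \<le> 1" if "j < n" for j
  proof -
    have "w j \<le> (\<Sum>i<n. ((cmod (P $$ (i, j)))\<^sup>2 + (cmod (Q $$ (j, i)))\<^sup>2) / 2)"
      unfolding w_def using k by (intro sum_mono2) auto
    also have "\<dots> = ((\<Sum>i<n. (cmod (P $$ (i, j)))\<^sup>2) + (\<Sum>i<n. (cmod (Q $$ (j, i)))\<^sup>2)) / 2"
      by (simp add: sum.distrib flip: sum_divide_distrib)
    also have "\<dots> = 1" using unitary_col_sum[OF P that] unitary_row_sum[OF Q that] by simp
    finally show ?thesis .
  qed
  have w0: "w j \<ge> 0" for j unfolding w_def by (intro sum_nonneg) auto
  have "(\<Sum>j<n. w j) = (\<Sum>i<k. \<Sum>j<n. ((cmod (P $$ (i, j)))\<^sup>2 + (cmod (Q $$ (j, i)))\<^sup>2) / 2)"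
    unfolding w_def by (rule sum.swap)
  also have "\<dots> = (\<Sum>i<k. ((\<Sum>j<n. (cmod (P $$ (i, j)))\<^sup>2) + (\<Sum>j<n. (cmod (Q $$ (j, i)))\<^sup>2)) / 2)"
    by (simp add: sum.distrib flip: sum_divide_distrib)
  also have "\<dots> = (\<Sum>i<k. 1)"
    using unitary_row_sum[OF P] unitary_col_sum[OF Q] k by (intro sum.cong) auto
  finally have ws: "(\<Sum>j<n. w j) = real k" by simp
  \<comment> \<open>The k-th largest singular value as threshold. Both weight vectors have total k,
    so subtracting it from every sigma_j does not change the difference of the two sums but makes
    each term nonpositive.\<close>
  define \<tau> where "\<tau> = \<sigma> (k - 1)"
  have kn: "k - 1 < n" using False k by simp
  have "weighted_trace n (topw k) (P * S * Q) = (\<Sum>i<k. (P * S * Q) $$ (i, i))"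
    unfolding weighted_trace_def using k by (intro sum.mono_neutral_cong_right) auto
  also have "\<dots> = (\<Sum>i<k. \<Sum>j<n. of_real (\<sigma> j) * (P $$ (i, j) * Q $$ (j, i)))" using e k by (intro sum.cong) auto
  also have "cmod \<dots> \<le> (\<Sum>i<k. \<Sum>j<n. \<sigma> j * (((cmod (P $$ (i, j)))\<^sup>2 + (cmod (Q $$ (j, i)))\<^sup>2) / 2))"
  proof (intro order.trans[OF norm_sum] sum_mono)
    fix i j assume "j \<in> {..<n}"
    have "cmod (P $$ (i, j)) * cmod (Q $$ (j, i)) \<le> ((cmod (P $$ (i, j)))\<^sup>2 + (cmod (Q $$ (j, i)))\<^sup>2) / 2"
      using sum_squares_bound[of "cmod (P $$ (i, j))" "cmod (Q $$ (j, i))"] by simp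
    hence "\<sigma> j * (cmod (P $$ (i, j)) * cmod (Q $$ (j, i))) \<le> \<sigma> j * (((cmod (P $$ (i, j)))\<^sup>2 + (cmod (Q $$ (j, i)))\<^sup>2) / 2)"
      using *(4)[of j] \<open>j \<in> {..<n}\<close> by (intro mult_left_mono) auto
    thus "cmod (of_real (\<sigma> j) * (P $$ (i, j) * Q $$ (j, i))) \<le> \<sigma> j * (((cmod (P $$ (i, j)))\<^sup>2 + (cmod (Q $$ (j, i)))\<^sup>2) / 2)"
      using *(4)[of j] \<open>j \<in> {..<n}\<close> by (simp add: norm_mult)
  qed
  also have "\<dots> = (\<Sum>j<n. \<sigma> j * w j)"
    unfolding w_def by (subst sum.swap) (simp add: sum_distrib_left)
  also have "\<dots> \<le> (\<Sum>j<n. \<sigma> j * topw k j)"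
  proof -
    have "(\<Sum>j<n. (\<sigma> j - \<tau>) * (w j - topw k j)) \<le> 0"
    proof (intro sum_nonpos)
      fix j assume j: "j \<in> {..<n}"
      show "(\<sigma> j - \<tau>) * (w j - topw k j) \<le> 0"
      proof (cases "j < k")
        case True
        hence "\<tau> \<le> \<sigma> j" using *(5)[of j "k - 1"] kn by (simp add: \<tau>_def)
        thus ?thesis using True w1[of j] j by (simp add: mult_le_0_iff)
      next
        case False
        hence "\<sigma> j \<le> \<tau>" using *(5)[of "k - 1" j] j by (simp add: \<tau>_def)
        thus ?thesis using False w0[of j] j by (simp add: mult_le_0_iff)
      qed
    qed
    moreover have "(\<Sum>j<n. topw k j) = real k"
    proof -
      have "(\<Sum>j<n. topw k j) = (\<Sum>j<k. 1)" using k by (intro sum.mono_neutral_cong_right) auto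
      thus ?thesis by simp
    qed
    moreover have "(\<Sum>j<n. (\<sigma> j - \<tau>) * (w j - topw k j))
      = (\<Sum>j<n. \<sigma> j * w j) - (\<Sum>j<n. \<sigma> j * topw k j) - \<tau> * ((\<Sum>j<n. w j) - (\<Sum>j<n. topw k j))"
      unfolding sum_subtractf[symmetric] sum_distrib_left by (intro sum.cong) (auto simp: algebra_simps)
    ultimately show ?thesis using ws by simp
  qed
  also have "\<dots> = (\<Sum>j<k. \<sigma> j)" using k by (intro sum.mono_neutral_cong_right) auto
  also have "\<dots> = ky_fan_norm k X" using *(6)[OF k] by simp
  finally show ?thesis unfolding UXV .
qed

section \<open>Spectral theorem and products of positive semidefinite matrices\<close>

lemma mat_eq_by_unit_vec:
  fixes A B :: "complex mat"
  assumes "A \<in> carrier_mat n n" "B \<in> carrier_mat n n" "\<And>i. i < n \<Longrightarrow> A *\<^sub>v unit_vec n i = B *\<^sub>v unit_vec n i"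
  shows "A = B"
  using assms by (intro mat_col_eqI) (auto simp: mult_unit_vec[of _ n n])

lemma ip_unit_unit: "i < n \<Longrightarrow> ip (unit_vec n i) (unit_vec n i) = 1"
  by (subst ip_unit_left) auto

lemma mult_mat_vec_square [simp, intro]: "A \<in> carrier_mat n n \<Longrightarrow> x \<in> carrier_vec n \<Longrightarrow> A *\<^sub>v x \<in> carrier_vec n"
  by (rule mult_mat_vec_carrier)

lemma mult_mat_vec_assoc: 
  "\<lbrakk>A \<in> carrier_mat n n; B \<in> carrier_mat n n; x \<in> carrier_vec n\<rbrakk> \<Longrightarrow> (A * B) *\<^sub>v x = A *\<^sub>v (B *\<^sub>v (x :: complex vec))"
  by (rule assoc_mult_mat_vec)

lemma mult_mat_vec_zero: "A \<in> carrier_mat n n \<Longrightarrow> A *\<^sub>v 0\<^sub>v n = (0\<^sub>v n :: complex vec)"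
  by (intro eq_vecI) (auto simp: mult_mat_vec_index[of _ n n])

lemma smult_zero_vec [simp]: "c \<cdot>\<^sub>v 0\<^sub>v n = (0\<^sub>v n :: complex vec)"
  by (intro eq_vecI) auto

lemma diagm_unit_vec: "i < n \<Longrightarrow> diagm n d *\<^sub>v unit_vec n i = d i \<cdot>\<^sub>v unit_vec n i"
  by (subst mult_unit_vec[of _ n n]) (auto simp: unit_vec_def intro!: eq_vecI)

text \<open>In a decomposition U A V = S the columns of V are eigenvectors of A^2 for the squares
  sigma_i^2. Positivity excludes the eigenvalue -sigma_i of A, so they are eigenvectors of A for
  sigma_i.\<close>

lemma psd_spectral:
  assumes A: "psd n A"
  shows "\<exists>V \<sigma>. unitary_mat n V \<and> (\<forall>i<n. 0 \<le> \<sigma> i) \<and> A = V * diagm n (\<lambda>i. complex_of_real (\<sigma> i)) * mat_adjoint V"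
proof -
  note Ac = psdD(1)[OF A]
  obtain U V \<sigma> where svd: "is_svd n A U V \<sigma>" using singular_value_decomposition[OF Ac] by blast
  note * = is_svdD[OF svd]
  define S where "S = diagm n (\<lambda>i. complex_of_real (\<sigma> i))"
  note c = unitary_matD(1)[OF *(1)] unitary_matD(1)[OF *(2)] Ac
  have S: "S \<in> carrier_mat n n" "mat_adjoint S = S" by (simp_all add: S_def adjoint_diagm)
  have "U * A * V = S" using *(3) by (simp only: S_def)
  hence "mat_adjoint S * S = mat_adjoint V * A * (mat_adjoint U * U) * A * V"
    using c psd_adjoint[OF A] by (auto simp: mat_adjoint_mult[of _ n n _ n] assoc_mult_mat[of _ n n _ n _ n])
  hence "S * S = mat_adjoint V * A * A * V" using S unitary_matD(2)[OF *(1)] c by simp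
  hence "V * (S * S) = (V * mat_adjoint V) * A * A * V" using c by (simp add: assoc_mult_mat[of _ n n _ n _ n])
  hence VSS: "V * (S * S) = A * A * V" using unitary_matD(3)[OF *(2)] c by simp
  have AV: "A * V = V * S"
  proof (rule mat_eq_by_unit_vec)
    fix i assume i: "i < n"
    define x where "x = V *\<^sub>v unit_vec n i"
    have x: "x \<in> carrier_vec n" using c by (simp add: x_def)
    define s where "s = complex_of_real (\<sigma> i)"
    have "A *\<^sub>v (A *\<^sub>v x) = (A * A * V) *\<^sub>v unit_vec n i"
      using c by (simp add: x_def mult_mat_vec_assoc[of _ n])
    also have "\<dots> = V *\<^sub>v (S *\<^sub>v (S *\<^sub>v unit_vec n i))" unfolding VSS[symmetric]
      using c S by (simp add: mult_mat_vec_assoc[of _ n])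
    also have "\<dots> = (s * s) \<cdot>\<^sub>v x"
      using i c by (simp add: S_def s_def x_def diagm_unit_vec mult_mat_vec[of _ n n] smult_smult_assoc)
    finally have AA: "A *\<^sub>v (A *\<^sub>v x) = (s * s) \<cdot>\<^sub>v x" .
    have "A *\<^sub>v x = s \<cdot>\<^sub>v x"
    proof (cases "\<sigma> i = 0")
      case True
      have "ip (A *\<^sub>v x) (A *\<^sub>v x) = ip x (A *\<^sub>v (A *\<^sub>v x))"
        using ip_adjoint[of A n n x "A *\<^sub>v x"] psd_adjoint[OF A] c x by simp
      also have "\<dots> = 0" unfolding AA using True by (simp add: s_def ip_smult_right)
      finally have "A *\<^sub>v x = 0\<^sub>v n" using ip_self_eq_0[of "A *\<^sub>v x" n] c x by simp
      thus ?thesis using True x by (auto simp: s_def)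
    next
      case False
      hence s0: "\<sigma> i > 0" using *(4)[OF i] by simp
      \<comment> \<open>The defect y = A x - s x satisfies A y = -s y, which a positive semidefinite
        matrix allows only for y = 0 when s > 0.\<close>
      define y where "y = A *\<^sub>v x + (- s) \<cdot>\<^sub>v x"
      have y: "y \<in> carrier_vec n" using c x by (simp add: y_def)
      have "A *\<^sub>v y = (- s) \<cdot>\<^sub>v y"
        using c x unfolding y_def
        by (simp add: mult_add_distrib_mat_vec[of _ n n] mult_mat_vec[of _ n n] AA) (intro eq_vecI, auto simp: algebra_simps)
      hence "0 \<le> - s * ip y y" using psdD(2)[OF A y] by (simp add: ip_smult_right)
      hence "\<sigma> i * Re (ip y y) \<le> 0" by (simp add: less_eq_complex_def s_def ip_self)
      hence "Re (ip y y) \<le> 0" using s0 by (simp add: mult_le_0_iff)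
      moreover have "0 \<le> Re (ip y y)" "ip y y = of_real (Re (ip y y))" by (simp_all add: ip_self sum_nonneg)
      ultimately have "ip y y = 0" by (metis antisym of_real_0)
      hence y0: "y = 0\<^sub>v n" using ip_self_eq_0[OF y] by simp
      show ?thesis
      proof (intro eq_vecI)
        fix j assume "j < dim_vec (s \<cdot>\<^sub>v x)"
        hence j: "j < n" using x by simp
        have "y $ j = 0" using y0 j by simp
        thus "(A *\<^sub>v x) $ j = (s \<cdot>\<^sub>v x) $ j" using j c x by (simp add: y_def)
      qed (use c x in auto)
    qed
    thus "(A * V) *\<^sub>v unit_vec n i = (V * S) *\<^sub>v unit_vec n i"
      using c S i by (simp add: mult_mat_vec_assoc[of _ n] S_def diagm_unit_vec mult_mat_vec[of _ n n] x_def s_def)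
  qed (use c S in auto)
  have "A = A * (V * mat_adjoint V)" using unitary_matD(3)[OF *(2)] c by simp
  also have "\<dots> = V * S * mat_adjoint V" using c S AV by (simp flip: assoc_mult_mat[of _ n n _ n _ n])
  finally show ?thesis using * by (auto simp: S_def)
qed

text \<open>With R the square root of A, the product A B = R (R B) has the same nonzero eigenvalues
  as C = R B R, which is positive semidefinite; an eigenvector w of C yields the eigenvector R
  w.\<close>

lemma psd_mult_pos_eigenvalue:
  assumes A: "psd n A" and B: "psd n B" and AB: "A * B \<noteq> 0\<^sub>m n n"
  shows "\<exists>\<nu> x. \<nu> > 0 \<and> x \<in> carrier_vec n \<and> x \<noteq> 0\<^sub>v n \<and> (A * B) *\<^sub>v x = complex_of_real \<nu> \<cdot>\<^sub>v x"
proof -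
  note Ac = psdD(1)[OF A] and Bc = psdD(1)[OF B]
  obtain V \<sigma> where V: "unitary_mat n V" and \<sigma>: "\<forall>i<n. 0 \<le> \<sigma> i"
    and AV: "A = V * diagm n (\<lambda>i. complex_of_real (\<sigma> i)) * mat_adjoint V" using psd_spectral[OF A] by blast
  note Vc = unitary_matD(1)[OF V]
  define Q where "Q = diagm n (\<lambda>i. complex_of_real (sqrt (\<sigma> i)))"
  have Qc: "Q \<in> carrier_mat n n" "mat_adjoint Q = Q" by (simp_all add: Q_def adjoint_diagm)
  have QQ: "Q * Q = diagm n (\<lambda>i. complex_of_real (\<sigma> i))"
    unfolding Q_def diagm_mult using \<sigma> by (intro eq_matI) (auto simp flip: of_real_mult)
  define R where "R = V * Q * mat_adjoint V"
  have Rc: "R \<in> carrier_mat n n" using Vc Qc by (simp add: R_def)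
  have Ra: "mat_adjoint R = R" using Vc Qc
    by (simp add: R_def mat_adjoint_mult[of _ n n _ n] assoc_mult_mat[of _ n n _ n _ n])
  have "R * R = V * Q * (mat_adjoint V * V) * Q * mat_adjoint V"
    using Vc Qc by (simp add: R_def assoc_mult_mat[of _ n n _ n _ n])
  also have "\<dots> = V * (Q * Q) * mat_adjoint V" using Vc Qc unitary_matD(2)[OF V] by (simp add: assoc_mult_mat[of _ n n _ n _ n])
  finally have RR: "R * R = A" by (simp add: QQ AV)
  define C where "C = R * B * R"
  have ipC: "ip x (C *\<^sub>v x) = ip (R *\<^sub>v x) (B *\<^sub>v (R *\<^sub>v x))" if "x \<in> carrier_vec n" for x
    using ip_adjoint[of R n n x "B *\<^sub>v (R *\<^sub>v x)"] Rc Bc Ra that by (simp add: C_def mult_mat_vec_assoc[of _ n])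
  have C: "psd n C"
    unfolding psd_def using ipC psdD(2)[OF B] Rc Bc by (auto simp: C_def)
  obtain W \<tau> where W: "unitary_mat n W" and \<tau>: "\<forall>i<n. 0 \<le> \<tau> i"
    and CW: "C = W * diagm n (\<lambda>i. complex_of_real (\<tau> i)) * mat_adjoint W" using psd_spectral[OF C] by blast
  note Wc = unitary_matD(1)[OF W]
  \<comment> \<open>If C vanished, the form of B would vanish on the range of R, hence B R = 0;
    taking adjoints gives R B = 0 and thus A B = 0.\<close>
  have "\<exists>i<n. \<tau> i \<noteq> 0"
  proof (rule ccontr)
    assume "\<not> (\<exists>i<n. \<tau> i \<noteq> 0)"
    hence "diagm n (\<lambda>i. complex_of_real (\<tau> i)) = 0\<^sub>m n n" by (intro eq_matI) auto
    hence C0: "C = 0\<^sub>m n n" using Wc by (simp add: CW)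
    have "B * R = 0\<^sub>m n n"
    proof (rule mat_eq_by_unit_vec)
      fix i assume i: "i < n"
      have "ip (R *\<^sub>v unit_vec n i) (B *\<^sub>v (R *\<^sub>v unit_vec n i)) = 0"
        using ipC[of "unit_vec n i"] i by (simp add: C0 ip_unit_left mult_mat_vec_index[of _ n n])
      from psd_ip_zero[OF B _ this] show "(B * R) *\<^sub>v unit_vec n i = 0\<^sub>m n n *\<^sub>v unit_vec n i"
        using Rc Bc i by (simp add: mult_mat_vec_assoc[of _ n]) (intro eq_vecI, auto simp: mult_mat_vec_index[of _ n n])
    qed (use Rc Bc in auto)
    hence "mat_adjoint (B * R) = 0\<^sub>m n n" by (simp, intro eq_matI, auto)
    hence "R * B = 0\<^sub>m n n" using Rc Bc Ra psd_adjoint[OF B] by (simp add: mat_adjoint_mult[of _ n n _ n])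
    hence "A * B = 0\<^sub>m n n" using Rc Bc by (simp add: RR[symmetric] assoc_mult_mat[of _ n n _ n _ n])
    with AB show False by simp
  qed
  then obtain i where i: "i < n" "\<tau> i > 0" using \<tau> by (metis less_eq_real_def)
  define w where "w = W *\<^sub>v unit_vec n i"
  have w: "w \<in> carrier_vec n" "ip w w = 1" using Wc i unitary_ip[OF W, of "unit_vec n i" "unit_vec n i"]
    by (simp_all add: w_def ip_unit_unit)
  have "C *\<^sub>v w = (W * diagm n (\<lambda>i. complex_of_real (\<tau> i)) * (mat_adjoint W * W)) *\<^sub>v unit_vec n i"
    using Wc by (simp add: CW w_def mult_mat_vec_assoc[of _ n])
  also have "\<dots> = of_real (\<tau> i) \<cdot>\<^sub>v w"
    using Wc unitary_matD(2)[OF W] i by (simp add: mult_mat_vec_assoc[of _ n] diagm_unit_vec mult_mat_vec[of _ n n] w_def)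
  finally have Cw: "C *\<^sub>v w = of_real (\<tau> i) \<cdot>\<^sub>v w" .
  define x where "x = R *\<^sub>v w"
  have x: "x \<in> carrier_vec n" using Rc w by (simp add: x_def)
  have "(A * B) *\<^sub>v x = R *\<^sub>v (C *\<^sub>v w)"
    using Rc Bc w by (simp add: RR[symmetric] x_def C_def mult_mat_vec_assoc[of _ n])
  also have "\<dots> = of_real (\<tau> i) \<cdot>\<^sub>v x" using Rc w by (simp add: Cw mult_mat_vec[of _ n n] x_def)
  finally have ev: "(A * B) *\<^sub>v x = of_real (\<tau> i) \<cdot>\<^sub>v x" .
  have "x \<noteq> 0\<^sub>v n"
  proof
    assume "x = 0\<^sub>v n"
    hence "C *\<^sub>v w = 0\<^sub>v n" using Rc Bc w by (simp add: C_def mult_mat_vec_assoc[of _ n] mult_mat_vec_zero flip: x_def)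
    hence "ip w (C *\<^sub>v w) = 0" by (simp add: ip_def)
    thus False using w i by (simp add: Cw ip_smult_right)
  qed
  with x ev i show ?thesis by blast
qed

text \<open>Rank at most one: the zero matrix is included.\<close>

definition rank1 :: "nat \<Rightarrow> complex mat \<Rightarrow> bool" where
  "rank1 n M \<longleftrightarrow> (\<exists>u v. \<forall>i<n. \<forall>j<n. M $$ (i, j) = u i * v j)"

lemma rank1_mult:
  assumes A: "A \<in> carrier_mat n n" and B: "B \<in> carrier_mat n n" and X: "X \<in> carrier_mat n n" and r: "rank1 n X"
  shows "rank1 n (A * X * B)"
proof -
  obtain u v where uv: "\<And>i j. i < n \<Longrightarrow> j < n \<Longrightarrow> X $$ (i, j) = u i * v j" using r unfolding rank1_def by blast
  have "(A * X * B) $$ (i, j) = (\<Sum>l<n. A $$ (i, l) * u l) * (\<Sum>m<n. v m * B $$ (m, j))" if "i < n" "j < n" for i j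
  proof -
    have "(A * X * B) $$ (i, j) = (\<Sum>m<n. (\<Sum>l<n. A $$ (i, l) * X $$ (l, m)) * B $$ (m, j))"
      using A B X that by (subst mult_mat_index[of _ n n _ n]) (auto simp: mult_mat_index[of _ n n _ n])
    also have "\<dots> = (\<Sum>m<n. (\<Sum>l<n. A $$ (i, l) * u l) * (v m * B $$ (m, j)))"
      unfolding sum_distrib_right by (intro sum.cong) (auto simp: uv)
    also have "\<dots> = (\<Sum>l<n. A $$ (i, l) * u l) * (\<Sum>m<n. v m * B $$ (m, j))" by (rule sum_distrib_left[symmetric])
    finally show ?thesis .
  qed
  thus ?thesis unfolding rank1_def
    by (intro exI[of _ "\<lambda>i. \<Sum>l<n. A $$ (i, l) * u l"] exI[of _ "\<lambda>j. \<Sum>m<n. v m * B $$ (m, j)"]) simp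
qed

text \<open>The n orthonormal vectors are the columns of a unitary matrix V, and M V has at most one
  nonzero column. Both rank arguments below, for k = 1 and for k >= 2, end here.\<close>

lemma rank1_of_orthonormal_kernel:
  fixes v :: "nat \<Rightarrow> complex vec"
  assumes M: "M \<in> carrier_mat n n" and v: "\<And>i. i < n \<Longrightarrow> v i \<in> carrier_vec n"
    and on: "\<And>i j. i < n \<Longrightarrow> j < n \<Longrightarrow> ip (v i) (v j) = (if i = j then 1 else 0)"
    and ker: "\<And>i. 0 < i \<Longrightarrow> i < n \<Longrightarrow> M *\<^sub>v v i = 0\<^sub>v n"
  shows "rank1 n M"
proof (cases "n = 0")
  case False
  define V where "V = mat n n (\<lambda>(i, j). v j $ i)"
  have Vc: "V \<in> carrier_mat n n" by (simp add: V_def)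
  have V: "unitary_mat n V"
  proof (rule unitary_matI[OF Vc], intro eq_matI)
    fix i j assume "i < dim_row (1\<^sub>m n :: complex mat)" "j < dim_col (1\<^sub>m n :: complex mat)"
    hence ij: "i < n" "j < n" by auto
    have "(mat_adjoint V * V) $$ (i, j) = ip (v i) (v j)"
      using ij Vc v by (subst mult_mat_index[of _ n n _ n]) (auto simp: ip_carrier[of _ n] V_def)
    thus "(mat_adjoint V * V) $$ (i, j) = 1\<^sub>m n $$ (i, j)" using on ij by simp
  qed (use Vc in auto)
  have MV: "(M * V) $$ (i, b) = (if b = 0 then (M *\<^sub>v v 0) $ i else 0)" if "i < n" "b < n" for i b
  proof -
    have "(M * V) $$ (i, b) = (M *\<^sub>v v b) $ i"
      using that M Vc v by (subst mult_mat_index[of _ n n _ n]) (auto simp: mult_mat_vec_index[of _ n n] V_def)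
    thus ?thesis using ker[of b] that by auto
  qed
  have "M = (M * V) * mat_adjoint V" using M Vc unitary_matD(3)[OF V] by (simp add: assoc_mult_mat[of _ n n _ n _ n])
  moreover have "((M * V) * mat_adjoint V) $$ (i, j) = (M *\<^sub>v v 0) $ i * mat_adjoint V $$ (0, j)" if "i < n" "j < n" for i j
  proof -
    have "((M * V) * mat_adjoint V) $$ (i, j) = (\<Sum>b<n. (M * V) $$ (i, b) * mat_adjoint V $$ (b, j))"
      using that M Vc by (intro mult_mat_index) auto
    also have "\<dots> = (\<Sum>b<n. if b = 0 then (M *\<^sub>v v 0) $ i * mat_adjoint V $$ (0, j) else 0)"
      using that MV by (intro sum.cong) auto
    finally show ?thesis using False by simp
  qed
  ultimately have "\<forall>i<n. \<forall>j<n. M $$ (i, j) = (M *\<^sub>v v 0) $ i * mat_adjoint V $$ (0, j)" by metis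
  thus ?thesis unfolding rank1_def
    by (intro exI[of _ "\<lambda>i. (M *\<^sub>v v 0) $ i"] exI[of _ "\<lambda>j. mat_adjoint V $$ (0, j)"])
qed (auto simp: rank1_def)

section \<open>Equality in the variational principle\<close>

lemma refl_mult_vec:
  assumes h: "h \<in> carrier_vec n" and x: "x \<in> carrier_vec n"
  shows "refl_mat n h z *\<^sub>v x = x + (- (1 - z) * ip h x) \<cdot>\<^sub>v h"
proof (intro eq_vecI)
  fix i assume "i < dim_vec (x + (- (1 - z) * ip h x) \<cdot>\<^sub>v h)"
  hence i: "i < n" using h by simp
  have "(refl_mat n h z *\<^sub>v x) $ i = (\<Sum>l<n. (if l = i then x $ i else 0) - (1 - z) * h $ i * (cnj (h $ l) * x $ l))"
    using i x by (subst mult_mat_vec_index[of _ n n]) (auto simp: refl_mat_def algebra_simps intro!: sum.cong)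
  also have "\<dots> = x $ i - (1 - z) * h $ i * ip h x"
    using i x by (simp add: sum_subtractf ip_carrier[of _ n] sum_distrib_left)
  finally show "(refl_mat n h z *\<^sub>v x) $ i = (x + (- (1 - z) * ip h x) \<cdot>\<^sub>v h) $ i" using i h x by (simp add: algebra_simps)
qed (use h x in \<open>auto simp: refl_mat_def\<close>)

text \<open>If the truncated trace of Y already equals the norm, no unitary factor improves it.
  Cutting off columns, or rows, from index k on then leaves a Hermitian matrix; its mirror entries
  are zero by truncation, so the off-diagonal blocks vanish.\<close>

lemma ky_fan_opt:
  assumes Y: "Y \<in> carrier_mat n n" and k: "k \<le> n" and opt: "ky_fan_norm k Y \<le> Re (weighted_trace n (topw k) Y)"
  shows "psd n (Y * diagm n (\<lambda>i. of_real (topw k i)))" "psd n (diagm n (\<lambda>i. of_real (topw k i)) * Y)"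
    "\<And>i j. \<lbrakk>i < k; k \<le> j; j < n\<rbrakk> \<Longrightarrow> Y $$ (i, j) = 0 \<and> Y $$ (j, i) = 0"
proof -
  have le: "Re (weighted_trace n (topw k) (G * Y * H)) \<le> Re (weighted_trace n (topw k) Y)" if "unitary_mat n G" "unitary_mat n H" for G H
    using ky_fan_upper[OF Y k that] complex_Re_le_cmod[of "weighted_trace n (topw k) (G * Y * H)"] opt by linarith
  show L: "psd n (Y * diagm n (\<lambda>i. of_real (topw k i)))"
  proof (rule opt_psd_left[OF Y])
    fix G assume G: "unitary_mat n G"
    show "Re (weighted_trace n (topw k) (G * Y)) \<le> Re (weighted_trace n (topw k) Y)"
      using le[OF G unitary_one] unitary_matD(1)[OF G] Y right_mult_one_mat[of "G * Y" n n] by simp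
  qed
  show R: "psd n (diagm n (\<lambda>i. of_real (topw k i)) * Y)"
  proof (rule opt_psd_right[OF Y])
    fix G assume G: "unitary_mat n G"
    show "Re (weighted_trace n (topw k) (Y * G)) \<le> Re (weighted_trace n (topw k) Y)"
      using le[OF unitary_one G] unitary_matD(1)[OF G] Y by simp
  qed
  fix i j assume ij: "i < k" "k \<le> j" "j < n"
  hence "i < n" by simp
  show "Y $$ (i, j) = 0 \<and> Y $$ (j, i) = 0"
    using psd_herm[OF L \<open>i < n\<close> ij(3)] psd_herm[OF R \<open>i < n\<close> ij(3)] ij \<open>i < n\<close> Y
    by (simp add: diagm_mult_left[OF Y] diagm_mult_right[OF Y])
qed

text \<open>The two reflections exchange the kernel vector \<open>x\<close> with \<open>e\<^sub>i\<close> and with \<open>z e\<^sub>j\<close>. This adds \<open>z Y\<^sub>i\<^sub>j\<close> to the sum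
  of the first \<open>k\<close> diagonal entries, which cannot increase.\<close>

lemma ky_fan_opt_kernel:
  assumes Y: "Y \<in> carrier_mat n n" and k: "k \<le> n" and opt: "ky_fan_norm k Y \<le> Re (weighted_trace n (topw k) Y)"
    and x: "x \<in> carrier_vec n" "ip x x = 1" "\<And>i. k \<le> i \<Longrightarrow> i < n \<Longrightarrow> x $ i = 0" "Y *\<^sub>v x = 0\<^sub>v n"
    and ij: "k \<le> i" "i < n" "k \<le> j" "j < n"
  shows "Y $$ (i, j) = 0"
proof -
  note lead_block = ky_fan_opt[OF Y k opt]
  define J where "J = diagm n (\<lambda>i. complex_of_real (topw k i))"
  have J: "J \<in> carrier_mat n n" by (simp add: J_def)
  have Jv: "(J *\<^sub>v v) $ l = (if l < k then v $ l else 0)" if "v \<in> carrier_vec n" "l < n" for v l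
  proof -
    have "(J *\<^sub>v v) $ l = (\<Sum>m<n. J $$ (l, m) * v $ m)"
      using that J by (intro mult_mat_vec_index) auto
    also have "\<dots> = (\<Sum>m<n. if m = l then (if l < k then v $ l else 0) else 0)"
      using that by (intro sum.cong) (auto simp: J_def)
    finally show ?thesis using that by simp
  qed
  have Jx: "J *\<^sub>v x = x" using Jv[OF x(1)] x J by (intro eq_vecI) auto
  have Je: "J *\<^sub>v unit_vec n l = 0\<^sub>v n" if "k \<le> l" for l
    using Jv[of "unit_vec n l"] that J by (intro eq_vecI) (auto simp: unit_vec_def)
  have JYe: "J *\<^sub>v (Y *\<^sub>v unit_vec n j) = 0\<^sub>v n"
    using Jv[of "Y *\<^sub>v unit_vec n j"] lead_block(3) ij J Y by (intro eq_vecI) (auto simp: mult_unit_vec[of _ n n])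
  have xe: "ip x (unit_vec n l) = 0" "ip (unit_vec n l) x = 0" if "k \<le> l" "l < n" for l
    using ip_cnj[of x "unit_vec n l"] x that by (auto simp: ip_unit_left[of _ n])
  have xYe: "ip x (Y *\<^sub>v unit_vec n j) = 0"
    unfolding ip_carrier[of _ n, OF mult_mat_vec_square[OF Y unit_vec_carrier]]
  proof (intro sum.neutral ballI)
    fix l assume "l \<in> {..<n}"
    thus "cnj (x $ l) * (Y *\<^sub>v unit_vec n j) $ l = 0"
      using x(3)[of l] lead_block(3)[of l j] ij Y by (cases "l < k") (auto simp: mult_unit_vec[of _ n n])
  qed
  have key: "Re (z * Y $$ (i, j)) \<le> 0" if z: "cmod z = 1" for z
  proof -
    \<comment> \<open>Normalising constant of x - e_i and x - z e_j: x is a unit vector supported on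
      the first k coordinates, hence orthogonal to e_i and e_j.\<close>
    define r where "r = complex_of_real (1 / sqrt 2)"
    have r: "cnj r = r" "r * r = 1 / 2" by (simp_all add: r_def flip: of_real_mult)
    have zz: "cnj z * z = 1" using z by (metis complex_norm_square mult.commute of_real_1 power_one)
    define g where "g = r \<cdot>\<^sub>v (x + (- 1) \<cdot>\<^sub>v unit_vec n i)"
    define h where "h = r \<cdot>\<^sub>v (x + (- z) \<cdot>\<^sub>v unit_vec n j)"
    have g: "g \<in> carrier_vec n" and h: "h \<in> carrier_vec n" using x by (simp_all add: g_def h_def)
    have "ip g g = r * r * 2" unfolding g_def using x ij xe[OF ij(1,2)] r(1)
      by (simp add: ip_smult_left[of _ n] ip_smult_right ip_add_left[of _ n] ip_add_right[of _ n] ip_unit_unit)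
    hence gg: "ip g g = 1" using r(2) by simp
    have "ip h h = r * r * (1 + cnj z * z)" unfolding h_def using x ij xe[OF ij(3,4)] r(1)
      by (simp add: ip_smult_left[of _ n] ip_smult_right ip_add_left[of _ n] ip_add_right[of _ n] ip_unit_unit algebra_simps)
    hence hh: "ip h h = 1" using r(2) zz by simp
    define G where "G = refl_mat n g (- 1)"
    define H where "H = refl_mat n h (- 1)"
    have GH: "unitary_mat n G" "unitary_mat n H"
      unfolding G_def H_def using g h gg hh by (auto intro: unitary_refl_mat)
    have Hc: "H \<in> carrier_mat n n" "G \<in> carrier_mat n n" by (simp_all add: H_def G_def)
    \<comment> \<open>H alone changes nothing, since J Y kills h: x lies in the kernel of Y, and
      column j has no entries in the first k rows.\<close>
    have "(J * Y) *\<^sub>v h = 0\<^sub>v n"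
      using J Y x JYe unfolding h_def
      by (simp add: mult_mat_vec_assoc[of _ n] mult_mat_vec[of _ n n] mult_add_distrib_mat_vec[of _ n n] mult_mat_vec_zero)
    hence 1: "weighted_trace n (topw k) (Y * H) = weighted_trace n (topw k) Y"
      unfolding H_def weighted_trace_refl_right[OF Y h] J_def[symmetric] by (simp add: ip_def)
    have "J *\<^sub>v g = r \<cdot>\<^sub>v x"
      using J x Jx Je[OF ij(1)] unfolding g_def
      by (simp add: mult_mat_vec[of _ n n] mult_add_distrib_mat_vec[of _ n n])
    moreover have "H *\<^sub>v x = z \<cdot>\<^sub>v unit_vec n j"
    proof -
      have "ip h x = r" unfolding h_def using x r xe[OF ij(3,4)]
        by (simp add: ip_smult_left[of _ n] ip_add_left[of _ n])
      hence "H *\<^sub>v x = x + (- 2 * r) \<cdot>\<^sub>v h" unfolding H_def refl_mult_vec[OF h x(1)] by simp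
      also have "\<dots> = z \<cdot>\<^sub>v unit_vec n j"
      proof (intro eq_vecI)
        fix l assume "l < dim_vec (z \<cdot>\<^sub>v unit_vec n j)"
        hence l: "l < n" by simp
        have "(x + (- 2 * r) \<cdot>\<^sub>v h) $ l = x $ l - 2 * (r * r) * (x $ l - z * unit_vec n j $ l)"
          using l x by (simp add: h_def algebra_simps)
        also have "\<dots> = (z \<cdot>\<^sub>v unit_vec n j) $ l" using l unfolding r(2) by simp
        finally show "(x + (- 2 * r) \<cdot>\<^sub>v h) $ l = (z \<cdot>\<^sub>v unit_vec n j) $ l" .
      qed (use x h in auto)
      finally show ?thesis .
    qed
    ultimately have YHJg: "(Y * H * J) *\<^sub>v g = (r * z) \<cdot>\<^sub>v (Y *\<^sub>v unit_vec n j)"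
      using Y J Hc g x by (simp add: mult_mat_vec_assoc[of _ n] mult_mat_vec[of _ n n] smult_smult_assoc)
    have "ip g ((Y * H * J) *\<^sub>v g) = r * r * z * (ip x (Y *\<^sub>v unit_vec n j) - Y $$ (i, j))"
      unfolding YHJg unfolding g_def using x Y ij r(1)
      by (simp add: ip_smult_left[of _ n] ip_smult_right ip_add_left[of _ n] ip_unit_left mult_unit_vec[of _ n n] algebra_simps)
    hence 2: "2 * ip g ((Y * H * J) *\<^sub>v g) = - (z * Y $$ (i, j))"
      unfolding r(2) xYe by simp
    have "weighted_trace n (topw k) (G * (Y * H)) = weighted_trace n (topw k) Y + z * Y $$ (i, j)"
      unfolding G_def weighted_trace_refl_left[OF mult_carrier_mat_square[OF Y Hc(1)] g] J_def[symmetric] 1 using 2 by simp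
    hence "weighted_trace n (topw k) (G * Y * H) = weighted_trace n (topw k) Y + z * Y $$ (i, j)"
      using Y Hc by (simp add: assoc_mult_mat[of _ n n _ n _ n])
    moreover have "Re (weighted_trace n (topw k) (G * Y * H)) \<le> Re (weighted_trace n (topw k) Y)"
      using ky_fan_upper[OF Y k GH] complex_Re_le_cmod[of "weighted_trace n (topw k) (G * Y * H)"] opt by linarith
    ultimately show ?thesis by simp
  qed
  show ?thesis
    \<comment> \<open>The phases 1, -1, i, -i bound the real and the imaginary part from both
      sides.\<close>
    using key[of 1] key[of "-1"] key[of \<i>] key[of "-\<i>"] by (simp add: complex_eq_iff)
qed

section \<open>Kronecker products and digits of indices\<close>

text \<open>\<open>digit n m a i\<close> is the \<open>i\<close>-th digit of \<open>a < (\<Prod>i<m. n i)\<close> in the mixed radix system that the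
  left-bracketed Kronecker product induces on row and column indices.\<close>

fun digit :: "(nat \<Rightarrow> nat) \<Rightarrow> nat \<Rightarrow> nat \<Rightarrow> nat \<Rightarrow> nat" where
  "digit n 0 a i = 0"
| "digit n (Suc m) a i = (if i = m then a mod n m else digit n m (a div n m) i)"

fun of_digits :: "(nat \<Rightarrow> nat) \<Rightarrow> nat \<Rightarrow> (nat \<Rightarrow> nat) \<Rightarrow> nat" where
  "of_digits n 0 c = 0"
| "of_digits n (Suc m) c = of_digits n m c * n m + c m"

abbreviation prd :: "(nat \<Rightarrow> nat) \<Rightarrow> nat \<Rightarrow> nat" where
  "prd n m \<equiv> (\<Prod>i<m. n i)"

lemma div_less_prd: "a < prd n (Suc m) \<Longrightarrow> a div n m < prd n m"
  by (simp add: less_mult_imp_div_less)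

lemma prd_pos: "a < prd n m \<Longrightarrow> i < m \<Longrightarrow> n i > 0"
  by (metis gr_zeroI lessThan_iff less_nat_zero_code prod_zero finite_lessThan)

lemma digit_less: "a < prd n m \<Longrightarrow> i < m \<Longrightarrow> digit n m a i < n i"
proof (induction m arbitrary: a)
  case (Suc m)
  have "n i > 0" using prd_pos[OF Suc.prems] .
  thus ?case using Suc div_less_prd[OF Suc.prems(1)] by auto
qed simp

lemma of_digits_cong: "(\<And>i. i < m \<Longrightarrow> c i = c' i) \<Longrightarrow> of_digits n m c = of_digits n m c'"
  by (induction m) auto

lemma of_digits_less: "(\<And>i. i < m \<Longrightarrow> c i < n i) \<Longrightarrow> of_digits n m c < prd n m"
proof (induction m)
  case (Suc m)
  hence "of_digits n m c + 1 \<le> prd n m" "c m < n m" by (auto simp: Suc_le_eq)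
  hence "(of_digits n m c + 1) * n m \<le> prd n m * n m" using mult_le_mono1 by blast
  thus ?case using \<open>c m < n m\<close> by (simp add: algebra_simps)
qed simp

lemma of_digits_digit: "a < prd n m \<Longrightarrow> of_digits n m (digit n m a) = a"
proof (induction m arbitrary: a)
  case (Suc m)
  have "of_digits n m (digit n (Suc m) a) = of_digits n m (digit n m (a div n m))" by (rule of_digits_cong) auto
  hence "of_digits n m (digit n (Suc m) a) = a div n m" using Suc.IH[OF div_less_prd[OF Suc.prems]] by simp
  moreover have "digit n (Suc m) a m = a mod n m" by simp
  ultimately show ?case by (simp only: of_digits.simps div_mult_mod_eq)
qed simp

lemma digit_of_digits: "(\<And>i. i < m \<Longrightarrow> c i < n i) \<Longrightarrow> i < m \<Longrightarrow> digit n m (of_digits n m c) i = c i"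
proof (induction m)
  case (Suc m)
  have c: "c m < n m" using Suc.prems by simp
  hence "(of_digits n m c * n m + c m) div n m = of_digits n m c" by simp
  thus ?case using Suc c by (cases "i = m") (simp_all del: div_mult_self1 div_mult_self2 div_mult_self3 div_mult_self4)
qed simp

lemma digit_eq_iff:
  assumes "a < prd n m" "b < prd n m"
  shows "(\<forall>i<m. digit n m a i = digit n m b i) \<longleftrightarrow> a = b"
  using of_digits_digit[OF assms(1)] of_digits_digit[OF assms(2)] of_digits_cong[of m "digit n m a" "digit n m b" n] by auto

text \<open>The distributive law: indices below the product of the n_i correspond to tuples of
  digits. Splitting an index as q n_m + p separates the last digit.\<close>

lemma sum_prd_digits:
  fixes f :: "nat \<Rightarrow> nat \<Rightarrow> 'a :: comm_semiring_1"
  shows "(\<Sum>a<prd n m. \<Prod>i<m. f i (digit n m a i)) = (\<Prod>i<m. \<Sum>p<n i. f i p)"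
proof (induction m)
  case (Suc m)
  have *: "(\<Prod>i<Suc m. f i (digit n (Suc m) a i)) = (\<Prod>i<m. f i (digit n m (a div n m) i)) * f m (a mod n m)" for a
    by (auto intro!: prod.cong)
  have "(\<Sum>a<prd n (Suc m). \<Prod>i<Suc m. f i (digit n (Suc m) a i))
      = (\<Sum>a<prd n m * n m. (\<Prod>i<m. f i (digit n m (a div n m) i)) * f m (a mod n m))"
    unfolding * by simp
  also have "\<dots> = (\<Sum>q<prd n m. \<Sum>a\<in>{q * n m..<q * n m + n m}. (\<Prod>i<m. f i (digit n m (a div n m) i)) * f m (a mod n m))"
    by (rule sum.nat_group[symmetric])
  also have "\<dots> = (\<Sum>q<prd n m. \<Sum>p<n m. (\<Prod>i<m. f i (digit n m q i)) * f m p)"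
  proof (rule sum.cong[OF refl])
    fix q
    have "(\<Sum>a\<in>{q * n m..<q * n m + n m}. (\<Prod>i<m. f i (digit n m (a div n m) i)) * f m (a mod n m))
        = (\<Sum>p\<in>{0..<n m}. (\<Prod>i<m. f i (digit n m ((p + q * n m) div n m) i)) * f m ((p + q * n m) mod n m))"
      using sum.shift_bounds_nat_ivl[of "\<lambda>a. (\<Prod>i<m. f i (digit n m (a div n m) i)) * f m (a mod n m)" 0 "q * n m" "n m"]
      by (simp add: add.commute)
    thus "(\<Sum>a\<in>{q * n m..<q * n m + n m}. (\<Prod>i<m. f i (digit n m (a div n m) i)) * f m (a mod n m))
        = (\<Sum>p<n m. (\<Prod>i<m. f i (digit n m q i)) * f m p)"
      by (simp add: lessThan_atLeast0)
  qed
  also have "\<dots> = (\<Prod>i<Suc m. \<Sum>p<n i. f i p)"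
    unfolding sum_product[symmetric] Suc.IH by simp
  finally show ?case .
qed simp

section \<open>Kronecker products of families\<close>

definition carr :: "nat \<Rightarrow> (nat \<Rightarrow> nat) \<Rightarrow> (nat \<Rightarrow> complex mat) \<Rightarrow> bool" where
  "carr m n A \<longleftrightarrow> (\<forall>i<m. A i \<in> carrier_mat (n i) (n i))"

lemma carrD: "carr m n A \<Longrightarrow> i < m \<Longrightarrow> A i \<in> carrier_mat (n i) (n i)"
  by (simp add: carr_def)

lemma kp_carrier: "carr m n A \<Longrightarrow> kronecker_prod m A \<in> carrier_mat (prd n m) (prd n m)"
  by (rule kronecker_prod_carrier) (simp add: carr_def)

lemma kp_index:
  assumes "carr m n A" "a < prd n m" "b < prd n m"
  shows "kronecker_prod m A $$ (a, b) = (\<Prod>i<m. A i $$ (digit n m a i, digit n m b i))"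
  using assms
proof (induction m arbitrary: a b)
  case (Suc m)
  have c: "carr m n A" "A m \<in> carrier_mat (n m) (n m)" using Suc.prems by (auto simp: carr_def)
  have k: "kronecker_prod m A \<in> carrier_mat (prd n m) (prd n m)" using kp_carrier[OF c(1)] .
  have "kronecker_prod (Suc m) A $$ (a, b) = kronecker_prod m A $$ (a div n m, b div n m) * A m $$ (a mod n m, b mod n m)"
    using Suc.prems c carrier_matD[OF k] by (auto simp: kronecker_def)
  also have "\<dots> = (\<Prod>i<m. A i $$ (digit n m (a div n m) i, digit n m (b div n m) i)) * A m $$ (a mod n m, b mod n m)"
    using Suc.IH[OF c(1) div_less_prd[OF Suc.prems(2)] div_less_prd[OF Suc.prems(3)]] by simp
  also have "\<dots> = (\<Prod>i<Suc m. A i $$ (digit n (Suc m) a i, digit n (Suc m) b i))"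
    by (auto intro!: prod.cong)
  finally show ?case .
qed simp

lemma kp_eqI:
  assumes "carr m n A" "carr m n B" "\<And>i. i < m \<Longrightarrow> A i = B i"
  shows "kronecker_prod m A = kronecker_prod m B"
  using assms(3) by (induction m) auto

lemma carr_mult: "carr m n A \<Longrightarrow> carr m n B \<Longrightarrow> carr m n (\<lambda>i. A i * B i)"
  by (auto simp: carr_def)

text \<open>The mixed product rule, which is the distributive law applied to the sum over the middle
  index.\<close>

lemma kp_mult:
  assumes A: "carr m n A" and B: "carr m n B"
  shows "kronecker_prod m A * kronecker_prod m B = kronecker_prod m (\<lambda>i. A i * B i)"
proof (intro eq_matI)
  note kp_carrier[OF A] kp_carrier[OF B] kp_carrier[OF carr_mult[OF A B]]
  fix a b assume "a < dim_row (kronecker_prod m (\<lambda>i. A i * B i))" "b < dim_col (kronecker_prod m (\<lambda>i. A i * B i))"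
  hence ab: "a < prd n m" "b < prd n m" using kp_carrier[OF carr_mult[OF A B]] by auto
  have "(kronecker_prod m A * kronecker_prod m B) $$ (a, b) = (\<Sum>c<prd n m. kronecker_prod m A $$ (a, c) * kronecker_prod m B $$ (c, b))"
    using kp_carrier[OF A] kp_carrier[OF B] ab by (intro mult_mat_index)
  also have "\<dots> = (\<Sum>c<prd n m. \<Prod>i<m. A i $$ (digit n m a i, digit n m c i) * B i $$ (digit n m c i, digit n m b i))"
    using ab by (intro sum.cong) (auto simp: kp_index[OF A] kp_index[OF B] prod.distrib)
  also have "\<dots> = (\<Prod>i<m. \<Sum>p<n i. A i $$ (digit n m a i, p) * B i $$ (p, digit n m b i))"
    by (rule sum_prd_digits)
  also have "\<dots> = (\<Prod>i<m. (A i * B i) $$ (digit n m a i, digit n m b i))"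
  proof (intro prod.cong refl)
    fix i assume "i \<in> {..<m}"
    thus "(\<Sum>p<n i. A i $$ (digit n m a i, p) * B i $$ (p, digit n m b i)) = (A i * B i) $$ (digit n m a i, digit n m b i)"
      using carrD[OF A, of i] carrD[OF B, of i] digit_less[OF ab(1)] digit_less[OF ab(2)]
      by (intro mult_mat_index[symmetric]) auto
  qed
  also have "\<dots> = kronecker_prod m (\<lambda>i. A i * B i) $$ (a, b)"
    by (rule kp_index[symmetric, OF carr_mult[OF A B] ab])
  finally show "(kronecker_prod m A * kronecker_prod m B) $$ (a, b) = kronecker_prod m (\<lambda>i. A i * B i) $$ (a, b)" .
qed (use kp_carrier[OF A] kp_carrier[OF B] kp_carrier[OF carr_mult[OF A B]] in auto)

lemma kp_diagm: "kronecker_prod m (\<lambda>i. diagm (n i) (d i)) = diagm (prd n m) (\<lambda>a. \<Prod>i<m. d i (digit n m a i))"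
proof (intro eq_matI)
  have c: "carr m n (\<lambda>i. diagm (n i) (d i))" by (simp add: carr_def)
  fix a b assume "a < dim_row (diagm (prd n m) (\<lambda>a. \<Prod>i<m. d i (digit n m a i)))"
    "b < dim_col (diagm (prd n m) (\<lambda>a. \<Prod>i<m. d i (digit n m a i)))"
  hence ab: "a < prd n m" "b < prd n m" by auto
  have "kronecker_prod m (\<lambda>i. diagm (n i) (d i)) $$ (a, b)
      = (\<Prod>i<m. if digit n m a i = digit n m b i then d i (digit n m a i) else 0)"
    unfolding kp_index[OF c ab] using digit_less[OF ab(1)] digit_less[OF ab(2)] by (intro prod.cong) auto
  also have "\<dots> = (if a = b then \<Prod>i<m. d i (digit n m a i) else 0)"
  proof (cases "a = b")
    case False
    then obtain i where "i < m" "digit n m a i \<noteq> digit n m b i" using digit_eq_iff[OF ab] by blast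
    thus ?thesis using False by (auto intro!: prod_zero bexI[of _ i])
  qed simp
  finally show "kronecker_prod m (\<lambda>i. diagm (n i) (d i)) $$ (a, b)
      = diagm (prd n m) (\<lambda>a. \<Prod>i<m. d i (digit n m a i)) $$ (a, b)" using ab by simp
qed (use kp_carrier[of m n "\<lambda>i. diagm (n i) (d i)"] in \<open>auto simp: carr_def\<close>)

lemma one_mat_diagm: "1\<^sub>m n = diagm n (\<lambda>_. 1)"
  by (intro eq_matI) auto

lemma carr_adjoint: "carr m n A \<Longrightarrow> carr m n (\<lambda>i. mat_adjoint (A i))"
  by (auto simp: carr_def)

lemma kp_adjoint:
  assumes A: "carr m n A"
  shows "mat_adjoint (kronecker_prod m A) = kronecker_prod m (\<lambda>i. mat_adjoint (A i))"
proof (intro eq_matI)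
  note c = kp_carrier[OF A] kp_carrier[OF carr_adjoint[OF A]]
  fix a b assume "a < dim_row (kronecker_prod m (\<lambda>i. mat_adjoint (A i)))" "b < dim_col (kronecker_prod m (\<lambda>i. mat_adjoint (A i)))"
  hence ab: "a < prd n m" "b < prd n m" using c by auto
  have "mat_adjoint (kronecker_prod m A) $$ (a, b) = (\<Prod>i<m. cnj (A i $$ (digit n m b i, digit n m a i)))"
    using c(1) ab by (simp add: kp_index[OF A])
  also have "\<dots> = (\<Prod>i<m. mat_adjoint (A i) $$ (digit n m a i, digit n m b i))"
  proof (rule prod.cong[OF refl])
    fix i assume "i \<in> {..<m}"
    thus "cnj (A i $$ (digit n m b i, digit n m a i)) = mat_adjoint (A i) $$ (digit n m a i, digit n m b i)"
      using carrier_matD[OF carrD[OF A, of i]] digit_less[OF ab(1), of i] digit_less[OF ab(2), of i] by simp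
  qed
  finally show "mat_adjoint (kronecker_prod m A) $$ (a, b) = kronecker_prod m (\<lambda>i. mat_adjoint (A i)) $$ (a, b)"
    using ab by (simp add: kp_index[OF carr_adjoint[OF A]])
qed (use kp_carrier[OF A] kp_carrier[OF carr_adjoint[OF A]] in auto)

lemma kp_unitary:
  assumes "\<And>i. i < m \<Longrightarrow> unitary_mat (n i) (U i)"
  shows "unitary_mat (prd n m) (kronecker_prod m U)"
proof (rule unitary_matI)
  have U: "carr m n U" using assms unitary_matD(1) by (auto simp: carr_def)
  show "kronecker_prod m U \<in> carrier_mat (prd n m) (prd n m)" using kp_carrier[OF U] .
  have "mat_adjoint (kronecker_prod m U) * kronecker_prod m U = kronecker_prod m (\<lambda>i. mat_adjoint (U i) * U i)"
    by (simp add: kp_adjoint[OF U] kp_mult[OF carr_adjoint[OF U] U])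
  also have "\<dots> = kronecker_prod m (\<lambda>i. diagm (n i) (\<lambda>_. 1))"
    using assms unitary_matD(2) by (intro kp_eqI[of m n] carr_mult carr_adjoint U) (auto simp: carr_def one_mat_diagm)
  finally show "mat_adjoint (kronecker_prod m U) * kronecker_prod m U = 1\<^sub>m (prd n m)"
    by (simp add: kp_diagm one_mat_diagm)
qed

text \<open>The last digit takes the base z and the leading digits the base z^(n_m), because a = (a
  div n_m) n_m + a mod n_m.\<close>

lemma power_product_form: "\<exists>d. \<forall>a<prd n m. (\<Prod>i<m. d i (digit n m a i)) = (z :: complex) ^ a"
proof (induction m arbitrary: z)
  case (Suc m)
  obtain d where d: "\<forall>a<prd n m. (\<Prod>i<m. d i (digit n m a i)) = (z ^ n m) ^ a" using Suc.IH by blast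
  show ?case
  proof (intro exI allI impI)
    fix a assume a: "a < prd n (Suc m)"
    have "(\<Prod>i<m. (d(m := \<lambda>p. z ^ p)) i (digit n (Suc m) a i)) = (\<Prod>i<m. d i (digit n m (a div n m) i))"
      by (intro prod.cong) auto
    also have "\<dots> = (z ^ n m) ^ (a div n m)" using d div_less_prd[OF a] by blast
    finally have "(\<Prod>i<Suc m. (d(m := \<lambda>p. z ^ p)) i (digit n (Suc m) a i)) = (z ^ n m) ^ (a div n m) * z ^ (a mod n m)" by simp
    also have "\<dots> = z ^ a" by (simp flip: power_mult power_add)
    finally show "(\<Prod>i<Suc m. (d(m := \<lambda>p. z ^ p)) i (digit n (Suc m) a i)) = z ^ a" .
  qed
qed simp

section \<open>Linear maps that preserve the norm of products\<close>

definition preserver :: "nat \<Rightarrow> (nat \<Rightarrow> nat) \<Rightarrow> nat \<Rightarrow> (complex mat \<Rightarrow> complex mat) \<Rightarrow> bool" where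
  "preserver m n k \<phi> \<longleftrightarrow>
     (\<forall>X \<in> carrier_mat (prd n m) (prd n m). \<phi> X \<in> carrier_mat (prd n m) (prd n m)) \<and>
     (\<forall>X \<in> carrier_mat (prd n m) (prd n m). \<forall>Y \<in> carrier_mat (prd n m) (prd n m). \<phi> (X + Y) = \<phi> X + \<phi> Y) \<and>
     (\<forall>c. \<forall>X \<in> carrier_mat (prd n m) (prd n m). \<phi> (c \<cdot>\<^sub>m X) = c \<cdot>\<^sub>m \<phi> X) \<and>
     (\<forall>A. carr m n A \<longrightarrow> ky_fan_norm k (\<phi> (kronecker_prod m A)) = ky_fan_norm k (kronecker_prod m A))"

lemma preserverD:
  assumes "preserver m n k \<phi>"
  shows "X \<in> carrier_mat (prd n m) (prd n m) \<Longrightarrow> \<phi> X \<in> carrier_mat (prd n m) (prd n m)"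
    "\<lbrakk>X \<in> carrier_mat (prd n m) (prd n m); Y \<in> carrier_mat (prd n m) (prd n m)\<rbrakk> \<Longrightarrow> \<phi> (X + Y) = \<phi> X + \<phi> Y"
    "X \<in> carrier_mat (prd n m) (prd n m) \<Longrightarrow> \<phi> (c \<cdot>\<^sub>m X) = c \<cdot>\<^sub>m \<phi> X"
    "carr m n A \<Longrightarrow> ky_fan_norm k (\<phi> (kronecker_prod m A)) = ky_fan_norm k (kronecker_prod m A)"
  using assms unfolding preserver_def by blast+

lemma preserver_sum:
  assumes \<phi>: "preserver m n k \<phi>" and fin: "finite I"
    and X: "\<And>t. t \<in> I \<Longrightarrow> X t \<in> carrier_mat (prd n m) (prd n m)" and ij: "i < prd n m" "j < prd n m"
  shows "\<phi> (mat (prd n m) (prd n m) (\<lambda>p. \<Sum>t\<in>I. c t * X t $$ p)) $$ (i, j) = (\<Sum>t\<in>I. c t * \<phi> (X t) $$ (i, j))"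
  using fin X
proof (induction I rule: finite_induct)
  case empty
  \<comment> \<open>The empty sum is covered by homogeneity: the zero matrix is 0 times
    itself.\<close>
  let ?Z = "mat (prd n m) (prd n m) (\<lambda>p. 0) :: complex mat"
  have "0 \<cdot>\<^sub>m ?Z = ?Z" by (intro eq_matI) auto
  hence "\<phi> ?Z = 0 \<cdot>\<^sub>m \<phi> ?Z" using preserverD(3)[OF \<phi>, of ?Z 0] by simp
  hence "\<phi> ?Z $$ (i, j) = (0 \<cdot>\<^sub>m \<phi> ?Z) $$ (i, j)" by simp
  thus ?case using preserverD(1)[OF \<phi>, of ?Z] ij by simp
next
  case (insert t I)
  let ?Z = "\<lambda>I. mat (prd n m) (prd n m) (\<lambda>p. \<Sum>t\<in>I. c t * X t $$ p)"
  have Xt: "X t \<in> carrier_mat (prd n m) (prd n m)" using insert.prems by simp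
  have "?Z (insert t I) = c t \<cdot>\<^sub>m X t + ?Z I"
    using insert.hyps Xt by (intro eq_matI) auto
  hence "\<phi> (?Z (insert t I)) = c t \<cdot>\<^sub>m \<phi> (X t) + \<phi> (?Z I)"
    using preserverD(2)[OF \<phi>, of "c t \<cdot>\<^sub>m X t" "?Z I"] preserverD(3)[OF \<phi> Xt] Xt by simp
  thus ?case using insert.IH insert.prems insert.hyps ij preserverD(1)[OF \<phi>, of "?Z I"] preserverD(1)[OF \<phi> Xt] by simp
qed

text \<open>Allows the unitary factors in singular value decompositions of the A_i to be absorbed
  into the map.\<close>

lemma preserver_twist:
  assumes \<phi>: "preserver m n k \<phi>" and U: "\<And>i. i < m \<Longrightarrow> unitary_mat (n i) (U i)" and V: "\<And>i. i < m \<Longrightarrow> unitary_mat (n i) (V i)"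
  shows "preserver m n k (\<lambda>X. \<phi> (kronecker_prod m U * X * kronecker_prod m V))"
proof -
  let ?U = "kronecker_prod m U" and ?V = "kronecker_prod m V"
  note u = kp_unitary[of m n U, OF U] and v = kp_unitary[of m n V, OF V]
  note c = unitary_matD(1)[OF u] unitary_matD(1)[OF v]
  have cu: "carr m n U" "carr m n V" using U V unitary_matD(1) by (auto simp: carr_def)
  show ?thesis unfolding preserver_def
  proof (intro conjI ballI allI impI)
    fix X :: "complex mat" assume X: "X \<in> carrier_mat (prd n m) (prd n m)"
    show "\<phi> (?U * X * ?V) \<in> carrier_mat (prd n m) (prd n m)" using preserverD(1)[OF \<phi>] c X by simp
    show "\<phi> (?U * (z \<cdot>\<^sub>m X) * ?V) = z \<cdot>\<^sub>m \<phi> (?U * X * ?V)" for z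
    proof -
      have "?U * (z \<cdot>\<^sub>m X) * ?V = z \<cdot>\<^sub>m (?U * X * ?V)" using c X
        by (simp add: mult_smult_distrib[of _ "prd n m" "prd n m"] mult_smult_assoc_mat[of _ "prd n m" "prd n m" _ "prd n m"])
      thus ?thesis using preserverD(3)[OF \<phi>] c X by simp
    qed
    fix Y :: "complex mat" assume Y: "Y \<in> carrier_mat (prd n m) (prd n m)"
    have "?U * (X + Y) * ?V = ?U * X * ?V + ?U * Y * ?V" using c X Y
      by (simp add: mult_add_distrib_mat[of _ "prd n m" "prd n m"] add_mult_distrib_mat[of _ "prd n m" "prd n m" _ _ "prd n m"])
    thus "\<phi> (?U * (X + Y) * ?V) = \<phi> (?U * X * ?V) + \<phi> (?U * Y * ?V)"
      using preserverD(2)[OF \<phi>] c X Y by simp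
  next
    fix A assume A: "carr m n A"
    have "?U * kronecker_prod m A * ?V = kronecker_prod m (\<lambda>i. U i * A i * V i)"
      by (simp add: kp_mult[OF cu(1) A] kp_mult[OF carr_mult[OF cu(1) A] cu(2)])
    moreover have "carr m n (\<lambda>i. U i * A i * V i)" by (intro carr_mult cu A)
    ultimately have "ky_fan_norm k (\<phi> (?U * kronecker_prod m A * ?V)) = ky_fan_norm k (?U * kronecker_prod m A * ?V)"
      using preserverD(4)[OF \<phi>] by metis
    thus "ky_fan_norm k (\<phi> (?U * kronecker_prod m A * ?V)) = ky_fan_norm k (kronecker_prod m A)"
      using ky_fan_unitary[OF u v kp_carrier[OF A]] by simp
  qed
qed

section \<open>Images of rank one products\<close>

definition zero_ext :: "nat \<Rightarrow> complex vec \<Rightarrow> complex vec" where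
  "zero_ext n x = vec n (\<lambda>i. if i < dim_vec x then x $ i else 0)"

definition lead_block :: "nat \<Rightarrow> complex mat \<Rightarrow> complex mat" where
  "lead_block k Y = mat k k (\<lambda>p. Y $$ p)"

lemma smult_mult_mat_vec:
  fixes A :: "complex mat"
  assumes "A \<in> carrier_mat a b" "x \<in> carrier_vec b"
  shows "(c \<cdot>\<^sub>m A) *\<^sub>v x = c \<cdot>\<^sub>v (A *\<^sub>v x)"
  using assms by (intro eq_vecI) (auto simp: mult_mat_vec_index[of _ a b] sum_distrib_left algebra_simps)

lemma zero_ext_zero: "zero_ext n (0\<^sub>v k) = 0\<^sub>v n"
  by (intro eq_vecI) (auto simp: zero_ext_def)

lemma zero_ext_carrier [simp]: "zero_ext n x \<in> carrier_vec n" by (simp add: zero_ext_def)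

lemma lead_block_carrier [simp]: "lead_block k Y \<in> carrier_mat k k" by (simp add: lead_block_def)

lemma ip_zero_ext:
  assumes "x \<in> carrier_vec k" "y \<in> carrier_vec k" "k \<le> n"
  shows "ip (zero_ext n x) (zero_ext n y) = ip x y"
proof -
  have "ip (zero_ext n x) (zero_ext n y) = (\<Sum>i<n. cnj (zero_ext n x $ i) * zero_ext n y $ i)" by (simp add: ip_carrier[of _ n])
  also have "\<dots> = (\<Sum>i<k. cnj (x $ i) * y $ i)"
    using assms by (intro sum.mono_neutral_cong_right) (auto simp: zero_ext_def)
  finally show ?thesis using assms by (simp add: ip_carrier[of _ k])
qed

lemma mult_zero_ext:
  assumes Y: "Y \<in> carrier_mat n n" and x: "x \<in> carrier_vec k" and k: "k \<le> n"
    and z: "\<And>i j. k \<le> i \<Longrightarrow> i < n \<Longrightarrow> j < k \<Longrightarrow> Y $$ (i, j) = 0"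
  shows "Y *\<^sub>v zero_ext n x = zero_ext n (lead_block k Y *\<^sub>v x)"
proof (intro eq_vecI)
  fix i assume "i < dim_vec (zero_ext n (lead_block k Y *\<^sub>v x))"
  hence i: "i < n" by (simp add: zero_ext_def)
  have "(Y *\<^sub>v zero_ext n x) $ i = (\<Sum>l<n. Y $$ (i, l) * zero_ext n x $ l)"
    using Y i by (intro mult_mat_vec_index) auto
  also have "\<dots> = (\<Sum>l<k. Y $$ (i, l) * x $ l)"
    using x k by (intro sum.mono_neutral_cong_right) (auto simp: zero_ext_def)
  also have "\<dots> = zero_ext n (lead_block k Y *\<^sub>v x) $ i"
  proof (cases "i < k")
    case True
    have "(lead_block k Y *\<^sub>v x) $ i = (\<Sum>l<k. lead_block k Y $$ (i, l) * x $ l)"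
      using x True by (intro mult_mat_vec_index) auto
    thus ?thesis using True i by (simp add: zero_ext_def lead_block_def)
  next
    case False
    thus ?thesis using z[of i] i by (simp add: zero_ext_def lead_block_def)
  qed
  finally show "(Y *\<^sub>v zero_ext n x) $ i = zero_ext n (lead_block k Y *\<^sub>v x) $ i" .
qed (use Y in \<open>auto simp: zero_ext_def\<close>)

text \<open>The truncated matrix of \<open>ky_fan_opt\<close> acts like the leading block on vectors
  supported on the first k coordinates.\<close>

lemma psd_lead_block:
  assumes Y: "Y \<in> carrier_mat n n" and k: "k \<le> n" and opt: "ky_fan_norm k Y \<le> Re (weighted_trace n (topw k) Y)"
  shows "psd k (lead_block k Y)"
  unfolding psd_def
proof (intro conjI ballI)
  note b = ky_fan_opt[OF Y k opt]
  let ?J = "diagm n (\<lambda>i. complex_of_real (topw k i))"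
  fix x :: "complex vec" assume x: "x \<in> carrier_vec k"
  have "Y * ?J \<in> carrier_mat n n" using Y by simp
  have z: "(Y * ?J) $$ (i, j) = 0" if "k \<le> i" "i < n" "j < k" for i j
    using b(3)[OF that(3,1,2)] that k by (simp add: diagm_mult_right[OF Y])
  have "lead_block k (Y * ?J) = lead_block k Y"
    using k by (intro eq_matI) (auto simp: lead_block_def diagm_mult_right[OF Y])
  hence "(Y * ?J) *\<^sub>v zero_ext n x = zero_ext n (lead_block k Y *\<^sub>v x)"
    using mult_zero_ext[OF _ x k z] Y by simp
  hence "ip (zero_ext n x) ((Y * ?J) *\<^sub>v zero_ext n x) = ip x (lead_block k Y *\<^sub>v x)"
    using ip_zero_ext[OF x _ k] x by simp
  with psdD(2)[OF b(1) zero_ext_carrier[of n x]] show "0 \<le> ip x (lead_block k Y *\<^sub>v x)" by simp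
qed simp

section \<open>Simultaneous maximisers and generic phases\<close>

lemma mult3_sum:
  fixes U V :: "complex mat"
  assumes "U \<in> carrier_mat N N" "V \<in> carrier_mat N N" "\<And>a. a \<in> I \<Longrightarrow> P a \<in> carrier_mat N N"
    and ij: "i < N" "j < N"
  shows "(U * mat N N (\<lambda>p. \<Sum>a\<in>I. c a * P a $$ p) * V) $$ (i, j) = (\<Sum>a\<in>I. c a * (U * P a * V) $$ (i, j))"
proof -
  have e: "(U * X * V) $$ (i, j) = (\<Sum>m<N. \<Sum>l<N. U $$ (i, l) * V $$ (m, j) * X $$ (l, m))" if "X \<in> carrier_mat N N" for X
  proof -
    have "(U * X * V) $$ (i, j) = (\<Sum>m<N. (U * X) $$ (i, m) * V $$ (m, j))"
      using assms that by (intro mult_mat_index) auto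
    also have "\<dots> = (\<Sum>m<N. \<Sum>l<N. U $$ (i, l) * V $$ (m, j) * X $$ (l, m))"
    proof (rule sum.cong[OF refl])
      fix m assume "m \<in> {..<N}"
      hence "(U * X) $$ (i, m) = (\<Sum>l<N. U $$ (i, l) * X $$ (l, m))"
        using assms that by (intro mult_mat_index) auto
      thus "(U * X) $$ (i, m) * V $$ (m, j) = (\<Sum>l<N. U $$ (i, l) * V $$ (m, j) * X $$ (l, m))"
        by (simp only: sum_distrib_right) (simp add: mult_ac)
    qed
    finally show ?thesis .
  qed
  have "(U * mat N N (\<lambda>p. \<Sum>a\<in>I. c a * P a $$ p) * V) $$ (i, j)
      = (\<Sum>m<N. \<Sum>l<N. \<Sum>a\<in>I. c a * (U $$ (i, l) * V $$ (m, j) * P a $$ (l, m)))"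
    by (subst e) (auto simp: sum_distrib_left mult_ac intro!: sum.cong)
  also have "\<dots> = (\<Sum>a\<in>I. \<Sum>m<N. \<Sum>l<N. c a * (U $$ (i, l) * V $$ (m, j) * P a $$ (l, m)))"
    by (subst sum.swap[of _ I]) (auto intro!: sum.cong sum.swap)
  also have "\<dots> = (\<Sum>a\<in>I. c a * (U * P a * V) $$ (i, j))"
    using assms by (intro sum.cong) (auto simp: e sum_distrib_left)
  finally show ?thesis .
qed

lemma weighted_trace_mult3_sum:
  assumes "U \<in> carrier_mat N N" "V \<in> carrier_mat N N" "\<And>a. a \<in> I \<Longrightarrow> P a \<in> carrier_mat N N"
  shows "weighted_trace N w (U * mat N N (\<lambda>p. \<Sum>a\<in>I. c a * P a $$ p) * V) = (\<Sum>a\<in>I. c a * weighted_trace N w (U * P a * V))"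
proof -
  have "weighted_trace N w (U * mat N N (\<lambda>p. \<Sum>a\<in>I. c a * P a $$ p) * V)
     = (\<Sum>i<N. \<Sum>a\<in>I. c a * (of_real (w i) * (U * P a * V) $$ (i, i)))"
    unfolding weighted_trace_def by (simp add: mult3_sum[of U N V I P, OF assms] sum_distrib_left mult_ac)
  also have "\<dots> = (\<Sum>a\<in>I. c a * weighted_trace N w (U * P a * V))"
    unfolding weighted_trace_def by (subst sum.swap) (simp add: sum_distrib_left)
  finally show ?thesis .
qed

text \<open>As \<open>r \<rightarrow> 0\<close>, maximisers of \<open>Re (tr (J U f V))\<close> for \<open>f = (\<Sum>a. (r \<theta>) ^ a P a)\<close> converge to a pair that is
  optimal for each of \<open>\<theta> ^ a P a\<close>, \<open>a < k\<close>, at the same time.\<close>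

lemma common_maximiser:
  assumes P: "\<And>a. a < N \<Longrightarrow> P a \<in> carrier_mat N N" and k: "k \<le> N"
    and nrm: "\<And>a. a < N \<Longrightarrow> ky_fan_norm k (P a) = 1"
    and \<theta>: "cmod \<theta> = 1"
    and f: "\<And>r::real. 0 < r \<Longrightarrow> r \<le> 1 \<Longrightarrow>
       ky_fan_norm k (mat N N (\<lambda>p. \<Sum>a<N. (of_real r * \<theta>) ^ a * P a $$ p)) = (\<Sum>a<k. r ^ a)"
  shows "\<exists>U V. unitary_mat N U \<and> unitary_mat N V \<and> (\<forall>a<k. 1 \<le> Re (\<theta> ^ a * weighted_trace N (topw k) (U * P a * V)))"
proof -
  define R where "R s = 1 / real (Suc s)" for s
  have R: "0 < R s" "R s \<le> 1" for s by (auto simp: R_def)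
  define F where "F s = mat N N (\<lambda>p. \<Sum>a<N. (of_real (R s) * \<theta>) ^ a * P a $$ p)" for s
  have Fc: "F s \<in> carrier_mat N N" for s by (simp add: F_def)
  have "\<exists>U V. unitary_mat N U \<and> unitary_mat N V \<and> weighted_trace N (topw k) (U * F s * V) = of_real (\<Sum>a<k. R s ^ a)" for s
  proof -
    obtain U V where UV: "unitary_mat N U" "unitary_mat N V" "weighted_trace N (topw k) (U * F s * V) = of_real (ky_fan_norm k (F s))"
      by (rule ky_fan_attained[OF Fc k])
    have "ky_fan_norm k (F s) = (\<Sum>a<k. R s ^ a)" unfolding F_def by (rule f[OF R])
    with UV show ?thesis by (intro exI[of _ U] exI[of _ V]) simp
  qed
  then have "\<exists>A B. \<forall>s. unitary_mat N (A s) \<and> unitary_mat N (B s) \<and> weighted_trace N (topw k) (A s * F s * B s) = of_real (\<Sum>a<k. R s ^ a)"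
    by metis
  then obtain A B where AB: "\<And>s. unitary_mat N (A s)" "\<And>s. unitary_mat N (B s)"
    "\<And>s. weighted_trace N (topw k) (A s * F s * B s) = of_real (\<Sum>a<k. R s ^ a)" by blast
  obtain r U V where r: "strict_mono r" "unitary_mat N U" "unitary_mat N V"
    "mat_lim N (\<lambda>s. A (r s)) U" "mat_lim N (\<lambda>s. B (r s)) V"
    using unitary_pair_subseq[of N A B] AB by blast
  define h where "h s a = \<theta> ^ a * weighted_trace N (topw k) (A s * P a * B s)" for s a
  have h1: "Re (h s a) \<le> 1" "- Re (h s a) \<le> 1" if "a < N" for s a
  proof -
    have "cmod (h s a) \<le> 1"
      unfolding h_def norm_mult norm_power \<theta> using ky_fan_upper[OF P[OF that] k AB(1,2)] nrm[OF that] by simp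
    thus "Re (h s a) \<le> 1" "- Re (h s a) \<le> 1" using abs_Re_le_cmod[of "h s a"] by linarith+
  qed
  \<comment> \<open>The defects 1 - Re h, weighted by r^b for b < k, add up to the terms of order k
    and higher, at most N r^k. Division by r^a with a < k still leaves a factor r, so each defect
    tends to 0.\<close>
  have bound: "1 - Re (h s a) \<le> real N * R s" if "a < k" for s a
  proof -
    have "of_real (\<Sum>b<k. R s ^ b) = (\<Sum>b<N. (of_real (R s) * \<theta>) ^ b * weighted_trace N (topw k) (A s * P b * B s))"
      unfolding AB(3)[symmetric] F_def using P unitary_matD(1)[OF AB(1)] unitary_matD(1)[OF AB(2)]
      by (intro weighted_trace_mult3_sum) auto
    also have "\<dots> = (\<Sum>b<N. of_real (R s ^ b) * h s b)" by (simp add: h_def power_mult_distrib algebra_simps)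
    finally have "Re (of_real (\<Sum>b<k. R s ^ b)) = Re (\<Sum>b<N. of_real (R s ^ b) * h s b)" by (rule arg_cong)
    hence "(\<Sum>b<k. R s ^ b) = (\<Sum>b<N. R s ^ b * Re (h s b))" by (simp del: of_real_power of_real_sum)
    also have "\<dots> = (\<Sum>b<k. R s ^ b * Re (h s b)) + (\<Sum>b=k..<N. R s ^ b * Re (h s b))"
      using k by (simp add: lessThan_atLeast0 sum.atLeastLessThan_concat)
    finally have e: "(\<Sum>b<k. R s ^ b * (1 - Re (h s b))) = (\<Sum>b=k..<N. R s ^ b * Re (h s b))"
      by (simp add: right_diff_distrib sum_subtractf)
    have "R s ^ a * (1 - Re (h s a)) \<le> (\<Sum>b<k. R s ^ b * (1 - Re (h s b)))"
      using that h1 k R(1)[of s] by (intro member_le_sum) auto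
    also have "\<dots> \<le> (\<Sum>b=k..<N. R s ^ k)" unfolding e
    proof (rule sum_mono)
      fix b assume b: "b \<in> {k..<N}"
      have "R s ^ b * Re (h s b) \<le> R s ^ b * 1" using h1(1)[of b s] R[of s] b by (intro mult_left_mono) auto
      also have "\<dots> \<le> R s ^ k" using R[of s] b by (simp add: power_decreasing)
      finally show "R s ^ b * Re (h s b) \<le> R s ^ k" .
    qed
    also have "\<dots> \<le> real N * R s ^ k" using R(1)[of s] by (simp add: mult_right_mono)
    also have "\<dots> \<le> real N * R s ^ Suc a" using R[of s] that by (intro mult_left_mono power_decreasing) auto
    finally have "R s ^ a * (1 - Re (h s a)) \<le> R s ^ a * (real N * R s)" by (simp add: algebra_simps)
    thus ?thesis using R(1)[of s] by (simp add: mult_le_cancel_left_pos)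
  qed
  have "1 \<le> Re (\<theta> ^ a * weighted_trace N (topw k) (U * P a * V))" if a: "a < k" for a
  proof -
    have lim: "(\<lambda>s. Re (h (r s) a)) \<longlonglongrightarrow> Re (\<theta> ^ a * weighted_trace N (topw k) (U * P a * V))"
      unfolding h_def using a k by (intro tendsto_Re tendsto_mult tendsto_const weighted_trace_lim mat_lim_mult mat_lim_const r P) auto
    have "(\<lambda>s. 1 - real N * R s) \<longlonglongrightarrow> 1 - real N * 0"
      unfolding R_def by (intro tendsto_diff tendsto_mult tendsto_const LIMSEQ_Suc[OF lim_1_over_n])
    from LIMSEQ_subseq_LIMSEQ[OF this r(1)] have "(\<lambda>s. 1 - real N * R (r s)) \<longlonglongrightarrow> 1" by (simp add: o_def)
    moreover have "1 - real N * R (r s) \<le> Re (h (r s) a)" for s using bound[OF a, of "r s"] by linarith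
    ultimately show ?thesis using LIMSEQ_le[OF _ lim] by blast
  qed
  with r show ?thesis by blast
qed

lemma infinite_unit_circle: "infinite {z :: complex. cmod z = 1}"
proof
  assume fin: "finite {z :: complex. cmod z = 1}"
  \<comment> \<open>One root of unity more than the supposed number of points on the circle.\<close>
  define n where "n = Suc (card {z :: complex. cmod z = 1})"
  have n: "n > 0" by (simp add: n_def)
  have "{z :: complex. z ^ n = 1} \<subseteq> {z. cmod z = 1}"
  proof clarify
    fix z :: complex assume "z ^ n = 1"
    hence "cmod z ^ n = 1 ^ n" by (metis norm_one norm_power power_one)
    thus "cmod z = 1" using n power_eq_imp_eq_base[of "cmod z" n 1] by simp
  qed
  from card_mono[OF fin this] have "n \<le> card {z :: complex. cmod z = 1}" using card_roots_unity_eq[OF n] by simp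
  thus False by (simp add: n_def)
qed

text \<open>For given l the excluded phases are roots of the polynomial l X^b - |l| X^a, which is
  nonzero as a and b differ. These are finitely many in all, while the circle is infinite.\<close>

lemma generic_phase:
  assumes "\<And>a b. a < k \<Longrightarrow> b < k \<Longrightarrow> finite (S a b)"
  shows "\<exists>\<theta>. cmod \<theta> = 1 \<and> (\<forall>a<k. \<forall>b<k. a \<noteq> b \<longrightarrow> (\<forall>l \<in> S a b. l \<noteq> 0 \<longrightarrow> l * \<theta> ^ b \<noteq> of_real (cmod l) * \<theta> ^ a))"
proof -
  define bad where "bad = (\<Union>a<k. \<Union>b\<in>{..<k}-{a}. \<Union>l\<in>S a b - {0}. {\<theta>. poly (monom l b - monom (of_real (cmod l)) a) \<theta> = 0})"
  have "finite bad" unfolding bad_def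
  proof (intro finite_UN_I finite_lessThan finite_Diff assms)
    fix a b l assume ab: "a \<in> {..<k}" "b \<in> {..<k} - {a}" and l: "l \<in> S a b - {0}"
    have "monom l b - monom (of_real (cmod l)) a \<noteq> 0"
    proof
      assume "monom l b - monom (of_real (cmod l)) a = 0"
      hence "coeff (monom l b - monom (of_real (cmod l)) a) b = 0" by simp
      thus False using ab l by simp
    qed
    thus "finite {\<theta>. poly (monom l b - monom (of_real (cmod l)) a) \<theta> = 0}" by (rule poly_roots_finite)
  qed auto
  hence "{z :: complex. cmod z = 1} - bad \<noteq> {}" using infinite_unit_circle by (metis Diff_eq_empty_iff finite_subset)
  then obtain \<theta> where "cmod \<theta> = 1" "\<theta> \<notin> bad" by blast
  thus ?thesis by (intro exI[of _ \<theta>]) (auto simp: bad_def poly_monom)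
qed

text \<open>For the pair \<open>(U, V)\<close> of the previous lemma, \<open>Y a = \<theta> ^ a U (P a) V\<close> has a positive semidefinite leading
  block \<open>M a\<close>. A nonzero product \<open>M a * M b\<close> would have a positive eigenvalue, so \<open>(P a)\<^sup>* (P b)\<close> would have
  one on the ray through \<open>\<theta> ^ a / \<theta> ^ b\<close>; a generic \<open>\<theta>\<close> avoids this. Thus the \<open>k\<close> blocks, of size \<open>k\<close>,
  annihilate each other and have rank one.\<close>

lemma rank1_first:
  assumes P: "\<And>a. a < N \<Longrightarrow> P a \<in> carrier_mat N N" and k: "2 \<le> k" "k \<le> N"
    and nrm: "\<And>a. a < N \<Longrightarrow> ky_fan_norm k (P a) = 1"
    and f: "\<And>z. z \<noteq> 0 \<Longrightarrow> cmod z \<le> 1 \<Longrightarrow>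
       ky_fan_norm k (mat N N (\<lambda>p. \<Sum>a<N. z ^ a * P a $$ p)) = (\<Sum>a<k. cmod z ^ a)"
  shows "rank1 N (P 0)"
proof -
  define S where "S a b = spectrum (mat_adjoint (P a) * P b)" for a b
  have "finite (S a b)" if "a < k" "b < k" for a b
    unfolding S_def using that k by (intro card_finite_spectrum(1)[of _ N] mult_carrier_mat_square mat_adjoint_carrier P) auto
  from generic_phase[of k S, OF this] obtain \<theta> where \<theta>: "cmod \<theta> = 1"
    and gen: "\<And>a b l. \<lbrakk>a < k; b < k; a \<noteq> b; l \<in> S a b; l \<noteq> 0\<rbrakk> \<Longrightarrow> l * \<theta> ^ b \<noteq> of_real (cmod l) * \<theta> ^ a"
    by blast
  have \<theta>0: "\<theta> \<noteq> 0" using \<theta> by auto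
  have "\<exists>U V. unitary_mat N U \<and> unitary_mat N V \<and> (\<forall>a<k. 1 \<le> Re (\<theta> ^ a * weighted_trace N (topw k) (U * P a * V)))"
  proof (rule common_maximiser[OF P k(2) nrm \<theta>])
    fix r :: real assume "0 < r" "r \<le> 1"
    thus "ky_fan_norm k (mat N N (\<lambda>p. \<Sum>a<N. (of_real r * \<theta>) ^ a * P a $$ p)) = (\<Sum>a<k. r ^ a)"
      using f[of "of_real r * \<theta>"] \<theta> \<theta>0 by (simp add: norm_mult)
  qed
  then obtain U V where U: "unitary_mat N U" and V: "unitary_mat N V"
    and opt: "\<And>a. a < k \<Longrightarrow> 1 \<le> Re (\<theta> ^ a * weighted_trace N (topw k) (U * P a * V))" by blast
  note c = unitary_matD(1)[OF U] unitary_matD(1)[OF V]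
  \<comment> \<open>The phase is absorbed into the left unitary factor, so that \<open>Y a\<close>
    itself attains its norm as truncated trace.\<close>
  define Y where "Y a = (\<theta> ^ a \<cdot>\<^sub>m U) * P a * V" for a
  have Pc: "P a \<in> carrier_mat N N" if "a < k" for a using P that k by simp
  have U': "unitary_mat N (\<theta> ^ a \<cdot>\<^sub>m U)" for a using unitary_smult[OF U] \<theta> by (simp add: norm_power)
  have Ye: "Y a = \<theta> ^ a \<cdot>\<^sub>m (U * P a * V)" if "a < k" for a
    unfolding Y_def using c Pc[OF that] by (simp add: mult_smult_assoc_mat[of _ N N _ N])
  have Yc: "Y a \<in> carrier_mat N N" if "a < k" for a using Ye[OF that] c Pc[OF that] by simp
  have Yopt: "ky_fan_norm k (Y a) \<le> Re (weighted_trace N (topw k) (Y a))" "1 \<le> Re (weighted_trace N (topw k) (Y a))" if "a < k" for a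
  proof -
    have "weighted_trace N (topw k) (Y a) = \<theta> ^ a * weighted_trace N (topw k) (U * P a * V)"
      unfolding Ye[OF that] weighted_trace_def using c Pc[OF that] by (auto simp: sum_distrib_left algebra_simps intro!: sum.cong)
    thus "1 \<le> Re (weighted_trace N (topw k) (Y a))" using opt[OF that] by simp
    moreover have "ky_fan_norm k (Y a) = 1" unfolding Y_def using ky_fan_unitary[OF U' V Pc[OF that]] nrm that k by simp
    ultimately show "ky_fan_norm k (Y a) \<le> Re (weighted_trace N (topw k) (Y a))" by simp
  qed
  define M where "M a = lead_block k (Y a)" for a
  have Mc: "M a \<in> carrier_mat k k" for a by (simp add: M_def)
  have M: "psd k (M a)" if "a < k" for a unfolding M_def by (rule psd_lead_block[OF Yc k(2) Yopt(1)]) fact+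
  note Yb = ky_fan_opt(3)[OF Yc k(2) Yopt(1)]
  have Yx: "Y a *\<^sub>v zero_ext N x = zero_ext N (M a *\<^sub>v x)" if "a < k" "x \<in> carrier_vec k" for a x
    unfolding M_def using Yb[OF that(1) that(1)] by (intro mult_zero_ext[OF Yc] that k) auto
  have Yax: "mat_adjoint (Y a) *\<^sub>v zero_ext N x = zero_ext N (M a *\<^sub>v x)" if "a < k" "x \<in> carrier_vec k" for a x
  proof -
    have "lead_block k (mat_adjoint (Y a)) = M a"
    proof (intro eq_matI)
      fix i j assume "i < dim_row (M a)" "j < dim_col (M a)"
      hence ij: "i < k" "j < k" using Mc[of a] by auto
      have "lead_block k (mat_adjoint (Y a)) $$ (i, j) = cnj (M a $$ (j, i))"
        using ij Yc[OF that(1)] k by (auto simp: lead_block_def M_def)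
      also have "\<dots> = M a $$ (i, j)" using psd_herm[OF M[OF that(1)] ij(2,1)] by simp
      finally show "lead_block k (mat_adjoint (Y a)) $$ (i, j) = M a $$ (i, j)" .
    qed (auto simp: lead_block_def M_def)
    moreover have "mat_adjoint (Y a) *\<^sub>v zero_ext N x = zero_ext N (lead_block k (mat_adjoint (Y a)) *\<^sub>v x)"
      using Yb[OF that(1) that(1)] Yc[OF that(1)] k by (intro mult_zero_ext that) auto
    ultimately show ?thesis by simp
  qed
  have ann: "M a * M b = 0\<^sub>m k k" if ab: "a < k" "b < k" "a \<noteq> b" for a b
  proof (rule ccontr)
    assume "M a * M b \<noteq> 0\<^sub>m k k"
    then obtain \<nu> x where \<nu>: "\<nu> > 0" and x: "x \<in> carrier_vec k" "x \<noteq> 0\<^sub>v k" and ev: "(M a * M b) *\<^sub>v x = of_real \<nu> \<cdot>\<^sub>v x"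
      using psd_mult_pos_eigenvalue[OF M[OF ab(1)] M[OF ab(2)]] by blast
    define e where "e = V *\<^sub>v zero_ext N x"
    have e: "e \<in> carrier_vec N" using c by (simp add: e_def)
    have "zero_ext N x \<noteq> 0\<^sub>v N"
    proof
      assume "zero_ext N x = 0\<^sub>v N"
      hence "ip x x = 0" using ip_zero_ext[OF x(1) x(1) k(2)] by (simp add: ip_def)
      thus False using ip_self_eq_0[OF x(1)] x by simp
    qed
    hence e0: "e \<noteq> 0\<^sub>v N"
      using unitary_ip[OF V, of "zero_ext N x" "zero_ext N x"] ip_self_eq_0[OF e] ip_self_eq_0[of "zero_ext N x" N] by (auto simp: e_def)
    have "(mat_adjoint (Y a) * Y b) *\<^sub>v zero_ext N x = zero_ext N ((M a * M b) *\<^sub>v x)"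
      using Yc[OF ab(1)] Yc[OF ab(2)] Mc x Yx[OF ab(2) x(1)] Yax[OF ab(1), of "M b *\<^sub>v x"]
      by (simp add: mult_mat_vec_assoc[of _ N] mult_mat_vec_assoc[of _ k])
    also have "\<dots> = of_real \<nu> \<cdot>\<^sub>v zero_ext N x" unfolding ev by (intro eq_vecI) (auto simp: zero_ext_def)
    finally have 1: "(mat_adjoint (Y a) * Y b) *\<^sub>v zero_ext N x = of_real \<nu> \<cdot>\<^sub>v zero_ext N x" .
    have tt: "cnj (\<theta> ^ a) * \<theta> ^ a = 1"
      using \<theta> by (metis complex_norm_square mult.commute norm_power of_real_1 power_one)
    have adjY: "mat_adjoint (Y a) = cnj (\<theta> ^ a) \<cdot>\<^sub>m (mat_adjoint V * mat_adjoint (P a) * mat_adjoint U)"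
    proof -
      have "mat_adjoint (\<theta> ^ a \<cdot>\<^sub>m (U * P a * V)) = cnj (\<theta> ^ a) \<cdot>\<^sub>m mat_adjoint (U * P a * V)"
        using c Pc[OF ab(1)] by (intro eq_matI) auto
      thus ?thesis using c Pc[OF ab(1)] unfolding Ye[OF ab(1)]
        by (simp add: mat_adjoint_mult[of _ N N _ N] assoc_mult_mat[of _ N N _ N _ N])
    qed
    have "mat_adjoint (Y a) * Y b = (cnj (\<theta> ^ a) * \<theta> ^ b) \<cdot>\<^sub>m (mat_adjoint V * mat_adjoint (P a) * (mat_adjoint U * U) * P b * V)"
      using c Pc[OF ab(1)] Pc[OF ab(2)] unfolding adjY Ye[OF ab(2)]
      by (simp add: mult_smult_distrib[of _ N N _ N] mult_smult_assoc_mat[of _ N N _ N] assoc_mult_mat[of _ N N _ N _ N] smult_smult mult.commute)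
    hence "mat_adjoint (Y a) * Y b = (cnj (\<theta> ^ a) * \<theta> ^ b) \<cdot>\<^sub>m (mat_adjoint V * (mat_adjoint (P a) * P b) * V)"
      using c Pc[OF ab(1)] Pc[OF ab(2)] unitary_matD(2)[OF U] by (simp add: assoc_mult_mat[of _ N N _ N _ N])
    hence "V * (mat_adjoint (Y a) * Y b) = (cnj (\<theta> ^ a) * \<theta> ^ b) \<cdot>\<^sub>m ((V * mat_adjoint V) * (mat_adjoint (P a) * P b) * V)"
      using c Pc[OF ab(1)] Pc[OF ab(2)] by (simp add: mult_smult_distrib[of _ N N _ N] assoc_mult_mat[of _ N N _ N _ N])
    hence "V * (mat_adjoint (Y a) * Y b) = (cnj (\<theta> ^ a) * \<theta> ^ b) \<cdot>\<^sub>m ((mat_adjoint (P a) * P b) * V)"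
      using c Pc[OF ab(1)] Pc[OF ab(2)] unitary_matD(3)[OF V] by simp
    hence "(V * (mat_adjoint (Y a) * Y b)) *\<^sub>v zero_ext N x = ((cnj (\<theta> ^ a) * \<theta> ^ b) \<cdot>\<^sub>m ((mat_adjoint (P a) * P b) * V)) *\<^sub>v zero_ext N x"
      by simp
    moreover have "(V * (mat_adjoint (Y a) * Y b)) *\<^sub>v zero_ext N x = V *\<^sub>v ((mat_adjoint (Y a) * Y b) *\<^sub>v zero_ext N x)"
      using c Yc[OF ab(1)] Yc[OF ab(2)] by (intro mult_mat_vec_assoc[of _ N]) auto
    moreover have "((cnj (\<theta> ^ a) * \<theta> ^ b) \<cdot>\<^sub>m ((mat_adjoint (P a) * P b) * V)) *\<^sub>v zero_ext N x = (cnj (\<theta> ^ a) * \<theta> ^ b) \<cdot>\<^sub>v ((mat_adjoint (P a) * P b) *\<^sub>v e)"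
      using c Pc[OF ab(1)] Pc[OF ab(2)]
      by (simp add: e_def smult_mult_mat_vec[of _ N N] mult_mat_vec_assoc[of _ N])
    ultimately have "V *\<^sub>v (of_real \<nu> \<cdot>\<^sub>v zero_ext N x) = (cnj (\<theta> ^ a) * \<theta> ^ b) \<cdot>\<^sub>v ((mat_adjoint (P a) * P b) *\<^sub>v e)"
      using 1 by metis
    hence 2: "of_real \<nu> \<cdot>\<^sub>v e = (cnj (\<theta> ^ a) * \<theta> ^ b) \<cdot>\<^sub>v ((mat_adjoint (P a) * P b) *\<^sub>v e)"
      using c by (simp add: mult_mat_vec[of _ N N] e_def)
    \<comment> \<open>The eigenvalue at e of the adjoint of \<open>P a\<close> times
      \<open>P b\<close>. It is a positive number times theta^a divided by theta^b, so l theta^b =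
      |l| theta^a, which the choice of theta rules out.\<close>
    define l where "l = of_real \<nu> * \<theta> ^ a * cnj (\<theta> ^ b)"
    have tb: "cnj (\<theta> ^ b) * \<theta> ^ b = 1"
      using \<theta> by (metis complex_norm_square mult.commute norm_power of_real_1 power_one)
    have "(\<theta> ^ a * cnj (\<theta> ^ b)) \<cdot>\<^sub>v (of_real \<nu> \<cdot>\<^sub>v e) = ((cnj (\<theta> ^ a) * \<theta> ^ a) * (cnj (\<theta> ^ b) * \<theta> ^ b)) \<cdot>\<^sub>v ((mat_adjoint (P a) * P b) *\<^sub>v e)"
      unfolding 2 smult_smult_assoc by (simp add: algebra_simps)
    hence "(mat_adjoint (P a) * P b) *\<^sub>v e = l \<cdot>\<^sub>v e" unfolding tt tb by (simp add: l_def smult_smult_assoc algebra_simps)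
    hence "l \<in> S a b" unfolding S_def spectrum_def eigenvalue_def eigenvector_def
      using e e0 Pc[OF ab(1)] Pc[OF ab(2)] by auto
    moreover have "l \<noteq> 0" using \<nu> \<theta>0 by (simp add: l_def)
    moreover have cm: "cmod l = \<nu>" using \<nu> \<theta> by (simp add: l_def norm_mult norm_power)
    moreover have "l * \<theta> ^ b = of_real (cmod l) * \<theta> ^ a" unfolding cm
    proof -
      have "l * \<theta> ^ b = of_real \<nu> * \<theta> ^ a * (cnj (\<theta> ^ b) * \<theta> ^ b)" by (simp only: l_def mult.assoc)
      thus "l * \<theta> ^ b = of_real \<nu> * \<theta> ^ a" by (simp only: tb mult_1_right)
    qed
    ultimately show False using gen[OF ab, of l] by blast
  qed
  \<comment> \<open>The trace of \<open>M a\<close> has real part at least 1, so \<open>M a\<close>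
    is nonzero and its range contains a unit vector.\<close>
  have "\<exists>v. v \<in> carrier_vec k \<and> ip v v = 1 \<and> (\<exists>c. c \<in> carrier_vec k \<and> v = M a *\<^sub>v c)" if a: "a < k" for a
  proof -
    have "\<exists>j<k. M a *\<^sub>v unit_vec k j \<noteq> 0\<^sub>v k"
    proof (rule ccontr)
      assume *: "\<not> (\<exists>j<k. M a *\<^sub>v unit_vec k j \<noteq> 0\<^sub>v k)"
      have "Y a $$ (i, i) = 0" if "i < k" for i
      proof -
        have "(M a *\<^sub>v unit_vec k i) $ i = 0" using * that by auto
        hence "M a $$ (i, i) = 0" using that Mc[of a] by (simp add: mult_unit_vec[OF Mc])
        thus ?thesis using that by (simp add: M_def lead_block_def)
      qed
      hence "weighted_trace N (topw k) (Y a) = 0" unfolding weighted_trace_def by (intro sum.neutral) auto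
      thus False using Yopt(2)[OF a] by simp
    qed
    then obtain j where j: "j < k" "M a *\<^sub>v unit_vec k j \<noteq> 0\<^sub>v k" by blast
    define y where "y = M a *\<^sub>v unit_vec k j"
    have y: "y \<in> carrier_vec k" "y \<noteq> 0\<^sub>v k" using j Mc by (simp_all add: y_def)
    define s where "s = Re (ip y y)"
    have s: "ip y y = of_real s" "s \<ge> 0" by (simp_all add: s_def ip_self sum_nonneg)
    have s0: "s > 0" using s y ip_self_eq_0[OF y(1)] by (metis less_eq_real_def of_real_0)
    define t where "t = 1 / sqrt s"
    have t: "t * t * s = 1" using s0 by (simp add: t_def)
    define v where "v = of_real t \<cdot>\<^sub>v y"
    have v: "v \<in> carrier_vec k" using y by (simp add: v_def)
    have "ip v v = of_real (t * t * s)"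
      using y s by (simp add: v_def ip_smult_left[of _ k] ip_smult_right)
    hence "ip v v = 1" unfolding t by simp
    moreover have "v = M a *\<^sub>v (of_real t \<cdot>\<^sub>v unit_vec k j)"
      by (simp add: v_def y_def mult_mat_vec[OF Mc])
    ultimately show ?thesis using v by (intro exI[of _ v] conjI exI[of _ "of_real t \<cdot>\<^sub>v unit_vec k j"]) auto
  qed
  then obtain v d where v: "\<And>a. a < k \<Longrightarrow> v a \<in> carrier_vec k" "\<And>a. a < k \<Longrightarrow> ip (v a) (v a) = 1"
    "\<And>a. a < k \<Longrightarrow> d a \<in> carrier_vec k" "\<And>a. a < k \<Longrightarrow> v a = M a *\<^sub>v d a" by metis
  have zero: "M a *\<^sub>v v b = 0\<^sub>v k" if "a < k" "b < k" "a \<noteq> b" for a b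
  proof -
    have "M a *\<^sub>v v b = (M a * M b) *\<^sub>v d b"
      using v(3,4)[OF that(2)] Mc by (simp add: mult_mat_vec_assoc[of _ k])
    also have "\<dots> = 0\<^sub>v k" unfolding ann[OF that] using v(3)[OF that(2)]
      by (intro eq_vecI) (auto simp: mult_mat_vec_index[of _ k k])
    finally show ?thesis .
  qed
  \<comment> \<open>The ranges are pairwise orthogonal, so the k chosen unit vectors fill the space
    of dimension k, and all but the first lie in the kernel of \<open>M 0\<close>.\<close>
  have "rank1 k (M 0)"
  proof (rule rank1_of_orthonormal_kernel[OF Mc v(1)])
    fix a b assume ab: "a < k" "b < k"
    show "ip (v a) (v b) = (if a = b then 1 else 0)"
    proof (cases "a = b")
      case False
      have "ip (v a) (v b) = ip (d a) (mat_adjoint (mat_adjoint (M a)) *\<^sub>v v b)"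
        using ip_adjoint[of "mat_adjoint (M a)" k k "d a" "v b"] v ab Mc psd_adjoint[OF M[OF ab(1)]] by simp
      also have "\<dots> = 0" using zero[OF ab False] v(3)[OF ab(1)] by (simp add: ip_def)
      finally show ?thesis using False by simp
    qed (use v ab in auto)
  next
    fix a assume "0 < a" "a < k"
    thus "M 0 *\<^sub>v v a = 0\<^sub>v k" using zero[of 0 a] k by simp
  qed
  then obtain p q where pq: "\<And>i j. i < k \<Longrightarrow> j < k \<Longrightarrow> M 0 $$ (i, j) = p i * q j" unfolding rank1_def by blast
  \<comment> \<open>As k >= 2 there is a second vector, \<open>v 1\<close>. Extended by zero it is
    the unit kernel vector of \<open>Y 0\<close> that \<open>ky_fan_opt_kernel\<close> asks for,
    which clears the lower right block.\<close>
  have k0: "0 < k" "1 < k" using k by auto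
  have x1: "Y 0 *\<^sub>v zero_ext N (v 1) = 0\<^sub>v N"
    unfolding Yx[OF k0(1) v(1)[OF k0(2)]] zero[OF k0 zero_neq_one] by (rule zero_ext_zero)
  have x1u: "ip (zero_ext N (v 1)) (zero_ext N (v 1)) = 1"
    unfolding ip_zero_ext[OF v(1)[OF k0(2)] v(1)[OF k0(2)] k(2)] by (rule v(2)[OF k0(2)])
  have x1z: "zero_ext N (v 1) $ i = 0" if "k \<le> i" "i < N" for i
    using carrier_vecD[OF v(1)[OF k0(2)]] that by (simp add: zero_ext_def)
  have low: "Y 0 $$ (i, j) = 0" if "k \<le> i" "i < N" "k \<le> j" "j < N" for i j
    by (rule ky_fan_opt_kernel[OF Yc[OF k0(1)] k(2) Yopt(1)[OF k0(1)] zero_ext_carrier x1u x1z x1 that])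
  have "\<forall>i<N. \<forall>j<N. Y 0 $$ (i, j) = (if i < k then p i else 0) * (if j < k then q j else 0)"
  proof (intro allI impI)
    fix i j assume ij: "i < N" "j < N"
    show "Y 0 $$ (i, j) = (if i < k then p i else 0) * (if j < k then q j else 0)"
    proof (cases "i < k"; cases "j < k")
      assume "i < k" "j < k"
      thus ?thesis using pq[of i j] by (simp add: M_def lead_block_def)
    next
      assume "i < k" "\<not> j < k" thus ?thesis using Yb[OF k0(1) k0(1), of i j] ij by simp
    next
      assume "\<not> i < k" "j < k" thus ?thesis using Yb[OF k0(1) k0(1), of j i] ij by simp
    next
      assume "\<not> i < k" "\<not> j < k" thus ?thesis using low[of i j] ij by simp
    qed
  qed
  hence rY: "rank1 N (Y 0)" unfolding rank1_def
    by (intro exI[of _ "\<lambda>i. if i < k then p i else 0"] exI[of _ "\<lambda>j. if j < k then q j else 0"])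
  have "1 \<cdot>\<^sub>m (U * P 0 * V) = U * P 0 * V" by (intro eq_matI) auto
  hence "Y 0 = U * P 0 * V" using Ye[OF k0(1)] by simp
  hence "mat_adjoint U * Y 0 * mat_adjoint V = (mat_adjoint U * U) * P 0 * (V * mat_adjoint V)"
    using c Pc[OF k0(1)] by (simp add: assoc_mult_mat[of _ N N _ N _ N])
  hence "mat_adjoint U * Y 0 * mat_adjoint V = P 0"
    using c Pc[OF k0(1)] unitary_matD(2)[OF U] unitary_matD(3)[OF V] by simp
  with rank1_mult[OF _ _ Yc[OF k0(1)] rY, of "mat_adjoint U" "mat_adjoint V"] c show ?thesis by simp
qed

section \<open>The operator norm: averages over roots of unity\<close>

lemma sum_roots_of_unity:
  assumes "a < N" "b < N"
  shows "(\<Sum>t<N. cis (2 * pi * real t / real N) ^ b * cis (2 * pi * real t / real N) ^ (N - a)) = (if a = b then of_nat N else 0)"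
proof -
  define \<omega> where "\<omega> t = cis (2 * pi * real t / real N)" for t
  have N: "N > 0" using assms by simp
  have w: "\<omega> t = \<omega> 1 ^ t" for t by (simp add: \<omega>_def DeMoivre mult_ac)
  have wN: "\<omega> 1 ^ N = 1" using N by (simp add: \<omega>_def DeMoivre)
  have inj: "inj_on \<omega> {..<N}"
    using bij_betw_roots_unity[OF N] unfolding \<omega>_def bij_betw_def by simp
  \<comment> \<open>The root of unity with exponent b - a, where \<open>N - a\<close> replaces -a to
    keep exponents natural.\<close>
  define \<zeta> where "\<zeta> = \<omega> 1 ^ (b + (N - a))"
  have e: "\<omega> t ^ b * \<omega> t ^ (N - a) = \<zeta> ^ t" for t
    unfolding w[of t] \<zeta>_def by (simp flip: power_mult power_add add: algebra_simps)
  have "\<zeta> ^ N = (\<omega> 1 ^ N) ^ (b + (N - a))" unfolding \<zeta>_def by (simp only: power_mult[symmetric] mult.commute)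
  hence zN: "\<zeta> ^ N = 1" unfolding wN by simp
  have "\<zeta> * \<omega> 1 ^ a = \<omega> 1 ^ b * \<omega> 1 ^ N"
    unfolding \<zeta>_def using assms by (simp flip: power_add)
  hence za: "\<zeta> * \<omega> a = \<omega> b" unfolding wN w[of a] w[of b] by simp
  show ?thesis
  proof (cases "a = b")
    case True
    have "\<omega> b \<noteq> 0" by (simp add: \<omega>_def)
    hence "\<zeta> = 1" using za True by simp
    thus ?thesis using True e unfolding \<omega>_def by simp
  next
    case False
    hence "\<omega> a \<noteq> \<omega> b" using inj assms by (auto dest: inj_onD)
    hence "\<zeta> \<noteq> 1" using za by auto
    hence "(\<Sum>t<N. \<zeta> ^ t) = 0" using zN by (simp add: geometric_sum)
    thus ?thesis using False e unfolding \<omega>_def by simp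
  qed
qed

text \<open>Inversion of the discrete Fourier transform.\<close>

lemma fourier_coeff_zero:
  fixes c :: "nat \<Rightarrow> complex"
  assumes "\<And>t. t < N \<Longrightarrow> (\<Sum>b<N. cis (2 * pi * real t / real N) ^ b * c b) = 0" and a: "a < N"
  shows "c a = 0"
proof -
  define \<omega> where "\<omega> t = cis (2 * pi * real t / real N)" for t
  have "0 = (\<Sum>t<N. \<omega> t ^ (N - a) * (\<Sum>b<N. \<omega> t ^ b * c b))" using assms by (simp add: \<omega>_def)
  also have "\<dots> = (\<Sum>b<N. (\<Sum>t<N. \<omega> t ^ b * \<omega> t ^ (N - a)) * c b)"
    unfolding sum_distrib_left sum_distrib_right by (subst sum.swap) (simp add: mult_ac)
  also have "\<dots> = (\<Sum>b<N. if b = a then of_nat N * c a else 0)"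
    using sum_roots_of_unity[OF a] unfolding \<omega>_def by (intro sum.cong) auto
  also have "\<dots> = of_nat N * c a" using a by simp
  finally show ?thesis using a by auto
qed

text \<open>Here the average over the \<open>N\<close>-th roots of unity shows that a maximising vector of \<open>P a\<close> is annihilated by
  all other \<open>P b\<close>.\<close>

lemma rank1_first_operator_norm:
  assumes P: "\<And>a. a < N \<Longrightarrow> P a \<in> carrier_mat N N" and N: "1 \<le> N"
    and nrm: "\<And>a. a < N \<Longrightarrow> ky_fan_norm 1 (P a) = 1"
    and f: "\<And>z. cmod z = 1 \<Longrightarrow> ky_fan_norm 1 (mat N N (\<lambda>p. \<Sum>a<N. z ^ a * P a $$ p)) = 1"
  shows "rank1 N (P 0)"
proof -
  have N0: "0 < N" using N by simp
  define \<omega> where "\<omega> t = cis (2 * pi * real t / real N)" for t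
  have w1: "cmod (\<omega> t) = 1" for t by (simp add: \<omega>_def)
  have wN: "\<omega> t ^ N = 1" for t
    using N by (simp add: \<omega>_def DeMoivre)
  have wtr1: "weighted_trace N (topw 1) X = X $$ (0, 0)" for X
  proof -
    have "weighted_trace N (topw 1) X = (\<Sum>i<N. if i = 0 then X $$ (0, 0) else 0)" unfolding weighted_trace_def by (intro sum.cong) auto
    thus ?thesis using N by simp
  qed
  have ex: "\<exists>U V. unitary_mat N U \<and> unitary_mat N V \<and> (U * P a * V) *\<^sub>v unit_vec N 0 = unit_vec N 0
      \<and> mat_adjoint (U * P a * V) *\<^sub>v unit_vec N 0 = unit_vec N 0
      \<and> (\<forall>b<N. b \<noteq> a \<longrightarrow> (U * P b * V) *\<^sub>v unit_vec N 0 = 0\<^sub>v N)" if a: "a < N" for a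
  proof -
    obtain U V where U: "unitary_mat N U" and V: "unitary_mat N V"
      and UV: "weighted_trace N (topw 1) (U * P a * V) = of_real (ky_fan_norm 1 (P a))"
      by (rule ky_fan_attained[OF P[OF a] N])
    note c = unitary_matD(1)[OF U] unitary_matD(1)[OF V]
    define h where "h b = (U * P b * V) $$ (0, 0)" for b
    have ha: "h a = 1" using UV[unfolded wtr1] nrm[OF a] by (simp add: h_def)
    define F where "F t = mat N N (\<lambda>p. \<Sum>b<N. \<omega> t ^ b * P b $$ p)" for t
    have Fc: "F t \<in> carrier_mat N N" for t by (simp add: F_def)
    have Fe: "(U * F t * V) $$ (i, j) = (\<Sum>b<N. \<omega> t ^ b * (U * P b * V) $$ (i, j))" if "i < N" "j < N" for t i j
      unfolding F_def by (rule mult3_sum[OF c _ that]) (simp add: P)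
    have F1: "ky_fan_norm 1 (F t) = 1" for t unfolding F_def by (rule f[OF w1])
    \<comment> \<open>The mean of the g t is the corner entry for the index a, which is 1. As |g t|
      <= 1, every g t equals 1, so up to a phase each F t is optimal for the same pair (U,
      V).\<close>
    define g where "g t = \<omega> t ^ (N - a) * (U * F t * V) $$ (0, 0)" for t
    have g1: "cmod (g t) \<le> 1" for t
      using ky_fan_upper[OF Fc N U V, of t, unfolded wtr1] F1[of t] w1[of t] by (simp add: g_def norm_mult norm_power)
    have "(\<Sum>t<N. g t) = (\<Sum>b<N. (\<Sum>t<N. \<omega> t ^ b * \<omega> t ^ (N - a)) * h b)"
      unfolding g_def Fe[OF N0 N0] h_def sum_distrib_left sum_distrib_right by (subst sum.swap) (simp add: mult_ac)
    also have "\<dots> = (\<Sum>b<N. if b = a then of_nat N * h a else 0)"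
      using sum_roots_of_unity[OF a] unfolding \<omega>_def by (intro sum.cong) auto
    also have "\<dots> = of_nat N" using a ha by simp
    finally have "Re (\<Sum>t<N. g t) = real N" by simp
    hence "(\<Sum>t<N. 1 - Re (g t)) = 0" by (simp add: sum_subtractf)
    moreover have "0 \<le> 1 - Re (g t)" for t using complex_Re_le_cmod[of "g t"] g1[of t] by linarith
    ultimately have "1 - Re (g t) = 0" if "t < N" for t
      using that by (subst (asm) sum_nonneg_eq_0_iff) auto
    hence gR: "Re (g t) = 1" if "t < N" for t using that by simp
    have g: "g t = 1" if "t < N" for t
    proof -
      have "(Re (g t))\<^sup>2 + (Im (g t))\<^sup>2 \<le> 1" using g1[of t] by (simp add: cmod_def)
      thus ?thesis using gR[OF that] by (simp add: complex_eq_iff)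
    qed
    \<comment> \<open>After multiplication by a phase, U F_t V attains its norm at the corner, and
      optimality clears the rest of its first column.\<close>
    have col: "(U * F t * V) $$ (i, 0) = (if i = 0 then \<omega> t ^ a else 0)" if t: "t < N" and i: "i < N" for t i
    proof -
      have U': "unitary_mat N (\<omega> t ^ (N - a) \<cdot>\<^sub>m U)" using unitary_smult[OF U] w1 by (simp add: norm_power)
      define Y where "Y = (\<omega> t ^ (N - a) \<cdot>\<^sub>m U) * F t * V"
      have Ye: "Y = \<omega> t ^ (N - a) \<cdot>\<^sub>m (U * F t * V)"
        unfolding Y_def using c Fc by (simp add: mult_smult_assoc_mat[of _ N N _ N])
      have Yc: "Y \<in> carrier_mat N N" unfolding Ye using c Fc by simp
      have "Y $$ (0, 0) = g t" unfolding Ye g_def using c Fc N0 by simp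
      hence "ky_fan_norm 1 Y \<le> Re (weighted_trace N (topw 1) Y)"
        unfolding wtr1 using ky_fan_unitary[OF U' V Fc, of 1 t] F1[of t] gR[OF t] by (simp add: Y_def)
      from ky_fan_opt(3)[OF Yc N this, of 0 i] have Y0: "i \<noteq> 0 \<Longrightarrow> Y $$ (i, 0) = 0" using i by simp
      have wa: "\<omega> t ^ a * \<omega> t ^ (N - a) = 1" using a wN[of t] by (simp flip: power_add)
      have "\<omega> t ^ a * Y $$ (i, 0) = (\<omega> t ^ a * \<omega> t ^ (N - a)) * (U * F t * V) $$ (i, 0)"
        unfolding Ye using c Fc i N0 by simp
      hence "(U * F t * V) $$ (i, 0) = \<omega> t ^ a * Y $$ (i, 0)" unfolding wa by simp
      thus ?thesis using Y0 \<open>Y $$ (0, 0) = g t\<close> g[OF t] by auto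
    qed
    \<comment> \<open>Fourier inversion in t transfers the known first columns of the U F_t V to the
      coefficients U P_b V.\<close>
    have coef: "(U * P b * V) $$ (i, 0) = (if b = a \<and> i = 0 then 1 else 0)" if b: "b < N" and i: "i < N" for b i
    proof -
      have "(U * P b * V) $$ (i, 0) - (if b = a \<and> i = 0 then 1 else 0) = 0"
      proof (rule fourier_coeff_zero[OF _ b, of "\<lambda>b. (U * P b * V) $$ (i, 0) - (if b = a \<and> i = 0 then 1 else 0)"])
        fix t assume t: "t < N"
        have "(\<Sum>b<N. \<omega> t ^ b * ((U * P b * V) $$ (i, 0) - (if b = a \<and> i = 0 then 1 else 0)))
            = (U * F t * V) $$ (i, 0) - (\<Sum>b<N. if b = a then (if i = 0 then \<omega> t ^ a else 0) else 0)"
          unfolding Fe[OF i N0] sum_subtractf[symmetric] by (intro sum.cong) (auto simp: algebra_simps)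
        thus "(\<Sum>b<N. cis (2 * pi * real t / real N) ^ b * ((U * P b * V) $$ (i, 0) - (if b = a \<and> i = 0 then 1 else 0))) = 0"
          using col[OF t i] a by (simp add: \<omega>_def)
      qed
      thus ?thesis by simp
    qed
    have Pc: "U * P b * V \<in> carrier_mat N N" if "b < N" for b using c P[OF that] by simp
    have "ky_fan_norm 1 (U * P a * V) \<le> Re (weighted_trace N (topw 1) (U * P a * V))"
      using ky_fan_unitary[OF U V P[OF a], of 1] nrm[OF a] UV by simp
    note row = ky_fan_opt(3)[OF Pc[OF a] N this, of 0]
    show ?thesis
    proof (rule exI[of _ U], rule exI[of _ V], intro conjI U V allI impI)
      show "(U * P a * V) *\<^sub>v unit_vec N 0 = unit_vec N 0"
        unfolding mult_unit_vec[OF Pc[OF a] N0] using carrier_matD[OF Pc[OF a]] coef[OF a] N0 by (intro eq_vecI) (auto simp: unit_vec_def)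
      show "mat_adjoint (U * P a * V) *\<^sub>v unit_vec N 0 = unit_vec N 0"
      proof (subst mult_unit_vec[OF mat_adjoint_carrier[OF Pc[OF a]] N0], intro eq_vecI)
        fix i assume "i < dim_vec (unit_vec N 0)"
        hence i: "i < N" by simp
        thus "col (mat_adjoint (U * P a * V)) 0 $ i = unit_vec N 0 $ i"
          using carrier_matD[OF Pc[OF a]] coef[OF a N0] row[of i] N0 by (cases "i = 0") (simp_all add: unit_vec_def del: index_mult_mat)
      qed (use carrier_matD[OF Pc[OF a]] in simp)
      show "(U * P b * V) *\<^sub>v unit_vec N 0 = 0\<^sub>v N" if "b < N" "b \<noteq> a" for b
        unfolding mult_unit_vec[OF Pc[OF that(1)] N0] using carrier_matD[OF Pc[OF that(1)]] coef[OF that(1)] that N0 by (intro eq_vecI) auto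
    qed
  qed
  \<comment> \<open>A right singular vector of \<open>P a\<close> for the singular value 1 that all
    other \<open>P b\<close> annihilate.\<close>
  define Q where "Q a x \<longleftrightarrow> x \<in> carrier_vec N \<and> ip x x = 1 \<and> mat_adjoint (P a) *\<^sub>v (P a *\<^sub>v x) = x
       \<and> (\<forall>b<N. b \<noteq> a \<longrightarrow> P b *\<^sub>v x = 0\<^sub>v N)" for a x
  have "\<exists>x. Q a x" if a: "a < N" for a
  proof -
    from ex[OF a] obtain U V where UV: "unitary_mat N U" "unitary_mat N V" "(U * P a * V) *\<^sub>v unit_vec N 0 = unit_vec N 0"
      "mat_adjoint (U * P a * V) *\<^sub>v unit_vec N 0 = unit_vec N 0"
      "\<And>b. b < N \<Longrightarrow> b \<noteq> a \<Longrightarrow> (U * P b * V) *\<^sub>v unit_vec N 0 = 0\<^sub>v N" by blast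
    note c = unitary_matD(1)[OF UV(1)] unitary_matD(1)[OF UV(2)]
    let ?e = "unit_vec N 0 :: complex vec"
    define x where "x = V *\<^sub>v ?e"
    define y where "y = mat_adjoint U *\<^sub>v ?e"
    have Px: "P b *\<^sub>v x = mat_adjoint U *\<^sub>v ((U * P b * V) *\<^sub>v ?e)" if "b < N" for b
    proof -
      have "mat_adjoint U *\<^sub>v ((U * P b * V) *\<^sub>v ?e) = (mat_adjoint U * U * P b * V) *\<^sub>v ?e"
        using c P[OF that] by (simp add: mult_mat_vec_assoc[of _ N])
      thus ?thesis using c P[OF that] unitary_matD(2)[OF UV(1)] by (simp add: x_def mult_mat_vec_assoc[of _ N])
    qed
    have "mat_adjoint (P a) *\<^sub>v y = (V * mat_adjoint V * mat_adjoint (P a) * mat_adjoint U) *\<^sub>v ?e"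
      using c P[OF a] unitary_matD(3)[OF UV(2)] by (simp add: y_def mult_mat_vec_assoc[of _ N])
    also have "\<dots> = V *\<^sub>v (mat_adjoint (U * P a * V) *\<^sub>v ?e)"
      using c P[OF a] by (simp add: mat_adjoint_mult[of _ N N _ N] mult_mat_vec_assoc[of _ N])
    finally have "mat_adjoint (P a) *\<^sub>v y = x" unfolding UV(4) by (simp add: x_def)
    moreover have "ip x x = 1" unfolding x_def using unitary_ip[OF UV(2), of ?e ?e] N0 by (simp add: ip_unit_unit)
    moreover have "P a *\<^sub>v x = y" using Px[OF a] UV(3) by (simp add: y_def)
    moreover have "\<forall>b<N. b \<noteq> a \<longrightarrow> P b *\<^sub>v x = 0\<^sub>v N"
      using Px UV(5) mult_mat_vec_zero[of "mat_adjoint U" N] c by simp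
    moreover have "x \<in> carrier_vec N" using c by (simp add: x_def)
    ultimately have "Q a x" by (simp add: Q_def)
    thus ?thesis ..
  qed
  hence "\<exists>x. \<forall>a<N. Q a (x a)" by metis
  then obtain x where x: "\<And>a. a < N \<Longrightarrow> Q a (x a)" by blast
  define y where "y a = P a *\<^sub>v x a" for a
  have xy: "x a \<in> carrier_vec N" "y a \<in> carrier_vec N" "ip (x a) (x a) = 1" "mat_adjoint (P a) *\<^sub>v y a = x a" if "a < N" for a
    using x[OF that] P[OF that] by (simp_all add: Q_def y_def)
  have x0: "P b *\<^sub>v x a = 0\<^sub>v N" if "a < N" "b < N" "b \<noteq> a" for a b
    using x[OF that(1)] that by (simp add: Q_def)
  show ?thesis
  proof (rule rank1_of_orthonormal_kernel[OF P[OF N0] xy(1)])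
    fix a b assume ab: "a < N" "b < N"
    show "ip (x a) (x b) = (if a = b then 1 else 0)"
    proof (cases "a = b")
      case False
      \<comment> \<open>The vector \<open>x b\<close> is in the range of the adjoint of
        \<open>P b\<close>, whereas \<open>P b\<close> kills \<open>x a\<close>.\<close>
      have "ip (x a) (x b) = ip (x a) (mat_adjoint (P b) *\<^sub>v y b)" using xy(4)[OF ab(2)] by simp
      also have "\<dots> = ip (P b *\<^sub>v x a) (y b)"
        using ip_adjoint[of "mat_adjoint (P b)" N N "x a" "y b"] P[OF ab(2)] xy(1)[OF ab(1)] xy(2)[OF ab(2)] by simp
      also have "\<dots> = 0" using x0[OF ab] False xy(2)[OF ab(2)] by (simp add: ip_carrier[of _ N])
      finally show ?thesis using False by simp
    qed (use xy(3) ab in simp)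
  next
    fix a assume "0 < a" "a < N"
    thus "P 0 *\<^sub>v x a = 0\<^sub>v N" using x0[of a 0] N0 by simp
  qed
qed

section \<open>Multilinear families of rank one matrices\<close>

text \<open>Indices are unbounded: images will be extended by zero, which frees this part from
  dimension conditions.\<close>

type_synonym cfun2 = "nat \<Rightarrow> nat \<Rightarrow> complex"

definition outer :: "(nat \<Rightarrow> complex) \<Rightarrow> (nat \<Rightarrow> complex) \<Rightarrow> cfun2" where
  "outer u v = (\<lambda>a b. u a * v b)"

text \<open>Zero is included; its factors are not determined, so \<open>nonzero\<close> is asked for
  where a factorisation has to be compared with another.\<close>

definition rank_one :: "cfun2 \<Rightarrow> bool" where
  "rank_one F \<longleftrightarrow> (\<exists>u v. F = outer u v)"

definition nonzero :: "cfun2 \<Rightarrow> bool" where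
  "nonzero F \<longleftrightarrow> (\<exists>a b. F a b \<noteq> 0)"

text \<open>The type of an edge along which only the column factor moves. The relation is not
  transitive through the zero matrix.\<close>

definition same_row :: "cfun2 \<Rightarrow> cfun2 \<Rightarrow> bool" where
  "same_row F G \<longleftrightarrow> (\<exists>u u' v. F = outer u v \<and> G = outer u' v)"

definition same_col :: "cfun2 \<Rightarrow> cfun2 \<Rightarrow> bool" where
  "same_col F G \<longleftrightarrow> (\<exists>u v v'. F = outer u v \<and> G = outer u v')"

text \<open>Linear independence of a pair of matrices.\<close>

definition indep :: "cfun2 \<Rightarrow> cfun2 \<Rightarrow> bool" where
  "indep F G \<longleftrightarrow> nonzero F \<and> nonzero G \<and> (\<forall>t. nonzero (\<lambda>a b. F a b + t * G a b))"

lemma same_row_sym: "same_row F G \<Longrightarrow> same_row G F" by (auto simp: same_row_def)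
lemma same_col_sym: "same_col F G \<Longrightarrow> same_col G F" by (auto simp: same_col_def)

lemma nonzero_outer: "nonzero (outer u v) \<Longrightarrow> (\<exists>a. u a \<noteq> 0) \<and> (\<exists>b. v b \<noteq> 0)"
  by (auto simp: nonzero_def outer_def)

text \<open>Factors of a nonzero rank one matrix are unique up to scalars, so a shared row factor
  may be taken to be the given one.\<close>

lemma same_row_rep:
  assumes "same_row (outer u v) G" "nonzero (outer u v)"
  shows "\<exists>u'. G = outer u' v"
proof -
  obtain u1 u2 v1 where 1: "outer u v = outer u1 v1" and G: "G = outer u2 v1" using assms(1) unfolding same_row_def by blast
  obtain a where "u1 a \<noteq> 0" using nonzero_outer assms(2) unfolding 1 by blast
  moreover have "u1 a * v1 b = u a * v b" for b using fun_cong[OF fun_cong[OF 1], of a b] by (simp add: outer_def)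
  ultimately have "v1 b = u a / u1 a * v b" for b by (simp add: field_simps)
  hence "G = outer (\<lambda>i. u2 i * (u a / u1 a)) v" unfolding G by (simp add: outer_def fun_eq_iff)
  thus ?thesis by blast
qed

lemma same_col_rep:
  assumes "same_col (outer u v) G" "nonzero (outer u v)"
  shows "\<exists>v'. G = outer u v'"
proof -
  obtain u1 v1 v2 where 1: "outer u v = outer u1 v1" and G: "G = outer u1 v2" using assms(1) unfolding same_col_def by blast
  obtain b where "v1 b \<noteq> 0" using nonzero_outer assms(2) unfolding 1 by blast
  moreover have "u1 a * v1 b = u a * v b" for a using fun_cong[OF fun_cong[OF 1], of a b] by (simp add: outer_def)
  ultimately have "u1 a = v b / v1 b * u a" for a by (simp add: field_simps)
  hence "G = outer u (\<lambda>j. v b / v1 b * v2 j)" unfolding G by (simp add: outer_def fun_eq_iff)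
  thus ?thesis by blast
qed

lemma proportional:
  fixes u u' :: "nat \<Rightarrow> complex"
  assumes "\<And>a a'. u a * u' a' = u a' * u' a" "\<exists>a. u a \<noteq> 0"
  shows "\<exists>t. u' = (\<lambda>a. t * u a)"
proof -
  obtain a where "u a \<noteq> 0" using assms(2) by blast
  hence "u' a' = u' a / u a * u a'" for a' using assms(1)[of a a'] by (simp add: field_simps)
  thus ?thesis by blast
qed

text \<open>Each 2 x 2 minor of [u u'] X [v v']^t is the product of the minor of [u u'], the
  determinant of X and the minor of [v v'], and minors of a rank one matrix vanish.\<close>

lemma rank_one_sum_minors:
  assumes "rank_one (\<lambda>a b. x1 * (u a * v b) + x2 * (u a * v' b) + x3 * (u' a * v b) + x4 * (u' a * v' b))"
  shows "(x1 * x4 - x2 * x3) * ((u a * u' a' - u a' * u' a) * (v b * v' b' - v b' * v' b)) = 0"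
proof -
  obtain p q where pq: "\<And>a b. x1 * (u a * v b) + x2 * (u a * v' b) + x3 * (u' a * v b) + x4 * (u' a * v' b) = p a * q b"
    using assms unfolding rank_one_def outer_def by (metis (no_types, lifting))
  define F where "F a b = x1 * (u a * v b) + x2 * (u a * v' b) + x3 * (u' a * v b) + x4 * (u' a * v' b)" for a b
  have F: "F a b = p a * q b" for a b unfolding F_def by (rule pq)
  have "(x1 * x4 - x2 * x3) * ((u a * u' a' - u a' * u' a) * (v b * v' b' - v b' * v' b)) = F a b * F a' b' - F a b' * F a' b"
    unfolding F_def by (simp add: algebra_simps)
  also have "\<dots> = 0" unfolding F by simp
  finally show ?thesis .
qed

text \<open>The preceding identity with the identity matrix as X: one of the two families of minors
  has to vanish identically.\<close>

lemma rank_one_sum_cases: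
  assumes "rank_one (\<lambda>a b. outer u v a b + outer u' v' a b)" "\<exists>a. u a \<noteq> 0" "\<exists>b. v b \<noteq> 0"
  shows "(\<exists>t. u' = (\<lambda>a. t * u a)) \<or> (\<exists>t. v' = (\<lambda>b. t * v b))"
proof -
  have "rank_one (\<lambda>a b. 1 * (u a * v b) + 0 * (u a * v' b) + 0 * (u' a * v b) + 1 * (u' a * v' b))"
    using assms(1) by (simp add: outer_def)
  from rank_one_sum_minors[OF this] have *: "(u a * u' a' - u a' * u' a) * (v b * v' b' - v b' * v' b) = 0" for a a' b b' by simp
  show ?thesis
  proof (cases "\<forall>a a'. u a * u' a' = u a' * u' a")
    case True
    thus ?thesis using proportional[of u u'] assms(2) by blast
  next
    case False
    hence "v b * v' b' = v b' * v' b" for b b' using * by (metis eq_iff_diff_eq_0 mult_eq_0_iff)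
    thus ?thesis using proportional[of v v'] assms(3) by blast
  qed
qed

lemma edge_cases:
  assumes "rank_one F" "rank_one G" "nonzero F" "rank_one (\<lambda>a b. F a b + G a b)"
  shows "same_row F G \<or> same_col F G"
proof -
  obtain u v u' v' where FG: "F = outer u v" "G = outer u' v'" using assms unfolding rank_one_def by blast
  from rank_one_sum_cases[OF assms(4)[unfolded FG]] nonzero_outer[OF assms(3)[unfolded FG]]
  consider t where "u' = (\<lambda>a. t * u a)" | t where "v' = (\<lambda>b. t * v b)" by blast
  thus ?thesis
  proof cases
    case 1
    hence "G = outer u (\<lambda>b. t * v' b)" by (simp add: FG outer_def fun_eq_iff)
    thus ?thesis using FG by (auto simp: same_col_def)
  next
    case 2
    hence "G = outer (\<lambda>a. t * u' a) v" by (simp add: FG outer_def fun_eq_iff)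
    thus ?thesis using FG by (auto simp: same_row_def)
  qed
qed

lemma indep_not_smult: "indep F G \<Longrightarrow> G \<noteq> (\<lambda>a b. t * F a b)"
proof
  assume i: "indep F G" and G: "G = (\<lambda>a b. t * F a b)"
  have "t \<noteq> 0" using i unfolding indep_def nonzero_def G by auto
  have "nonzero (\<lambda>a b. F a b + (- 1 / t) * G a b)" using i unfolding indep_def by blast
  thus False using \<open>t \<noteq> 0\<close> by (simp add: nonzero_def G)
qed

lemma indep_not_smult': "indep F G \<Longrightarrow> F \<noteq> (\<lambda>a b. t * G a b)"
proof
  assume i: "indep F G" and F: "F = (\<lambda>a b. t * G a b)"
  have "nonzero (\<lambda>a b. F a b + (- t) * G a b)" using i unfolding indep_def by blast
  thus False by (simp add: nonzero_def F)
qed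

text \<open>Two nonzero matrices that share both factors are proportional.\<close>

lemma not_same_row_col:
  assumes "indep F G" "same_row F G" shows "\<not> same_col F G"
proof
  assume "same_col F G"
  then obtain u v v' where F: "F = outer u v" "G = outer u v'" unfolding same_col_def by blast
  have n: "nonzero F" using assms(1) by (simp add: indep_def)
  obtain u' where u': "G = outer u' v" using same_row_rep[of u v G] assms(2) n F by blast
  obtain a where a: "u a \<noteq> 0" using nonzero_outer n unfolding F by blast
  have "u a * v' b = u' a * v b" for b using fun_cong[OF fun_cong[OF F(2)[unfolded u']], of a b] by (simp add: outer_def)
  hence "v' b = u' a / u a * v b" for b using a by (simp add: field_simps)
  hence "G = (\<lambda>i j. (u' a / u a) * F i j)" unfolding F by (simp add: outer_def fun_eq_iff)
  thus False using indep_not_smult[OF assms(1)] by blast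
qed

text \<open>Three vectors of one slot: the two edges at a common vertex have the same type.\<close>

lemma triangle:
  assumes pq: "indep F G" "same_row F G" and pr: "indep F H" and qr: "same_row G H \<or> same_col G H"
    and n: "same_row F H \<or> same_col F H"
  shows "same_row F H"
proof (rule ccontr)
  assume "\<not> same_row F H"
  hence scF: "same_col F H" using n by blast
  have nF: "nonzero F" "nonzero G" "nonzero H" using pq pr by (auto simp: indep_def)
  obtain u u2 v where F: "F = outer u v" and G: "G = outer u2 v" using pq(2) unfolding same_row_def by blast
  obtain w where H: "H = outer u w" using same_col_rep scF nF F by blast
  obtain a b where a: "u a \<noteq> 0" and b: "v b \<noteq> 0" using nonzero_outer nF(1) unfolding F by blast
  from qr show False
  proof
    assume "same_row G H"
    then obtain u3 where "H = outer u3 v" using same_row_rep nF(2) unfolding G by blast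
    hence "same_row F H" using F by (auto simp: same_row_def)
    thus False using \<open>\<not> same_row F H\<close> by blast
  next
    assume "same_col G H"
    then obtain u3 where "G = outer u u3" using same_col_rep[of u w G] same_col_sym nF(3) unfolding H by blast
    hence "same_col F G" using F by (auto simp: same_col_def)
    thus False using not_same_row_col[OF pq] by blast
  qed
qed

text \<open>The sum regroups as u1 ((1 + al be) v + al w1)^t + u2 v^t. It has rank two as soon as
  u1, u2 and v, w1 are independent pairs and al is nonzero.\<close>

lemma square_aux:
  assumes u12: "\<not> (\<exists>t. u2 = (\<lambda>a. t * u1 a))" and w: "\<not> (\<exists>t. w1 = (\<lambda>b. t * v b))"
    and nonzero: "\<exists>a. u1 a \<noteq> 0" "\<exists>b. v b \<noteq> 0" and al: "al \<noteq> 0"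
    and r: "rank_one (\<lambda>a b. u1 a * v b + u2 a * v b + (al * u1 a) * w1 b + (al * u1 a) * (be * v b))"
  shows False
proof -
  have "rank_one (\<lambda>a b. outer u1 (\<lambda>b. (1 + al * be) * v b + al * w1 b) a b + outer u2 v a b)"
    using r by (simp add: outer_def algebra_simps)
  moreover have "\<exists>b. (1 + al * be) * v b + al * w1 b \<noteq> 0"
  proof (rule ccontr)
    assume "\<not> ?thesis"
    hence "w1 b = - (1 + al * be) / al * v b" for b using al by (simp add: field_simps eq_neg_iff_add_eq_0)
    thus False using w by blast
  qed
  ultimately consider t where "v = (\<lambda>b. t * ((1 + al * be) * v b + al * w1 b))"
    using rank_one_sum_cases[OF _ nonzero(1)] u12 by blast
  thus False
  proof cases
    case 1
    have t: "t \<noteq> 0"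
    proof
      assume "t = 0" thus False using 1 nonzero(2) by auto
    qed
    have "w1 b = (1 / t - (1 + al * be)) / al * v b" for b
      using fun_cong[OF 1, of b] t al by (simp add: field_simps)
    thus False using w by blast
  qed
qed

text \<open>Two slots: the type of an edge does not change when a second slot is varied.\<close>

lemma square:
  assumes e: "indep F00 F10" "indep F01 F11"
    and s0: "same_row F00 F10" and s1: "same_row F01 F11 \<or> same_col F01 F11"
    and l0: "rank_one (\<lambda>a b. F00 a b + F01 a b)" and l1: "rank_one (\<lambda>a b. F10 a b + F11 a b)"
    and all: "rank_one (\<lambda>a b. F00 a b + F10 a b + F01 a b + F11 a b)"
  shows "same_row F01 F11"
proof (rule ccontr)
  assume "\<not> same_row F01 F11"
  hence sc1: "same_col F01 F11" using s1 by blast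
  obtain u1 u2 v where F0: "F00 = outer u1 v" "F10 = outer u2 v" using s0 unfolding same_row_def by blast
  obtain u w1 w2 where F1: "F01 = outer u w1" "F11 = outer u w2" using sc1 unfolding same_col_def by blast
  have n: "nonzero F00" "nonzero F10" "nonzero F01" "nonzero F11" using e by (auto simp: indep_def)
  have nu: "\<exists>a. u1 a \<noteq> 0" "\<exists>a. u2 a \<noteq> 0" "\<exists>b. v b \<noteq> 0" "\<exists>a. u a \<noteq> 0" "\<exists>b. w1 b \<noteq> 0" "\<exists>b. w2 b \<noteq> 0"
    using n nonzero_outer unfolding F0 F1 by blast+
  have "u2 \<noteq> (\<lambda>a. t * u1 a)" "u1 \<noteq> (\<lambda>a. t * u2 a)" for t
    using indep_not_smult[OF e(1), of t] indep_not_smult'[OF e(1), of t] unfolding F0 outer_def by (auto simp: mult.assoc)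
  hence u12: "\<not> (\<exists>t. u2 = (\<lambda>a. t * u1 a))" "\<not> (\<exists>t. u1 = (\<lambda>a. t * u2 a))" by blast+
  have "w2 \<noteq> (\<lambda>a. t * w1 a)" "w1 \<noteq> (\<lambda>a. t * w2 a)" for t
    using indep_not_smult[OF e(2), of t] indep_not_smult'[OF e(2), of t] unfolding F1 outer_def by (auto simp: mult.left_commute)
  hence w12: "\<not> (\<exists>t. w2 = (\<lambda>a. t * w1 a))" "\<not> (\<exists>t. w1 = (\<lambda>a. t * w2 a))" by blast+
  \<comment> \<open>The two remaining sides of the square. Each forces a common factor; the two
    surviving combinations are mirror images under the exchange of F00 with F10 and F01 with
    F11.\<close>
  have c0: "(\<exists>t. u = (\<lambda>a. t * u1 a)) \<or> (\<exists>t. w1 = (\<lambda>b. t * v b))"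
    using rank_one_sum_cases[OF l0[unfolded F0 F1] nu(1,3)] .
  have c1: "(\<exists>t. u = (\<lambda>a. t * u2 a)) \<or> (\<exists>t. w2 = (\<lambda>b. t * v b))"
    using rank_one_sum_cases[OF l1[unfolded F0 F1] nu(2,3)] .
  show False
  proof (cases "\<exists>t. w1 = (\<lambda>b. t * v b)")
    case False
    then obtain al where al: "u = (\<lambda>a. al * u1 a)" using c0 by blast
    have al0: "al \<noteq> 0" using nu(4) unfolding al by auto
    have "\<not> (\<exists>t. u = (\<lambda>a. t * u2 a))"
    proof
      assume "\<exists>t. u = (\<lambda>a. t * u2 a)"
      then obtain t where "u = (\<lambda>a. t * u2 a)" by blast
      hence "u1 a = (t / al) * u2 a" for a using al0 al by (simp add: fun_eq_iff field_simps)
      thus False using u12 by blast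
    qed
    then obtain be where be: "w2 = (\<lambda>b. be * v b)" using c1 by blast
    have "rank_one (\<lambda>a b. u1 a * v b + u2 a * v b + (al * u1 a) * w1 b + (al * u1 a) * (be * v b))"
      using all unfolding F0 F1 al be outer_def .
    from square_aux[OF u12(1) False nu(1,3) al0 this] show False .
  next
    case True
    then obtain be where be: "w1 = (\<lambda>b. be * v b)" by blast
    have be0: "be \<noteq> 0" using nu(5) unfolding be by auto
    have nw: "\<not> (\<exists>t. w2 = (\<lambda>b. t * v b))"
    proof
      assume "\<exists>t. w2 = (\<lambda>b. t * v b)"
      then obtain t where "w2 = (\<lambda>b. t * v b)" by blast
      hence "w2 a = (t / be) * w1 a" for a using be0 be by (simp add: fun_eq_iff field_simps)
      thus False using w12 by blast
    qed
    then obtain al where al: "u = (\<lambda>a. al * u2 a)" using c1 by blast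
    have al0: "al \<noteq> 0" using nu(4) unfolding al by auto
    have "rank_one (\<lambda>a b. u2 a * v b + u1 a * v b + (al * u2 a) * w2 b + (al * u2 a) * (be * v b))"
      using all unfolding F0 F1 al be outer_def by (simp add: algebra_simps)
    from square_aux[OF u12(2) nw nu(2,3) al0 this] show False .
  qed
qed

text \<open>A family of rank one matrices indexed by the digits \<open>c s < d s\<close> of finitely many slots \<open>s < S\<close>: the
  images of the decomposable tensors that are built from basis vectors.\<close>

locale rank_one_family =
  fixes S :: nat and d :: "nat \<Rightarrow> nat" and M :: "(nat \<Rightarrow> nat) \<Rightarrow> cfun2"
  assumes M_cong: "(\<And>s. s < S \<Longrightarrow> c s = c' s) \<Longrightarrow> M c = M c'"
    and d_pos: "s < S \<Longrightarrow> 0 < d s"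
    and r1M: "(\<And>s. s < S \<Longrightarrow> c s < d s) \<Longrightarrow> rank_one (M c)"
    and nzM: "(\<And>s. s < S \<Longrightarrow> c s < d s) \<Longrightarrow> nonzero (M c)"
    and edge_r1: "\<lbrakk>\<And>s. s < S \<Longrightarrow> c s < d s; s < S; q < d s; q \<noteq> c s\<rbrakk> \<Longrightarrow> rank_one (\<lambda>a b. M c a b + M (c(s := q)) a b)"
    and edge_indep: "\<lbrakk>\<And>s. s < S \<Longrightarrow> c s < d s; s < S; q < d s; q \<noteq> c s\<rbrakk> \<Longrightarrow> nonzero (\<lambda>a b. M c a b + t * M (c(s := q)) a b)"
    and square_r1: "\<lbrakk>\<And>s. s < S \<Longrightarrow> c s < d s; s < S; q < d s; q \<noteq> c s; l < S; p < d l; p \<noteq> c l; l \<noteq> s\<rbrakk>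
      \<Longrightarrow> rank_one (\<lambda>a b. M c a b + M (c(s := q)) a b + M (c(l := p)) a b + M (c(l := p, s := q)) a b)"
begin

definition valid :: "(nat \<Rightarrow> nat) \<Rightarrow> bool" where
  "valid c \<longleftrightarrow> (\<forall>s<S. c s < d s)"

definition edge :: "(nat \<Rightarrow> nat) \<Rightarrow> nat \<Rightarrow> nat \<Rightarrow> bool" where
  "edge c s q \<longleftrightarrow> valid c \<and> s < S \<and> q < d s \<and> q \<noteq> c s"

lemma valid_upd: "valid c \<Longrightarrow> q < d s \<Longrightarrow> valid (c(s := q))"
  by (auto simp: valid_def)

lemma edge_ind: "edge c s q \<Longrightarrow> indep (M c) (M (c(s := q)))"
  unfolding indep_def using edge_indep[of c s q] nzM[of c] nzM[of "c(s := q)"] by (auto simp: edge_def valid_def)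

lemma edge_type: "edge c s q \<Longrightarrow> same_row (M c) (M (c(s := q))) \<or> same_col (M c) (M (c(s := q)))"
  by (rule edge_cases) (auto intro!: r1M nzM edge_r1 simp: edge_def valid_def)

lemma edge_rev: "edge c s q \<Longrightarrow> edge (c(s := q)) s (c s)"
  by (auto simp: edge_def valid_def)

abbreviation T :: "(nat \<Rightarrow> nat) \<Rightarrow> nat \<Rightarrow> nat \<Rightarrow> bool" where
  "T c s q \<equiv> same_row (M c) (M (c(s := q)))"

lemma T_rev: "T c s q \<Longrightarrow> T (c(s := q)) s (c s)"
  using same_row_sym by simp

lemma T_triangle:
  assumes "edge c s q" "edge c s r" "T c s q"
  shows "T c s r"
proof (cases "q = r")
  case False
  have "edge (c(s := q)) s r" using assms False by (auto simp: edge_def valid_def)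
  from edge_type[OF this] have "same_row (M (c(s := q))) (M (c(s := r))) \<or> same_col (M (c(s := q))) (M (c(s := r)))" by simp
  thus ?thesis by (rule triangle[OF edge_ind[OF assms(1)] assms(3) edge_ind[OF assms(2)] _ edge_type[OF assms(2)]])
qed (use assms in simp)

lemma T_square:
  assumes e: "edge c s q" and l: "l < S" "p < d l" "l \<noteq> s" and T: "T c s q"
  shows "T (c(l := p)) s q"
proof (cases "p = c l")
  case False
  have e': "edge (c(l := p)) s q" using e l by (auto simp: edge_def valid_def)
  have el: "edge c l p" "edge (c(s := q)) l p" using e l False by (auto simp: edge_def valid_def)
  have sw: "c(s := q, l := p) = c(l := p, s := q)" using l(3) by (auto simp: fun_upd_def)
  show ?thesis
  proof (rule square[OF edge_ind[OF e] edge_ind[OF e'] T edge_type[OF e']])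
    show "rank_one (\<lambda>a b. M c a b + M (c(l := p)) a b)" using el(1) by (intro edge_r1) (auto simp: edge_def valid_def)
    show "rank_one (\<lambda>a b. M (c(s := q)) a b + M (c(l := p, s := q)) a b)"
      unfolding sw[symmetric] using el(2) by (intro edge_r1) (auto simp: edge_def valid_def)
    show "rank_one (\<lambda>a b. M c a b + M (c(s := q)) a b + M (c(l := p)) a b + M (c(l := p, s := q)) a b)"
      using e l False by (intro square_r1) (auto simp: edge_def valid_def)
  qed
qed (use T in simp)

text \<open>The type is a property of the slot alone: other slots are altered one at a time by
  \<open>T_square\<close>, and the pair of digits inside the slot by
  \<open>T_triangle\<close>.\<close>

lemma T_slot:
  assumes e: "edge c s q" and e': "edge c' s q'" and T: "T c s q"
  shows "T c' s q'"
proof -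
  \<comment> \<open>A path from c towards c' that leaves slot s alone; its end agrees with c' in
    every other slot.\<close>
  define cj where "cj j = (\<lambda>l. if l < j \<and> l \<noteq> s then c' l else c l)" for j
  have *: "edge (cj j) s q \<and> T (cj j) s q" if "j \<le> S" for j
    using that
  proof (induction j)
    case 0
    have "cj 0 = c" by (simp add: cj_def)
    thus ?case using e T by metis
  next
    case (Suc j)
    hence IH: "edge (cj j) s q" "T (cj j) s q" using Suc_leD by blast+
    show ?case
    proof (cases "j = s")
      case True
      hence "cj (Suc j) = cj j" by (auto simp: cj_def less_Suc_eq)
      thus ?thesis using IH by metis
    next
      case False
      hence eq: "cj (Suc j) = (cj j)(j := c' j)" by (auto simp: cj_def less_Suc_eq)
      have cj: "c' j < d j" using e' Suc.prems by (auto simp: edge_def valid_def)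
      have "T ((cj j)(j := c' j)) s q" by (rule T_square[OF IH(1) _ cj False IH(2)]) (use Suc.prems in simp)
      moreover have "edge ((cj j)(j := c' j)) s q" using IH(1) cj False by (auto simp: edge_def valid_def)
      ultimately show ?thesis unfolding eq by blast
    qed
  qed
  define f where "f = cj S"
  have f: "edge f s q" "T f s q" using *[of S] by (auto simp: f_def)
  have M': "M c' = M (f(s := c' s))" by (rule M_cong) (auto simp: f_def cj_def)
  have M'q: "M (c'(s := q')) = M (f(s := q'))" by (rule M_cong) (auto simp: f_def cj_def)
  have "same_row (M (f(s := c' s))) (M (f(s := q')))"
  proof (cases "c' s = f s")
    case True
    hence fs: "f(s := c' s) = f" by simp
    have "edge f s q'" using f(1) e' True by (auto simp: edge_def)
    from T_triangle[OF f(1) this f(2)] show ?thesis unfolding fs .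
  next
    case False
    have e1: "edge f s (c' s)" using f(1) e' False by (auto simp: edge_def valid_def)
    have "T f s (c' s)" by (rule T_triangle[OF f(1) e1 f(2)])
    from T_rev[OF this] edge_rev[OF e1] have 1: "edge (f(s := c' s)) s (f s)" "T (f(s := c' s)) s (f s)" by auto
    have "edge (f(s := c' s)) s q'" using e1 e' by (auto simp: edge_def valid_def)
    from T_triangle[OF 1(1) this 1(2)] show ?thesis by simp
  qed
  thus ?thesis unfolding M' M'q .
qed

text \<open>Slots with a single digit carry no edges, so their type may be chosen freely.\<close>

definition typing :: "(nat \<Rightarrow> bool) \<Rightarrow> bool" where
  "typing \<tau> \<longleftrightarrow> (\<forall>c s q. edge c s q \<longrightarrow> (if \<tau> s then same_row (M c) (M (c(s := q))) else same_col (M c) (M (c(s := q)))))"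

lemma typing_exists: "\<exists>\<tau>. typing \<tau>"
proof -
  define \<tau> where "\<tau> s \<longleftrightarrow> (\<exists>c q. edge c s q \<and> T c s q)" for s
  have "typing \<tau>" unfolding typing_def
  proof (intro allI impI)
    fix c s q assume e: "edge c s q"
    show "if \<tau> s then same_row (M c) (M (c(s := q))) else same_col (M c) (M (c(s := q)))"
      using e edge_type[OF e] T_slot[OF _ e] by (auto simp: \<tau>_def)
  qed
  thus ?thesis by blast
qed

text \<open>Induction on the number of nonzero digits. If slots of one type only are nonzero, the
  other factor is still that of the base point. If both types occur, clearing one slot of each type
  gives a square with corners U V, U' V, U V' and a multiple of U' V'; the rank of the sum of the
  corners fixes the multiple.\<close>

lemma factorisation:
  assumes ty: "typing \<tau>"
  shows "\<exists>u v. \<forall>c. valid c \<longrightarrow> M c = outer (u (\<lambda>s. if \<tau> s then c s else 0)) (v (\<lambda>s. if \<tau> s then 0 else c s))"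
proof -
  define z :: "nat \<Rightarrow> nat" where "z = (\<lambda>_. 0)"
  have vz: "valid z" using d_pos by (auto simp: valid_def z_def)
  obtain u0 v0 where M0: "M z = outer u0 v0" using r1M[of z] vz unfolding rank_one_def valid_def by blast
  have "nonzero (M z)" using nzM vz by (auto simp: valid_def)
  then obtain a0 b0 where a0: "u0 a0 \<noteq> 0" and b0: "v0 b0 \<noteq> 0" using nonzero_outer unfolding M0 by blast
  \<comment> \<open>Slices through a nonzero entry of the base point, scaled so that they reproduce
    its factors. They give the correct factor whenever the other factor is that of the base
    point.\<close>
  define u where "u c = (\<lambda>a. M c a b0 / v0 b0)" for c
  define v where "v c = (\<lambda>b. M c a0 b / u0 a0)" for c
  define cl where "cl c = (\<lambda>s. if \<tau> s then c s else 0)" for c :: "nat \<Rightarrow> nat"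
  define rw where "rw c = (\<lambda>s. if \<tau> s then 0 else c s)" for c :: "nat \<Rightarrow> nat"
  have u_cong: "u c = u c'" if "\<And>s. s < S \<Longrightarrow> c s = c' s" for c c' using M_cong[of c c'] that by (simp add: u_def)
  have v_cong: "v c = v c'" if "\<And>s. s < S \<Longrightarrow> c s = c' s" for c c' using M_cong[of c c'] that by (simp add: v_def)
  have uz: "u z = u0" and vz0: "v z = v0" using a0 b0 by (auto simp: u_def v_def M0 outer_def)
  have main: "M c = outer (u (cl c)) (v (rw c))" if "valid c" for c
    using that
  proof (induction "card {s. s < S \<and> c s \<noteq> 0}" arbitrary: c rule: less_induct)
    case less
    have smaller: "M (c(s := 0)) = outer (u (cl (c(s := 0)))) (v (rw (c(s := 0))))" if "s < S" "c s \<noteq> 0" for s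
    proof (rule less.hyps)
      show "card {l. l < S \<and> (c(s := 0)) l \<noteq> 0} < card {s. s < S \<and> c s \<noteq> 0}"
        using that by (intro psubset_card_mono) auto
      show "valid (c(s := 0))" using less.prems d_pos[OF that(1)] by (rule valid_upd)
    qed
    have ed: "edge (c(s := 0)) s (c s)" if "s < S" "c s \<noteq> 0" for s
      using that less.prems d_pos[OF that(1)] by (auto simp: edge_def valid_def)
    have upd_back: "(c(s := 0))(s := c s) = c" for s by simp
    have nzs: "nonzero (M (c(s := 0)))" if "s < S" "c s \<noteq> 0" for s
      using edge_ind[OF ed[OF that]] by (simp add: indep_def)
    show ?case
    proof (cases "\<exists>s<S. \<tau> s \<and> c s \<noteq> 0")
      case False
      show ?thesis
      proof (cases "\<exists>s<S. \<not> \<tau> s \<and> c s \<noteq> 0")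
        case False
        with \<open>\<not> (\<exists>s<S. \<tau> s \<and> c s \<noteq> 0)\<close> have c0: "c s = 0" if "s < S" for s using that by blast
        have "M c = M z" by (rule M_cong) (simp add: c0 z_def)
        moreover have "u (cl c) = u z" "v (rw c) = v z" by (auto simp: cl_def rw_def z_def c0 intro!: u_cong v_cong)
        ultimately show ?thesis by (simp add: uz vz0 M0)
      next
        case True
        then obtain l where l: "l < S" "\<not> \<tau> l" "c l \<noteq> 0" by blast
        have c0: "\<tau> s \<Longrightarrow> c s = 0" if "s < S" for s using that \<open>\<not> (\<exists>s<S. \<tau> s \<and> c s \<noteq> 0)\<close> by blast
        have "u (cl (c(l := 0))) = u z" by (rule u_cong) (auto simp: cl_def z_def c0)
        hence Ml: "M (c(l := 0)) = outer u0 (v (rw (c(l := 0))))" using smaller[OF l(1,3)] by (simp add: uz)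
        have "same_col (M (c(l := 0))) (M c)" using ty ed[OF l(1,3)] l(2) unfolding typing_def by (metis upd_back)
        from same_col_rep[OF this[unfolded Ml]] nzs[OF l(1,3)] obtain w where w: "M c = outer u0 w" unfolding Ml by blast
        have "v (rw c) = v c" by (rule v_cong) (auto simp: rw_def c0)
        moreover have "v c = w" using a0 by (simp add: v_def w outer_def)
        moreover have "u (cl c) = u z" by (rule u_cong) (auto simp: cl_def z_def c0)
        ultimately show ?thesis using w by (simp add: uz)
      qed
    next
      case True
      then obtain s where s: "s < S" "\<tau> s" "c s \<noteq> 0" by blast
      have srs: "same_row (M (c(s := 0))) (M c)" using ty ed[OF s(1,3)] s(2) unfolding typing_def by (metis upd_back)
      show ?thesis
      proof (cases "\<exists>s<S. \<not> \<tau> s \<and> c s \<noteq> 0")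
        case False
        hence c0: "\<not> \<tau> s \<Longrightarrow> c s = 0" if "s < S" for s using that by blast
        have "v (rw (c(s := 0))) = v z" by (rule v_cong) (auto simp: rw_def z_def c0)
        hence Ms: "M (c(s := 0)) = outer (u (cl (c(s := 0)))) v0" using smaller[OF s(1,3)] by (simp add: vz0)
        from same_row_rep[OF srs[unfolded Ms]] nzs[OF s(1,3)] obtain w where w: "M c = outer w v0" unfolding Ms by blast
        have "u (cl c) = u c" by (rule u_cong) (auto simp: cl_def c0)
        moreover have "u c = w" using b0 by (simp add: u_def w outer_def)
        moreover have "v (rw c) = v z" by (rule v_cong) (auto simp: rw_def z_def c0)
        ultimately show ?thesis using w by (simp add: vz0)
      next
        case True
        then obtain l where l: "l < S" "\<not> \<tau> l" "c l \<noteq> 0" by blast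
        have ls: "l \<noteq> s" using l s by auto
        have scl: "same_col (M (c(l := 0))) (M c)" using ty ed[OF l(1,3)] l(2) unfolding typing_def by (metis upd_back)
        let ?c0 = "c(s := 0, l := 0)"
        define U where "U = u (cl (c(s := 0)))"
        define U' where "U' = u (cl c)"
        define V where "V = v (rw (c(l := 0)))"
        define V' where "V' = v (rw c)"
        have "cl (c(l := 0)) = cl c" "rw (c(s := 0)) = rw c" using l s by (auto simp: cl_def rw_def)
        hence Ms: "M (c(s := 0)) = outer U V'" and Ml: "M (c(l := 0)) = outer U' V"
          using smaller[OF s(1,3)] smaller[OF l(1,3)] by (simp_all add: U_def U'_def V_def V'_def)
        have v0s: "valid ?c0" using less.prems d_pos[OF l(1)] d_pos[OF s(1)] by (intro valid_upd) auto
        have "M ?c0 = outer (u (cl ?c0)) (v (rw ?c0))"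
        proof (rule less.hyps[OF _ v0s])
          show "card {x. x < S \<and> ?c0 x \<noteq> 0} < card {x. x < S \<and> c x \<noteq> 0}"
            using s by (intro psubset_card_mono) auto
        qed
        moreover have "cl ?c0 = cl (c(s := 0))" "rw ?c0 = rw (c(l := 0))" using l s by (auto simp: cl_def rw_def)
        ultimately have M00: "M ?c0 = outer U V" by (simp add: U_def V_def)
        obtain x where x: "M c = outer x V'" using same_row_rep[OF srs[unfolded Ms]] nzs[OF s(1,3)] unfolding Ms by blast
        obtain y where y: "M c = outer U' y" using same_col_rep[OF scl[unfolded Ml]] nzs[OF l(1,3)] unfolding Ml by blast
        have nUV: "\<exists>a. U a \<noteq> 0" "\<exists>b. V' b \<noteq> 0" "\<exists>a. U' a \<noteq> 0" "\<exists>b. V b \<noteq> 0"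
          using nonzero_outer nzs[OF s(1,3)] nzs[OF l(1,3)] unfolding Ms Ml by blast+
        obtain b where b: "V' b \<noteq> 0" using nUV by blast
        have "x a = y b / V' b * U' a" for a
          using fun_cong[OF fun_cong[OF x[unfolded y]], of a b] b by (simp add: outer_def field_simps)
        then obtain \<zeta> where \<zeta>: "M c = outer (\<lambda>a. \<zeta> * U' a) V'" using x by (metis ext)
        have e1: "edge ?c0 s (c s)" "edge ?c0 l (c l)" using v0s s l ls less.prems by (auto simp: edge_def valid_def)
        have u1: "?c0(s := c s) = c(l := 0)" "?c0(l := c l) = c(s := 0)" "?c0(l := c l, s := c s) = c" using ls by (auto simp: fun_eq_iff)
        have "rank_one (\<lambda>a b. M ?c0 a b + M (?c0(s := c s)) a b + M (?c0(l := c l)) a b + M (?c0(l := c l, s := c s)) a b)"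
          using e1 ls by (intro square_r1) (auto simp: edge_def valid_def)
        \<comment> \<open>The coefficient determinant of the four corners is the unknown multiple
          minus 1, and independence along both edges provides nonzero minors.\<close>
        hence "rank_one (\<lambda>a b. 1 * (U a * V b) + 1 * (U a * V' b) + 1 * (U' a * V b) + \<zeta> * (U' a * V' b))"
          unfolding u1 unfolding M00 Ml Ms unfolding outer_def by (simp add: \<zeta> outer_def algebra_simps)
        note mn = rank_one_sum_minors[OF this]
        have iU: "indep (outer U V) (outer U' V)" using edge_ind[OF e1(1)] unfolding u1 M00 Ml .
        have iV: "indep (outer U V) (outer U V')" using edge_ind[OF e1(2)] unfolding u1 M00 Ms .
        have "\<exists>a a'. U a * U' a' - U a' * U' a \<noteq> 0"
        proof (rule ccontr)
          assume "\<not> ?thesis"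
          then obtain t where "U' = (\<lambda>a. t * U a)" using proportional[of U U'] nUV(1) by auto
          thus False using indep_not_smult[OF iU, of t] by (simp add: outer_def mult.assoc)
        qed
        moreover have "\<exists>b b'. V b * V' b' - V b' * V' b \<noteq> 0"
        proof (rule ccontr)
          assume "\<not> ?thesis"
          then obtain t where "V' = (\<lambda>a. t * V a)" using proportional[of V V'] nUV(4) by auto
          thus False using indep_not_smult[OF iV, of t] by (simp add: outer_def mult.left_commute)
        qed
        ultimately have "1 * \<zeta> - 1 * 1 = 0" using mn by (metis mult_eq_0_iff)
        hence "\<zeta> = 1" by simp
        thus ?thesis using \<zeta> by (simp add: U'_def V'_def)
      qed
    qed
  qed
  show ?thesis
  proof (rule exI[of _ u], rule exI[of _ v], intro allI impI)
    fix c assume "valid c"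
    from main[OF this] show "M c = outer (u (\<lambda>s. if \<tau> s then c s else 0)) (v (\<lambda>s. if \<tau> s then 0 else c s))"
      by (simp only: cl_def rw_def)
  qed
qed

end

section \<open>Ky Fan norms of rank one matrices\<close>

lemma rank1_svd:
  assumes X: "X \<in> carrier_mat n n" and n: "0 < n" and uv: "\<And>i j. i < n \<Longrightarrow> j < n \<Longrightarrow> X $$ (i, j) = u i * v j"
    and svd: "is_svd n X U V \<sigma>"
  shows "\<And>i. 0 < i \<Longrightarrow> i < n \<Longrightarrow> \<sigma> i = 0" "\<sigma> 0 = sqrt (\<Sum>i<n. (cmod (u i))\<^sup>2) * sqrt (\<Sum>i<n. (cmod (v i))\<^sup>2)"
proof -
  note s = is_svdD[OF svd]
  note c = unitary_matD(1)[OF s(1)] unitary_matD(1)[OF s(2)]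
  define a where "a = U *\<^sub>v vec n u"
  define b where "b = transpose_mat V *\<^sub>v vec n v"
  have ab: "a \<in> carrier_vec n" "b \<in> carrier_vec n" using c by (simp_all add: a_def b_def)
  have ai: "a $ i = (\<Sum>l<n. U $$ (i, l) * u l)" if "i < n" for i
    unfolding a_def using that c by (subst mult_mat_vec_index[of _ n n]) auto
  have bi: "b $ i = (\<Sum>l<n. v l * V $$ (l, i))" if "i < n" for i
    unfolding b_def using that c by (subst mult_mat_vec_index[of _ n n]) (auto simp: mult.commute)
  \<comment> \<open>The transformed matrix a b^t is diagonal. If its corner is nonzero, all further
    entries of a and b vanish, and the corner is the product of the two norms, which U and the
    transpose of V preserve.\<close>
  have prd: "a $ i * b $ j = (if i = j then of_real (\<sigma> i) else 0)" if "i < n" "j < n" for i j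
  proof -
    have "(U * X * V) $$ (i, j) = (\<Sum>m<n. (U * X) $$ (i, m) * V $$ (m, j))"
      using c X that by (intro mult_mat_index) auto
    also have "\<dots> = (\<Sum>m<n. a $ i * (v m * V $$ (m, j)))"
    proof (rule sum.cong[OF refl])
      fix m assume "m \<in> {..<n}"
      hence m: "m < n" by simp
      have "(U * X) $$ (i, m) = (\<Sum>l<n. U $$ (i, l) * X $$ (l, m))" using c X that m by (intro mult_mat_index) auto
      also have "\<dots> = a $ i * v m" unfolding ai[OF that(1)] sum_distrib_right using uv m by (intro sum.cong) auto
      finally show "(U * X) $$ (i, m) * V $$ (m, j) = a $ i * (v m * V $$ (m, j))" by simp
    qed
    also have "\<dots> = a $ i * b $ j" unfolding bi[OF that(2)] by (rule sum_distrib_left[symmetric])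
    finally show ?thesis using that by (simp add: s(3))
  qed
  have nrm: "(\<Sum>i<n. (cmod (w $ i))\<^sup>2) = (\<Sum>i<n. (cmod (f i))\<^sup>2)" if W: "unitary_mat n W" and w: "w = W *\<^sub>v vec n f" for W w f
  proof -
    have "complex_of_real (\<Sum>i<n. (cmod (w $ i))\<^sup>2) = ip w w"
      unfolding w ip_self using unitary_matD(1)[OF W] by simp
    also have "\<dots> = ip (vec n f) (vec n f)" unfolding w by (rule unitary_ip[OF W]) auto
    also have "\<dots> = complex_of_real (\<Sum>i<n. (cmod (f i))\<^sup>2)" unfolding ip_self by simp
    finally show ?thesis using of_real_eq_iff by blast
  qed
  have na: "(\<Sum>i<n. (cmod (a $ i))\<^sup>2) = (\<Sum>i<n. (cmod (u i))\<^sup>2)" by (rule nrm[OF s(1) a_def])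
  have nb: "(\<Sum>i<n. (cmod (b $ i))\<^sup>2) = (\<Sum>i<n. (cmod (v i))\<^sup>2)" by (rule nrm[OF unitary_transpose[OF s(2)] b_def])
  show z: "\<sigma> i = 0" if "0 < i" "i < n" for i
  proof (rule ccontr)
    assume ne: "\<sigma> i \<noteq> 0"
    hence "\<sigma> i > 0" using s(4)[OF that(2)] by simp
    hence "\<sigma> 0 > 0" using s(5)[of 0 i] that by simp
    hence "a $ 0 \<noteq> 0" using prd[OF n n] by auto
    moreover have "b $ i \<noteq> 0" using prd[OF that(2) that(2)] ne by auto
    ultimately show False using prd[OF n that(2)] that by simp
  qed
  have one: "(\<Sum>i<n. (cmod (w $ i))\<^sup>2) = (cmod (w $ 0))\<^sup>2" if "\<And>i. 0 < i \<Longrightarrow> i < n \<Longrightarrow> w $ i = 0" for w :: "complex vec"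
  proof -
    have "(\<Sum>i<n. (cmod (w $ i))\<^sup>2) = (\<Sum>i<n. if i = 0 then (cmod (w $ 0))\<^sup>2 else 0)" using that by (intro sum.cong) auto
    thus ?thesis using n by simp
  qed
  show "\<sigma> 0 = sqrt (\<Sum>i<n. (cmod (u i))\<^sup>2) * sqrt (\<Sum>i<n. (cmod (v i))\<^sup>2)"
  proof (cases "\<sigma> 0 = 0")
    case False
    hence ne: "a $ 0 \<noteq> 0" "b $ 0 \<noteq> 0" using prd[OF n n] by auto
    have "a $ i = 0" "b $ i = 0" if "0 < i" "i < n" for i using prd[OF n that(2)] prd[OF that(2) n] ne that by auto
    hence "(\<Sum>i<n. (cmod (u i))\<^sup>2) = (cmod (a $ 0))\<^sup>2" "(\<Sum>i<n. (cmod (v i))\<^sup>2) = (cmod (b $ 0))\<^sup>2"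
      using one[of a] one[of b] na nb by auto
    hence "sqrt (\<Sum>i<n. (cmod (u i))\<^sup>2) * sqrt (\<Sum>i<n. (cmod (v i))\<^sup>2) = cmod (a $ 0 * b $ 0)" by (simp add: norm_mult)
    also have "\<dots> = \<sigma> 0" unfolding prd[OF n n] using s(4)[OF n] by simp
    finally show ?thesis by simp
  next
    case True
    have all: "a $ i * b $ j = 0" if "i < n" "j < n" for i j
    proof -
      have "\<sigma> i = 0" using True z[of i] that by (cases "i = 0") auto
      thus ?thesis using prd[OF that] by (cases "i = j") auto
    qed
    have "(\<forall>i<n. a $ i = 0) \<or> (\<forall>i<n. b $ i = 0)" using all by (metis mult_eq_0_iff)
    hence "(\<Sum>i<n. (cmod (a $ i))\<^sup>2) = 0 \<or> (\<Sum>i<n. (cmod (b $ i))\<^sup>2) = 0" by (metis (no_types, lifting) lessThan_iff norm_zero power_zero_numeral sum.neutral)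
    thus ?thesis using True na nb by auto
  qed
qed

text \<open>There is only one nonzero singular value, so every Ky Fan norm is the Frobenius norm,
  whose square is a quadratic function of the entries.\<close>

lemma ky_fan_rank1:
  assumes X: "X \<in> carrier_mat n n" and k: "1 \<le> k" "k \<le> n" and uv: "\<And>i j. i < n \<Longrightarrow> j < n \<Longrightarrow> X $$ (i, j) = u i * v j"
  shows "ky_fan_norm k X = sqrt (\<Sum>i<n. (cmod (u i))\<^sup>2) * sqrt (\<Sum>i<n. (cmod (v i))\<^sup>2)"
proof -
  obtain U V \<sigma> where svd: "is_svd n X U V \<sigma>" using singular_value_decomposition[OF X] by blast
  have n: "0 < n" using k by simp
  note r = rank1_svd[OF X n uv svd]
  have "ky_fan_norm k X = (\<Sum>i<k. \<sigma> i)" by (rule ky_fan_svd[OF X svd k(2)])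
  also have "\<dots> = (\<Sum>i<k. if i = 0 then \<sigma> 0 else 0)" using r(1) k by (intro sum.cong) auto
  also have "\<dots> = \<sigma> 0" using k by simp
  finally show ?thesis using r(2) by simp
qed

section \<open>Images of the corner unit and of rank one products\<close>

lemma diagm_cong: "(\<And>i. i < n \<Longrightarrow> c i = d i) \<Longrightarrow> diagm n c = diagm n d"
  by (intro eq_matI) auto

lemma digit_zero: "i < m \<Longrightarrow> digit n m 0 i = 0"
  by (induction m arbitrary: i) (auto simp: less_Suc_eq)

lemma prod_indicator:
  "(\<Prod>i<(m::nat). if P i then 1 else 0) = (if \<forall>i<m. P i then 1 else (0 :: complex))"
  by (induction m) (auto simp: less_Suc_eq)

lemma kp_unit_diag:
  assumes "a < prd n m"
  shows "kronecker_prod m (\<lambda>i. diagm (n i) (\<lambda>p. if p = digit n m a i then 1 else 0)) = diagm (prd n m) (\<lambda>b. if b = a then 1 else 0)"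
  unfolding kp_diagm prod_indicator
proof (rule diagm_cong)
  fix b assume "b < prd n m"
  from digit_eq_iff[OF this assms]
  show "(if \<forall>i<m. digit n m b i = digit n m a i then 1 else 0) = (if b = a then 1 else (0::complex))" by simp
qed

lemma preserver_corner:
  assumes \<phi>: "preserver m n k \<phi>" and k: "1 \<le> k" "k \<le> prd n m"
  shows "rank1 (prd n m) (\<phi> (diagm (prd n m) (\<lambda>b. if b = 0 then 1 else 0)))"
proof -
  define N where "N = prd n m"
  define E where "E a = diagm N (\<lambda>b. if b = a then 1 else 0 :: complex)" for a
  define P where "P a = \<phi> (E a)" for a
  have Ec: "E a \<in> carrier_mat N N" for a by (simp add: E_def)
  have P: "P a \<in> carrier_mat N N" for a unfolding P_def using preserverD(1)[OF \<phi>] Ec by (simp add: N_def)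
  have carr_d: "carr m n (\<lambda>i. diagm (n i) (d i))" for d by (simp add: carr_def)
  have kyE: "ky_fan_norm k (E a) = 1" if "a < N" for a
  proof -
    have z: "ky_fan_norm k (diagm N (\<lambda>b. if b = 0 then 1 else 0)) = 1"
    proof -
      have "ky_fan_norm k (diagm N (\<lambda>b. if b = 0 then 1 else 0)) = (\<Sum>i<k. cmod (if i = 0 then 1 else 0))"
        using k by (intro ky_fan_diagm) (auto simp: N_def)
      also have "\<dots> = (\<Sum>i<k. if i = 0 then 1 else 0)" by (intro sum.cong) auto
      finally show ?thesis using k by simp
    qed
    have "E a = diagm N (\<lambda>i. (\<lambda>b. if b = 0 then 1 else 0) (transpose a 0 i))"
      unfolding E_def by (rule diagm_cong) (auto simp: transpose_def)
    thus ?thesis using ky_fan_diagm_transpose[of a N 0 k "\<lambda>b. if b = 0 then 1 else 0"] that z by simp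
  qed
  have nrm: "ky_fan_norm k (P a) = 1" if "a < N" for a
    unfolding P_def kyE[OF that, symmetric] E_def N_def kp_unit_diag[OF that[unfolded N_def], symmetric]
    by (rule preserverD(4)[OF \<phi> carr_d])
  have f: "ky_fan_norm k (mat N N (\<lambda>p. \<Sum>a<N. z ^ a * P a $$ p)) = (\<Sum>a<k. cmod z ^ a)" if z: "cmod z \<le> 1" for z
  proof -
    obtain d where d: "\<forall>a<prd n m. (\<Prod>i<m. d i (digit n m a i)) = z ^ a" using power_product_form by blast
    have kp: "kronecker_prod m (\<lambda>i. diagm (n i) (d i)) = diagm N (\<lambda>a. z ^ a)"
      unfolding kp_diagm N_def using d by (intro diagm_cong) auto
    have eq: "mat N N (\<lambda>p. \<Sum>a<N. z ^ a * E a $$ p) = diagm N (\<lambda>a. z ^ a)"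
    proof (intro eq_matI)
      fix i j assume "i < dim_row (diagm N (\<lambda>a. z ^ a))" "j < dim_col (diagm N (\<lambda>a. z ^ a))"
      hence ij: "i < N" "j < N" by auto
      have "(\<Sum>a<N. z ^ a * E a $$ (i, j)) = (\<Sum>a<N. if a = i then (if i = j then z ^ i else 0) else 0)"
        using ij by (intro sum.cong) (auto simp: E_def)
      thus "mat N N (\<lambda>p. \<Sum>a<N. z ^ a * E a $$ p) $$ (i, j) = diagm N (\<lambda>a. z ^ a) $$ (i, j)" using ij by simp
    qed auto
    have "mat N N (\<lambda>p. \<Sum>a<N. z ^ a * P a $$ p) = \<phi> (diagm N (\<lambda>a. z ^ a))"
    proof (intro eq_matI)
      have c: "\<phi> (diagm N (\<lambda>a. z ^ a)) \<in> carrier_mat N N" using preserverD(1)[OF \<phi>] by (simp add: N_def)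
      show "dim_row (mat N N (\<lambda>p. \<Sum>a<N. z ^ a * P a $$ p)) = dim_row (\<phi> (diagm N (\<lambda>a. z ^ a)))"
        "dim_col (mat N N (\<lambda>p. \<Sum>a<N. z ^ a * P a $$ p)) = dim_col (\<phi> (diagm N (\<lambda>a. z ^ a)))" using c by auto
      fix i j assume "i < dim_row (\<phi> (diagm N (\<lambda>a. z ^ a)))" "j < dim_col (\<phi> (diagm N (\<lambda>a. z ^ a)))"
      hence ij: "i < N" "j < N" using c by auto
      show "mat N N (\<lambda>p. \<Sum>a<N. z ^ a * P a $$ p) $$ (i, j) = \<phi> (diagm N (\<lambda>a. z ^ a)) $$ (i, j)"
        unfolding eq[symmetric] P_def using preserver_sum[OF \<phi>, of "{..<N}" E i j "\<lambda>a. z ^ a"] Ec ij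
        by (simp add: N_def)
    qed
    hence "ky_fan_norm k (mat N N (\<lambda>p. \<Sum>a<N. z ^ a * P a $$ p)) = ky_fan_norm k (diagm N (\<lambda>a. z ^ a))"
      using preserverD(4)[OF \<phi> carr_d, of d] unfolding kp by simp
    also have "\<dots> = (\<Sum>a<k. cmod (z ^ a))"
      using k z by (intro ky_fan_diagm) (auto simp: N_def norm_power intro!: power_decreasing)
    finally show ?thesis by (simp add: norm_power)
  qed
  have "rank1 N (P 0)"
  \<comment> \<open>The argument of \<open>rank1_first\<close> needs a second optimal block, which
    exists only for k >= 2.\<close>
  proof (cases "k = 1")
    case True
    show ?thesis
      by (rule rank1_first_operator_norm[of N P]) (use P nrm f k True in \<open>auto simp: N_def\<close>)
  next
    case False
    show ?thesis
      by (rule rank1_first[of N P k]) (use P nrm f k False in \<open>auto simp: N_def\<close>)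
  qed
  thus ?thesis by (simp add: P_def E_def N_def)
qed

text \<open>Each factor becomes a multiple of its corner unit in a singular value decomposition, so
  the product becomes a multiple of the corner unit of M_N, to which \<open>preserver_corner\<close>
  applies after a twist.\<close>

lemma preserver_rank1:
  assumes \<phi>: "preserver m n k \<phi>" and k: "1 \<le> k" "k \<le> prd n m"
    and A: "carr m n A" and xy: "\<And>i p q. i < m \<Longrightarrow> p < n i \<Longrightarrow> q < n i \<Longrightarrow> A i $$ (p, q) = x i p * y i q"
  shows "rank1 (prd n m) (\<phi> (kronecker_prod m A))"
proof -
  have p0: "0 < prd n m" using k by linarith
  have npos: "0 < n i" if "i < m" for i by (rule prd_pos[OF p0 that])
  have "\<exists>U V \<sigma>. is_svd (n i) (A i) U V \<sigma>" if "i < m" for i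
    using singular_value_decomposition[OF carrD[OF A that]] .
  then obtain U V \<sigma> where svd: "\<And>i. i < m \<Longrightarrow> is_svd (n i) (A i) (U i) (V i) (\<sigma> i)" by metis
  define U' where "U' i = mat_adjoint (U i)" for i
  define V' where "V' i = mat_adjoint (V i)" for i
  have UV: "unitary_mat (n i) (U' i)" "unitary_mat (n i) (V' i)" if "i < m" for i
    using is_svdD(1,2)[OF svd[OF that]] by (auto simp: U'_def V'_def intro: unitary_adjoint)
  define D where "D i = diagm (n i) (\<lambda>p. complex_of_real (\<sigma> i p))" for i
  have AUV: "A i = U' i * D i * V' i" if "i < m" for i
  proof -
    note s = is_svdD(1-3)[OF svd[OF that]]
    note c = unitary_matD(1)[OF s(1)] unitary_matD(1)[OF s(2)] carrD[OF A that]
    have "U' i * D i * V' i = (mat_adjoint (U i) * U i) * A i * (V i * mat_adjoint (V i))"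
      unfolding U'_def V'_def D_def s(3)[symmetric] using c by (simp add: assoc_mult_mat[of _ "n i" "n i" _ "n i" _ "n i"])
    thus ?thesis using unitary_matD(2)[OF s(1)] unitary_matD(3)[OF s(2)] c by simp
  qed
  have cD: "carr m n D" by (simp add: carr_def D_def)
  have cU: "carr m n U'" "carr m n V'" using UV unitary_matD(1) by (auto simp: carr_def)
  define t where "t = (\<Prod>i<m. complex_of_real (\<sigma> i 0))"
  define E where "E = diagm (prd n m) (\<lambda>b. if b = 0 then 1 else 0 :: complex)"
  have "D i = diagm (n i) (\<lambda>p. if p = digit n m 0 i then complex_of_real (\<sigma> i 0) else 0)" if "i < m" for i
    unfolding D_def digit_zero[OF that] using rank1_svd(1)[OF carrD[OF A that] npos[OF that] xy[OF that] svd[OF that]]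
    by (intro diagm_cong) auto
  hence "kronecker_prod m D = kronecker_prod m (\<lambda>i. diagm (n i) (\<lambda>p. if p = digit n m 0 i then complex_of_real (\<sigma> i 0) else 0))"
    by (intro kp_eqI[of m n]) (auto simp: carr_def D_def)
  also have "\<dots> = diagm (prd n m) (\<lambda>b. t * (if b = 0 then 1 else 0))"
    unfolding kp_diagm
  proof (rule diagm_cong)
    fix b assume b: "b < prd n m"
    have "(\<Prod>i<m. if digit n m b i = digit n m 0 i then complex_of_real (\<sigma> i 0) else 0)
        = (\<Prod>i<m. complex_of_real (\<sigma> i 0) * (if digit n m b i = digit n m 0 i then 1 else 0))"
      by (intro prod.cong) auto
    also have "\<dots> = t * (if \<forall>i<m. digit n m b i = digit n m 0 i then 1 else 0)" by (simp add: prod.distrib t_def prod_indicator)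
    also have "(\<forall>i<m. digit n m b i = digit n m 0 i) \<longleftrightarrow> b = 0" by (rule digit_eq_iff[OF b p0])
    finally show "(\<Prod>i<m. if digit n m b i = digit n m 0 i then complex_of_real (\<sigma> i 0) else 0) = t * (if b = 0 then 1 else 0)" .
  qed
  also have "\<dots> = t \<cdot>\<^sub>m E" unfolding E_def by (intro eq_matI) auto
  finally have kD: "kronecker_prod m D = t \<cdot>\<^sub>m E" .
  define \<phi>' where "\<phi>' X = \<phi> (kronecker_prod m U' * X * kronecker_prod m V')" for X
  have \<phi>': "preserver m n k \<phi>'" unfolding \<phi>'_def by (rule preserver_twist[OF \<phi> UV])
  have "kronecker_prod m A = kronecker_prod m (\<lambda>i. U' i * D i * V' i)"
    by (intro kp_eqI[of m n]) (use A AUV carr_mult[OF carr_mult[OF cU(1) cD] cU(2)] in auto)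
  also have "\<dots> = kronecker_prod m U' * kronecker_prod m D * kronecker_prod m V'"
    by (simp add: kp_mult[OF cU(1) cD] kp_mult[OF carr_mult[OF cU(1) cD] cU(2)])
  finally have "\<phi> (kronecker_prod m A) = \<phi>' (t \<cdot>\<^sub>m E)" by (simp add: \<phi>'_def kD)
  also have "\<dots> = t \<cdot>\<^sub>m \<phi>' E" using preserverD(3)[OF \<phi>'] by (simp add: E_def)
  finally have e: "\<phi> (kronecker_prod m A) = t \<cdot>\<^sub>m \<phi>' E" .
  have c: "\<phi>' E \<in> carrier_mat (prd n m) (prd n m)" using preserverD(1)[OF \<phi>'] by (simp add: E_def)
  obtain u v where "\<forall>i<prd n m. \<forall>j<prd n m. \<phi>' E $$ (i, j) = u i * v j"
    using preserver_corner[OF \<phi>' k] unfolding rank1_def E_def by blast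
  hence "\<forall>i<prd n m. \<forall>j<prd n m. \<phi> (kronecker_prod m A) $$ (i, j) = (t * u i) * v j" unfolding e using c by simp
  thus ?thesis unfolding rank1_def by (intro exI[of _ "\<lambda>i. t * u i"] exI[of _ v])
qed

text \<open>The two arguments are decoupled by polarising in one factor after the other.\<close>

lemma product_polarisation:
  fixes H :: "nat \<Rightarrow> nat \<Rightarrow> complex"
  assumes H: "\<And>x. (\<Sum>a<prd n m. \<Sum>b<prd n m. cnj (\<Prod>i<m. x i (digit n m a i)) * (\<Prod>i<m. x i (digit n m b i)) * H a b) = 0"
    and ab: "a < prd n m" "b < prd n m"
  shows "H a b = 0"
proof -
  define K where "K x y = (\<Sum>a<prd n m. \<Sum>b<prd n m. cnj (\<Prod>i<m. x i (digit n m a i)) * (\<Prod>i<m. y i (digit n m b i)) * H a b)"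
    for x y :: "nat \<Rightarrow> nat \<Rightarrow> complex"
  have split: "(\<Prod>i<m. (x(j := w)) i (digit n m a i)) = w (digit n m a j) * (\<Prod>i\<in>{..<m}-{j}. x i (digit n m a i))"
    if "j < m" for x w j a
    using that by (subst prod.remove[of _ j]) (auto intro!: prod.cong)
  have lin: "K (x(j := \<lambda>p. w p + t * w' p)) (y(j := \<lambda>p. v p + s * v' p))
     = K (x(j := w)) (y(j := v)) + s * K (x(j := w)) (y(j := v')) + cnj t * K (x(j := w')) (y(j := v))
       + cnj t * s * K (x(j := w')) (y(j := v'))" if "j < m" for x y j w w' v v' t s
    unfolding K_def split[OF that] sum_distrib_left sum.distrib[symmetric]
    by (intro sum.cong refl) (simp add: algebra_simps)
  \<comment> \<open>The form is claimed to vanish when x and y agree from factor j on. At j = 0 this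
    is the hypothesis, at j = m it is unrestricted.\<close>
  have "\<forall>x y. (\<forall>i. j \<le> i \<longrightarrow> i < m \<longrightarrow> x i = y i) \<longrightarrow> K x y = 0" if "j \<le> m" for j
    using that
  proof (induction j)
    case 0
    show ?case
    proof (intro allI impI)
      fix x y :: "nat \<Rightarrow> nat \<Rightarrow> complex" assume "\<forall>i. 0 \<le> i \<longrightarrow> i < m \<longrightarrow> x i = y i"
      hence "(\<Prod>i<m. y i (digit n m b i)) = (\<Prod>i<m. x i (digit n m b i))" for b by (intro prod.cong) auto
      hence "K x y = K x x" unfolding K_def by simp
      thus "K x y = 0" using H[of x] by (simp add: K_def)
    qed
  next
    case (Suc j)
    hence j: "j < m" and IH: "\<And>x y. (\<forall>i. j \<le> i \<longrightarrow> i < m \<longrightarrow> x i = y i) \<Longrightarrow> K x y = 0" by auto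
    show ?case
    proof (intro allI impI)
      fix x y :: "nat \<Rightarrow> nat \<Rightarrow> complex" assume xy: "\<forall>i. Suc j \<le> i \<longrightarrow> i < m \<longrightarrow> x i = y i"
      have B0: "K (x(j := w)) (y(j := w)) = 0" for w
      proof (rule IH, intro allI impI)
        fix i assume "j \<le> i" "i < m"
        thus "(x(j := w)) i = (y(j := w)) i" using xy by (cases "i = j") auto
      qed
      \<comment> \<open>The form vanishes at w = x_j, w = y_j and w = x_j + t y_j, which leaves the
        two cross terms; t = 1 and t = i separate them.\<close>
      have e: "t * K (x(j := x j)) (y(j := y j)) + cnj t * K (x(j := y j)) (y(j := x j)) = 0" for t
        using lin[OF j, of x "x j" t "y j" y "x j" t "y j"] B0[of "x j"] B0[of "y j"] B0[of "\<lambda>p. x j p + t * y j p"] by simp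
      have "K (x(j := x j)) (y(j := y j)) = 0"
        using e[of 1] e[of \<i>] by (simp add: algebra_simps)
      thus "K x y = 0" by simp
    qed
  qed
  note all = this
  have K0: "K x y = 0" for x y using all[of m] by simp
  define e where "e c = (\<lambda>i p. if p = digit n m c i then 1 else 0 :: complex)" for c
  have pe: "(\<Prod>i<m. e c i (digit n m a i)) = (if a = c then 1 else 0)" if "c < prd n m" "a < prd n m" for a c
    unfolding e_def prod_indicator using digit_eq_iff[OF that(2,1)] by simp
  have "K (e a) (e b) = (\<Sum>a'<prd n m. \<Sum>b'<prd n m. if b' = b then (if a' = a then H a b else 0) else 0)"
    unfolding K_def using pe ab by (intro sum.cong refl) auto
  also have "\<dots> = H a b" using ab by simp
  finally show ?thesis using K0 by simp
qed

text \<open>If U A V = D is diagonal, the transposes of V and U diagonalise the transpose of A to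
  the same D. Hence both products are unitarily equivalent to the same diagonal product.\<close>

lemma kp_transpose_norm:
  assumes A: "carr m n A" and \<psi>: "\<And>i. i < m \<Longrightarrow> \<psi> i = (\<lambda>X. X) \<or> \<psi> i = transpose_mat"
  shows "ky_fan_norm k (kronecker_prod m (\<lambda>i. \<psi> i (A i))) = ky_fan_norm k (kronecker_prod m A)"
proof -
  have "\<exists>U V \<sigma>. is_svd (n i) (A i) U V \<sigma>" if "i < m" for i
    using singular_value_decomposition[OF carrD[OF A that]] .
  then obtain U V \<sigma> where svd: "\<And>i. i < m \<Longrightarrow> is_svd (n i) (A i) (U i) (V i) (\<sigma> i)" by metis
  define D where "D i = diagm (n i) (\<lambda>p. complex_of_real (\<sigma> i p))" for i
  have cD: "carr m n D" by (simp add: carr_def D_def)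
  have *: "ky_fan_norm k (kronecker_prod m B) = ky_fan_norm k (kronecker_prod m D)"
    if B: "carr m n B" and U: "\<And>i. i < m \<Longrightarrow> unitary_mat (n i) (U i)" and V: "\<And>i. i < m \<Longrightarrow> unitary_mat (n i) (V i)"
      and UBV: "\<And>i. i < m \<Longrightarrow> U i * B i * V i = D i" for U V B
  proof -
    have cU: "carr m n U" "carr m n V" using U V unitary_matD(1) by (auto simp: carr_def)
    have "kronecker_prod m U * kronecker_prod m B * kronecker_prod m V = kronecker_prod m (\<lambda>i. U i * B i * V i)"
      by (simp add: kp_mult[OF cU(1) B] kp_mult[OF carr_mult[OF cU(1) B] cU(2)])
    also have "\<dots> = kronecker_prod m D"
      by (intro kp_eqI[of m n]) (use UBV cD carr_mult[OF carr_mult[OF cU(1) B] cU(2)] in auto)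
    finally show ?thesis
      using ky_fan_unitary[OF kp_unitary[of m n U, OF U] kp_unitary[of m n V, OF V] kp_carrier[OF B], of k] by simp
  qed
  have 1: "ky_fan_norm k (kronecker_prod m A) = ky_fan_norm k (kronecker_prod m D)"
    by (rule *[OF A, of U V]) (use is_svdD(1-3)[OF svd] in \<open>auto simp: D_def\<close>)
  have 2: "ky_fan_norm k (kronecker_prod m (\<lambda>i. \<psi> i (A i))) = ky_fan_norm k (kronecker_prod m D)"
  proof (rule *[of _ "\<lambda>i. if \<psi> i = (\<lambda>X. X) then U i else transpose_mat (V i)" "\<lambda>i. if \<psi> i = (\<lambda>X. X) then V i else transpose_mat (U i)"])
    show "carr m n (\<lambda>i. \<psi> i (A i))" using \<psi> carrD[OF A] by (fastforce simp: carr_def)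
    fix i assume i: "i < m"
    note s = is_svdD(1-3)[OF svd[OF i]]
    note c = unitary_matD(1)[OF s(1)] unitary_matD(1)[OF s(2)] carrD[OF A i]
    show "unitary_mat (n i) (if \<psi> i = (\<lambda>X. X) then U i else transpose_mat (V i))"
      "unitary_mat (n i) (if \<psi> i = (\<lambda>X. X) then V i else transpose_mat (U i))"
      using s(1,2) unitary_transpose by auto
    have "transpose_mat (V i) * transpose_mat (A i) * transpose_mat (U i) = transpose_mat (U i * A i * V i)"
      using c by (simp add: transpose_mult[of _ "n i" "n i" _ "n i"] assoc_mult_mat[of _ "n i" "n i" _ "n i" _ "n i"])
    also have "\<dots> = D i" unfolding s(3) D_def by (intro eq_matI) auto
    finally show "(if \<psi> i = (\<lambda>X. X) then U i else transpose_mat (V i)) * \<psi> i (A i) *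
        (if \<psi> i = (\<lambda>X. X) then V i else transpose_mat (U i)) = D i"
      using \<psi>[OF i] s(3) by (auto simp: D_def)
  qed
  show ?thesis using 1 2 by simp
qed

section \<open>The form of a preserver\<close>

text \<open>The rank one factor x y^t, without conjugation, so that the product is complex linear in
  each of the 2 m slots.\<close>

definition slot_fac :: "(nat \<Rightarrow> nat) \<Rightarrow> nat \<Rightarrow> (nat \<Rightarrow> nat \<Rightarrow> complex) \<Rightarrow> nat \<Rightarrow> complex mat" where
  "slot_fac n m z i = mat (n i) (n i) (\<lambda>(p, q). z i p * z (m + i) q)"

text \<open>Slot \<open>s < m\<close> carries the column vector and slot \<open>m + s\<close> the row vector of the \<open>s\<close>-th factor.\<close>

definition slot_dim :: "(nat \<Rightarrow> nat) \<Rightarrow> nat \<Rightarrow> nat \<Rightarrow> nat" where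
  "slot_dim n m s = (if s < m then n s else n (s - m))"

text \<open>The matrix unit at (a, b) as a digit string of length 2 m. The default 0 beyond it makes
  strings equal as functions in \<open>preserver_form\<close>.\<close>

definition slot_digit :: "(nat \<Rightarrow> nat) \<Rightarrow> nat \<Rightarrow> nat \<Rightarrow> nat \<Rightarrow> nat \<Rightarrow> nat" where
  "slot_digit n m a b s = (if s < m then digit n m a s else if s < 2 * m then digit n m b (s - m) else 0)"

lemma carr_slot_fac: "carr m n (slot_fac n m z)" by (simp add: carr_def slot_fac_def)

lemma prod_two_slots: "(\<Prod>s<2 * m. f s) = (\<Prod>i<m. f i) * (\<Prod>i<m. f (m + i :: nat) :: 'a :: comm_monoid_mult)"
proof -
  have "(\<Prod>s<2 * m. f s) = (\<Prod>s\<in>{0..<m}. f s) * (\<Prod>s\<in>{m..<2 * m}. f s)"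
    by (simp add: lessThan_atLeast0 prod.atLeastLessThan_concat)
  also have "(\<Prod>s\<in>{m..<2 * m}. f s) = (\<Prod>i\<in>{0..<m}. f (i + m))"
    using prod.shift_bounds_nat_ivl[of f 0 m m] by (simp add: mult_2)
  finally show ?thesis by (simp add: lessThan_atLeast0 add.commute)
qed

lemma kp_slot_fac:
  assumes "a < prd n m" "b < prd n m"
  shows "kronecker_prod m (slot_fac n m z) $$ (a, b) = (\<Prod>i<m. z i (digit n m a i)) * (\<Prod>i<m. z (m + i) (digit n m b i))"
    and "kronecker_prod m (slot_fac n m z) $$ (a, b) = (\<Prod>s<2 * m. z s (slot_digit n m a b s))"
proof -
  show 1: "kronecker_prod m (slot_fac n m z) $$ (a, b) = (\<Prod>i<m. z i (digit n m a i)) * (\<Prod>i<m. z (m + i) (digit n m b i))"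
    unfolding kp_index[OF carr_slot_fac assms] prod.distrib[symmetric]
    using digit_less[OF assms(1)] digit_less[OF assms(2)] by (intro prod.cong) (auto simp: slot_fac_def)
  show "kronecker_prod m (slot_fac n m z) $$ (a, b) = (\<Prod>s<2 * m. z s (slot_digit n m a b s))"
    unfolding 1 prod_two_slots by (simp add: slot_digit_def)
qed

text \<open>Extension by zero lets the image count as rank one over all pairs of natural
  numbers.\<close>

definition slot_img :: "(nat \<Rightarrow> nat) \<Rightarrow> nat \<Rightarrow> (complex mat \<Rightarrow> complex mat) \<Rightarrow> (nat \<Rightarrow> nat \<Rightarrow> complex) \<Rightarrow> cfun2" where
  "slot_img n m \<phi> z = (\<lambda>a b. if a < prd n m \<and> b < prd n m then \<phi> (kronecker_prod m (slot_fac n m z)) $$ (a, b) else 0)"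

definition unit_slot :: "(nat \<Rightarrow> nat) \<Rightarrow> nat \<Rightarrow> nat \<Rightarrow> complex" where
  "unit_slot c s p = (if p = c s then 1 else 0)"

lemma slot_fac_cong:
  assumes "\<And>s. s < 2 * m \<Longrightarrow> z s = z' s"
  shows "kronecker_prod m (slot_fac n m z) = kronecker_prod m (slot_fac n m z')"
  by (rule kp_eqI[of m n]) (auto simp: carr_slot_fac slot_fac_def assms)

text \<open>Each entry of the product is a product over the slots in which slot s occurs exactly
  once.\<close>

lemma slot_img_lin:
  assumes \<phi>: "preserver m n k \<phi>" and s: "s < 2 * m"
  shows "slot_img n m \<phi> (z(s := \<lambda>p. w p + t * w' p))
    = (\<lambda>a b. slot_img n m \<phi> (z(s := w)) a b + t * slot_img n m \<phi> (z(s := w')) a b)"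
proof -
  let ?K = "\<lambda>z. kronecker_prod m (slot_fac n m z)"
  note c = kp_carrier[OF carr_slot_fac[of m n]]
  have upd_prod: "(\<Prod>l<2 * m. (z(s := f)) l (D l)) = f (D s) * (\<Prod>l\<in>{..<2 * m}-{s}. z l (D l))" for f :: "nat \<Rightarrow> complex" and D
    using s by (subst prod.remove[of _ s]) (auto intro!: prod.cong)
  have K: "?K (z(s := \<lambda>p. w p + t * w' p)) = ?K (z(s := w)) + t \<cdot>\<^sub>m ?K (z(s := w'))"
  proof (intro eq_matI)
    fix a b assume "a < dim_row (?K (z(s := w)) + t \<cdot>\<^sub>m ?K (z(s := w')))" "b < dim_col (?K (z(s := w)) + t \<cdot>\<^sub>m ?K (z(s := w')))"
    hence ab: "a < prd n m" "b < prd n m" using carrier_matD[OF c] by auto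
    show "?K (z(s := \<lambda>p. w p + t * w' p)) $$ (a, b) = (?K (z(s := w)) + t \<cdot>\<^sub>m ?K (z(s := w'))) $$ (a, b)"
      using ab carrier_matD[OF c] by (simp add: kp_slot_fac(2)[OF ab] upd_prod del: fun_upd_apply) (simp add: algebra_simps)
  qed (use carrier_matD[OF c] in auto)
  have "\<phi> (?K (z(s := \<lambda>p. w p + t * w' p))) = \<phi> (?K (z(s := w))) + t \<cdot>\<^sub>m \<phi> (?K (z(s := w')))"
    unfolding K using preserverD(2)[OF \<phi> c smult_carrier_mat[OF c]] preserverD(3)[OF \<phi> c] by simp
  thus ?thesis unfolding slot_img_def using carrier_matD[OF preserverD(1)[OF \<phi> c]] by (auto simp: fun_eq_iff simp del: fun_upd_apply)
qed

lemma slot_img_rank_one: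
  assumes \<phi>: "preserver m n k \<phi>" and k: "1 \<le> k" "k \<le> prd n m"
  shows "rank_one (slot_img n m \<phi> z)"
proof -
  have "rank1 (prd n m) (\<phi> (kronecker_prod m (slot_fac n m z)))"
    by (rule preserver_rank1[OF \<phi> k carr_slot_fac, where x = z and y = "\<lambda>i. z (m + i)"]) (simp add: slot_fac_def)
  then obtain u v where "\<forall>i<prd n m. \<forall>j<prd n m. \<phi> (kronecker_prod m (slot_fac n m z)) $$ (i, j) = u i * v j"
    unfolding rank1_def by blast
  hence "slot_img n m \<phi> z = outer (\<lambda>i. if i < prd n m then u i else 0) (\<lambda>j. if j < prd n m then v j else 0)"
    by (auto simp: slot_img_def outer_def fun_eq_iff)
  thus ?thesis unfolding rank_one_def by blast
qed

text \<open>Squared Frobenius norm. On rank one matrices it is the square of every Ky Fan norm, and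
  unlike these it obeys the parallelogram law in general.\<close>

definition fro_sq :: "nat \<Rightarrow> cfun2 \<Rightarrow> real" where
  "fro_sq N F = (\<Sum>a<N. \<Sum>b<N. (cmod (F a b))\<^sup>2)"

lemma fro_sq_ky_fan:
  assumes X: "X \<in> carrier_mat N N" and k: "1 \<le> k" "k \<le> N" and r: "rank_one F"
    and F: "\<And>a b. a < N \<Longrightarrow> b < N \<Longrightarrow> F a b = X $$ (a, b)"
  shows "(ky_fan_norm k X)\<^sup>2 = fro_sq N F"
proof -
  obtain u v where uv: "F = outer u v" using r unfolding rank_one_def by blast
  have "ky_fan_norm k X = sqrt (\<Sum>i<N. (cmod (u i))\<^sup>2) * sqrt (\<Sum>i<N. (cmod (v i))\<^sup>2)"
    by (rule ky_fan_rank1[OF X k]) (simp add: F[symmetric] uv outer_def)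
  hence "(ky_fan_norm k X)\<^sup>2 = (\<Sum>i<N. (cmod (u i))\<^sup>2) * (\<Sum>i<N. (cmod (v i))\<^sup>2)"
    by (simp add: power_mult_distrib sum_nonneg)
  also have "\<dots> = fro_sq N F"
    unfolding fro_sq_def uv outer_def norm_mult power_mult_distrib by (rule sum_product)
  finally show ?thesis .
qed

text \<open>The form in which the norm hypothesis enters the multilinear argument; it yields
  nonvanishing, independence along edges and finally unitarity.\<close>

lemma slot_img_fro_sq:
  assumes \<phi>: "preserver m n k \<phi>" and k: "1 \<le> k" "k \<le> prd n m"
  shows "fro_sq (prd n m) (slot_img n m \<phi> z) = (\<Prod>s<2 * m. \<Sum>p<slot_dim n m s. (cmod (z s p))\<^sup>2)"
proof -
  let ?K = "kronecker_prod m (slot_fac n m z)"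
  note c = kp_carrier[OF carr_slot_fac[of m n z]]
  have s: "(\<Sum>a<prd n m. (cmod (\<Prod>i<m. f i (digit n m a i)))\<^sup>2) = (\<Prod>i<m. \<Sum>p<n i. (cmod (f i p))\<^sup>2)" for f :: "nat \<Rightarrow> nat \<Rightarrow> complex"
    unfolding prod_norm[symmetric] prod_power_distrib by (rule sum_prd_digits)
  have "fro_sq (prd n m) (slot_img n m \<phi> z) = (ky_fan_norm k (\<phi> ?K))\<^sup>2"
    by (rule fro_sq_ky_fan[symmetric, OF preserverD(1)[OF \<phi> c] k slot_img_rank_one[OF \<phi> k]]) (simp add: slot_img_def)
  also have "\<dots> = (ky_fan_norm k ?K)\<^sup>2" using preserverD(4)[OF \<phi> carr_slot_fac] by simp
  also have "\<dots> = fro_sq (prd n m) (outer (\<lambda>a. \<Prod>i<m. z i (digit n m a i)) (\<lambda>b. \<Prod>i<m. z (m + i) (digit n m b i)))"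
    by (rule fro_sq_ky_fan[OF c k]) (auto simp: rank_one_def outer_def kp_slot_fac(1))
  also have "\<dots> = (\<Sum>a<prd n m. (cmod (\<Prod>i<m. z i (digit n m a i)))\<^sup>2) * (\<Sum>b<prd n m. (cmod (\<Prod>i<m. z (m + i) (digit n m b i)))\<^sup>2)"
    unfolding fro_sq_def outer_def norm_mult power_mult_distrib by (rule sum_product[symmetric])
  also have "\<dots> = (\<Prod>i<m. \<Sum>p<n i. (cmod (z i p))\<^sup>2) * (\<Prod>i<m. \<Sum>p<n i. (cmod (z (m + i) p))\<^sup>2)"
    unfolding s[of z] s[of "\<lambda>i. z (m + i)"] ..
  also have "\<dots> = (\<Prod>s<2 * m. \<Sum>p<slot_dim n m s. (cmod (z s p))\<^sup>2)"
    unfolding prod_two_slots by (simp add: slot_dim_def)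
  finally show ?thesis .
qed

lemma fro_sq_zero: "\<not> nonzero F \<Longrightarrow> fro_sq N F = 0"
  by (simp add: nonzero_def fro_sq_def)

lemma slot_img_nonzero:
  assumes \<phi>: "preserver m n k \<phi>" and k: "1 \<le> k" "k \<le> prd n m"
    and z: "\<And>s. s < 2 * m \<Longrightarrow> \<exists>p<slot_dim n m s. z s p \<noteq> 0"
  shows "nonzero (slot_img n m \<phi> z)"
proof (rule ccontr)
  assume "\<not> nonzero (slot_img n m \<phi> z)"
  hence "(\<Prod>s<2 * m. \<Sum>p<slot_dim n m s. (cmod (z s p))\<^sup>2) = 0"
    using fro_sq_zero slot_img_fro_sq[OF \<phi> k] by metis
  then obtain s where s: "s < 2 * m" "(\<Sum>p<slot_dim n m s. (cmod (z s p))\<^sup>2) = 0" by auto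
  from s(2) have "\<forall>p<slot_dim n m s. z s p = 0" by (subst (asm) sum_nonneg_eq_0_iff) auto
  thus False using z[OF s(1)] by blast
qed

lemma unit_slot_upd: "unit_slot (c(s := q)) = (unit_slot c)(s := \<lambda>p. if p = q then 1 else 0)"
  by (auto simp: unit_slot_def fun_eq_iff)

lemma unit_slot_upd_self: "(unit_slot c)(s := \<lambda>p. if p = c s then 1 else 0) = unit_slot c"
  by (auto simp: unit_slot_def fun_eq_iff)

lemma slot_img_edge:
  assumes \<phi>: "preserver m n k \<phi>" and s: "s < 2 * m"
  shows "slot_img n m \<phi> ((unit_slot c)(s := \<lambda>p. (if p = c s then 1 else 0) + t * (if p = q then 1 else 0)))
    = (\<lambda>a b. slot_img n m \<phi> (unit_slot c) a b + t * slot_img n m \<phi> (unit_slot (c(s := q))) a b)"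
  unfolding slot_img_lin[OF \<phi> s] unit_slot_upd unit_slot_upd_self ..

lemma preserver_family:
  assumes \<phi>: "preserver m n k \<phi>" and k: "1 \<le> k" "k \<le> prd n m"
  shows "rank_one_family (2 * m) (slot_dim n m) (\<lambda>c. slot_img n m \<phi> (unit_slot c))"
proof
  have p0: "0 < prd n m" using k by linarith
  fix c :: "nat \<Rightarrow> nat" and s q l p and t :: complex
  show "slot_img n m \<phi> (unit_slot c) = slot_img n m \<phi> (unit_slot c')" if "\<And>s. s < 2 * m \<Longrightarrow> c s = c' s" for c'
  proof -
    have "unit_slot c s = unit_slot c' s" if "s < 2 * m" for s
      using \<open>\<And>s. s < 2 * m \<Longrightarrow> c s = c' s\<close>[OF that] by (simp add: unit_slot_def fun_eq_iff)
    from slot_fac_cong[of m "unit_slot c" "unit_slot c'" n, OF this] show ?thesis unfolding slot_img_def by (simp only:)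
  qed
  show "0 < slot_dim n m s" if "s < 2 * m"
    using prd_pos[OF p0] that by (auto simp: slot_dim_def)
  show "rank_one (slot_img n m \<phi> (unit_slot c))" by (rule slot_img_rank_one[OF \<phi> k])
  assume c: "\<And>s. s < 2 * m \<Longrightarrow> c s < slot_dim n m s"
  show "nonzero (slot_img n m \<phi> (unit_slot c))"
    by (rule slot_img_nonzero[OF \<phi> k]) (use c in \<open>auto simp: unit_slot_def\<close>)
  assume s: "s < 2 * m" and q: "q < slot_dim n m s" "q \<noteq> c s"
  show "rank_one (\<lambda>a b. slot_img n m \<phi> (unit_slot c) a b + slot_img n m \<phi> (unit_slot (c(s := q))) a b)"
  proof -
    have "rank_one (\<lambda>a b. slot_img n m \<phi> (unit_slot c) a b + 1 * slot_img n m \<phi> (unit_slot (c(s := q))) a b)"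
      unfolding slot_img_edge[OF \<phi> s, symmetric] by (rule slot_img_rank_one[OF \<phi> k])
    thus ?thesis by simp
  qed
  have "nonzero (slot_img n m \<phi> ((unit_slot c)(s := \<lambda>p. (if p = c s then 1 else 0) + t * (if p = q then 1 else 0))))"
  proof (rule slot_img_nonzero[OF \<phi> k])
    fix l assume l: "l < 2 * m"
    show "\<exists>p<slot_dim n m l. ((unit_slot c)(s := \<lambda>p. (if p = c s then 1 else 0) + t * (if p = q then 1 else 0))) l p \<noteq> 0"
      using c[OF l] q by (intro exI[of _ "c l"]) (auto simp: unit_slot_def)
  qed
  thus "nonzero (\<lambda>a b. slot_img n m \<phi> (unit_slot c) a b + t * slot_img n m \<phi> (unit_slot (c(s := q))) a b)"
    unfolding slot_img_edge[OF \<phi> s] .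
  assume l: "l < 2 * m" "p < slot_dim n m l" "p \<noteq> c l" "l \<noteq> s"
  \<comment> \<open>The sum of the four corners is the image of a single decomposable tensor, with a
    sum of two basis vectors in each of the slots s and l.\<close>
  let ?w = "\<lambda>x. (if x = c s then 1 else 0) + 1 * (if x = q then 1 else 0 :: complex)"
  let ?y = "\<lambda>x. (if x = c l then 1 else 0) + 1 * (if x = p then 1 else 0 :: complex)"
  have a1: "((unit_slot c)(s := ?w))(l := \<lambda>x. if x = c l then 1 else 0) = (unit_slot c)(s := ?w)"
    using l(4) by (auto simp: unit_slot_def fun_eq_iff)
  have a2: "((unit_slot c)(s := ?w))(l := \<lambda>x. if x = p then 1 else 0) = (unit_slot (c(l := p)))(s := \<lambda>x. (if x = (c(l := p)) s then 1 else 0) + 1 * (if x = q then 1 else 0))"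
    using l(4) by (auto simp: unit_slot_def fun_eq_iff)
  have "slot_img n m \<phi> (((unit_slot c)(s := ?w))(l := ?y))
     = (\<lambda>a b. (slot_img n m \<phi> (unit_slot c) a b + 1 * slot_img n m \<phi> (unit_slot (c(s := q))) a b)
        + 1 * (slot_img n m \<phi> (unit_slot (c(l := p))) a b + 1 * slot_img n m \<phi> (unit_slot (c(l := p, s := q))) a b))"
    unfolding slot_img_lin[OF \<phi> l(1)] a1 a2 slot_img_edge[OF \<phi> s] ..
  moreover have "rank_one (slot_img n m \<phi> (((unit_slot c)(s := ?w))(l := ?y)))" by (rule slot_img_rank_one[OF \<phi> k])
  ultimately show "rank_one (\<lambda>a b. slot_img n m \<phi> (unit_slot c) a b + slot_img n m \<phi> (unit_slot (c(s := q))) a b +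
        slot_img n m \<phi> (unit_slot (c(l := p))) a b + slot_img n m \<phi> (unit_slot (c(l := p, s := q))) a b)"
    by (simp add: add.assoc)
qed

lemma kp_unit_slot:
  assumes ab: "a < prd n m" "b < prd n m" and xy: "x < prd n m" "y < prd n m"
  shows "kronecker_prod m (slot_fac n m (unit_slot (slot_digit n m a b))) $$ (x, y) = (if x = a \<and> y = b then 1 else 0)"
proof -
  have "kronecker_prod m (slot_fac n m (unit_slot (slot_digit n m a b))) $$ (x, y)
     = (\<Prod>i<m. if digit n m x i = digit n m a i then 1 else 0) * (\<Prod>i<m. if digit n m y i = digit n m b i then 1 else 0)"
    unfolding kp_slot_fac(1)[OF xy] by (simp add: unit_slot_def slot_digit_def)
  also have "\<dots> = (if x = a then 1 else 0) * (if y = b then 1 else 0)"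
    unfolding prod_indicator using digit_eq_iff[OF xy(1) ab(1)] digit_eq_iff[OF xy(2) ab(2)] by simp
  finally show ?thesis by simp
qed

text \<open>The column and the row slot of a factor of size at least 2 have opposite types: otherwise the images of
  \<open>E\<^sub>0\<^sub>0 \<plusminus> E\<^sub>1\<^sub>1\<close> in that factor would have rank one, so that by the parallelogram law their norm would be
  \<open>\<surd>2\<close> rather than \<open>min k 2\<close>.\<close>

lemma opposite_types:
  assumes \<phi>: "preserver m n k \<phi>" and k: "1 \<le> k" "k \<le> prd n m" and i: "i < m" and ni: "2 \<le> n i"
    and ty: "rank_one_family.typing (2 * m) (slot_dim n m) (\<lambda>c. slot_img n m \<phi> (unit_slot c)) \<tau>"
  shows "\<tau> i \<noteq> \<tau> (m + i)"
proof
  assume same: "\<tau> i = \<tau> (m + i)"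
  define N where "N = prd n m"
  interpret rank_one_family "2 * m" "slot_dim n m" "\<lambda>c. slot_img n m \<phi> (unit_slot c)" by (rule preserver_family[OF \<phi> k])
  let ?M = "\<lambda>c. slot_img n m \<phi> (unit_slot c)"
  have p0: "0 < prd n m" using k by linarith
  have npos: "0 < n l" if "l < m" for l by (rule prd_pos[OF p0 that])
  obtain u v where uv: "\<And>c. valid c \<Longrightarrow> ?M c = outer (u (\<lambda>s. if \<tau> s then c s else 0)) (v (\<lambda>s. if \<tau> s then 0 else c s))"
    using factorisation[OF ty] by blast
  define z where "z = (\<lambda>_ :: nat. 0 :: nat)"
  define c where "c = z(i := 1, m + i := 1)"
  have vz: "valid z" using d_pos by (auto simp: valid_def z_def)
  have vc: "valid c" unfolding c_def using i ni by (intro valid_upd vz) (auto simp: slot_dim_def)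
  \<comment> \<open>Both slots move the same factor of the image, so the other factor is common to
    both terms.\<close>
  have r1s: "rank_one (\<lambda>a b. ?M z a b + t * ?M c a b)" for t
  proof (cases "\<tau> i")
    case True
    have "(\<lambda>s. if \<tau> s then 0 else c s) = (\<lambda>s. if \<tau> s then 0 else z s)" using True same by (auto simp: c_def z_def fun_eq_iff)
    thus ?thesis unfolding uv[OF vz] uv[OF vc] rank_one_def outer_def
      by (intro exI[of _ "\<lambda>a. u (\<lambda>s. if \<tau> s then z s else 0) a + t * u (\<lambda>s. if \<tau> s then c s else 0) a"]
           exI[of _ "v (\<lambda>s. if \<tau> s then 0 else z s)"]) (simp add: algebra_simps)
  next
    case False
    have "(\<lambda>s. if \<tau> s then c s else 0) = (\<lambda>s. if \<tau> s then z s else 0)" using False same by (auto simp: c_def z_def fun_eq_iff)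
    thus ?thesis unfolding uv[OF vz] uv[OF vc] rank_one_def outer_def
      by (intro exI[of _ "u (\<lambda>s. if \<tau> s then z s else 0)"]
           exI[of _ "\<lambda>b. v (\<lambda>s. if \<tau> s then 0 else z s) b + t * v (\<lambda>s. if \<tau> s then 0 else c s) b"]) (simp add: algebra_simps)
  qed
  \<comment> \<open>The index whose only nonzero digit is a 1 in position i: the diagonal unit at q
    is E_11 in factor i and E_00 in all others.\<close>
  define q where "q = of_digits n m (\<lambda>l. if l = i then 1 else 0)"
  have cdig: "(if l = i then 1 else 0) < n l" if "l < m" for l using npos[OF that] ni by auto
  have qN: "q < N" unfolding q_def N_def by (rule of_digits_less) (rule cdig)
  have dgq: "digit n m q l = (if l = i then 1 else 0)" if "l < m" for l
    unfolding q_def by (rule digit_of_digits) (use cdig that in auto)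
  have q0: "q \<noteq> 0" using dgq[OF i] digit_zero[OF i, of n] by (metis zero_neq_one)
  hence N2: "1 < N" using qN by simp
  have us: "kronecker_prod m (slot_fac n m (unit_slot (slot_digit n m a a))) = diagm N (\<lambda>b. if b = a then 1 else 0)" if a: "a < N" for a
    using carrier_matD[OF kp_carrier[OF carr_slot_fac[of m n]]] a
    by (intro eq_matI) (auto simp: N_def kp_unit_slot)
  have Mz: "?M z = ?M (slot_digit n m 0 0)" by (rule M_cong) (auto simp: z_def slot_digit_def digit_zero)
  have Mc: "?M c = ?M (slot_digit n m q q)" using i by (intro M_cong) (auto simp: c_def z_def slot_digit_def dgq)
  have fro1: "fro_sq N (?M c') = 1" if "valid c'" for c'
  proof -
    have "(\<Sum>p<slot_dim n m s. (cmod (unit_slot c' s p))\<^sup>2) = 1" if "s < 2 * m" for s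
    proof -
      have "(\<Sum>p<slot_dim n m s. (cmod (unit_slot c' s p))\<^sup>2) = (\<Sum>p<slot_dim n m s. if p = c' s then 1 else 0)"
        by (intro sum.cong) (auto simp: unit_slot_def)
      thus ?thesis using \<open>valid c'\<close> that by (simp add: valid_def)
    qed
    thus ?thesis unfolding N_def slot_img_fro_sq[OF \<phi> k] by simp
  qed
  have frot: "fro_sq N (\<lambda>a b. ?M z a b + t * ?M c a b) = (min (real k) 2)\<^sup>2" if t: "cmod t = 1" for t
  proof -
    let ?D = "\<lambda>a. diagm N (\<lambda>b. if b = a then 1 else 0 :: complex)"
    let ?X = "diagm N (\<lambda>b. if b = 0 then 1 else if b = q then t else 0)"
    have X: "?X = ?D 0 + t \<cdot>\<^sub>m ?D q" using q0 by (intro eq_matI) auto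
    have Dc: "?D a \<in> carrier_mat (prd n m) (prd n m)" for a by (simp add: N_def)
    have \<phi>X: "\<phi> ?X = \<phi> (?D 0) + t \<cdot>\<^sub>m \<phi> (?D q)" unfolding X
      using preserverD(2)[OF \<phi> Dc smult_carrier_mat[OF Dc]] preserverD(3)[OF \<phi> Dc] by simp
    have "(ky_fan_norm k (\<phi> ?X))\<^sup>2 = fro_sq N (\<lambda>a b. ?M z a b + t * ?M c a b)"
    proof (rule fro_sq_ky_fan[OF _ k(1) _ r1s])
      show "\<phi> ?X \<in> carrier_mat N N" using preserverD(1)[OF \<phi>, of ?X] by (simp add: N_def)
      show "k \<le> N" using k by (simp add: N_def)
      fix a b assume "a < N" "b < N"
      thus "?M z a b + t * ?M c a b = \<phi> ?X $$ (a, b)"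
        unfolding Mz Mc unfolding \<phi>X slot_img_def us[OF qN] us[OF p0[folded N_def]]
        using carrier_matD[OF preserverD(1)[OF \<phi> Dc]] by (simp add: N_def)
    qed
    moreover have "ky_fan_norm k (\<phi> ?X) = ky_fan_norm k ?X"
    proof -
      \<comment> \<open>The diagonal matrix is itself a Kronecker product, with diag(1, t, 0, ...)
        in factor i and the first diagonal unit elsewhere, so its norm is preserved.\<close>
      define f where "f l p = (if l = i then (if p = 0 then 1 else if p = 1 then t else 0) else (if p = 0 then 1 else 0))" for l p :: nat
      have "(\<Prod>l<m. f l (digit n m b l)) = (if b = 0 then 1 else if b = q then t else 0)" if b: "b < N" for b
      proof -
        have "(\<Prod>l<m. f l (digit n m b l)) = f i (digit n m b i) * (\<Prod>l\<in>{..<m}-{i}. f l (digit n m b l))"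
          using i by (subst prod.remove[of _ i]) auto
        also have "(\<Prod>l\<in>{..<m}-{i}. f l (digit n m b l)) = (if \<forall>l\<in>{..<m}-{i}. digit n m b l = 0 then 1 else 0)"
        proof (cases "\<forall>l\<in>{..<m}-{i}. digit n m b l = 0")
          case True
          thus ?thesis by (simp add: f_def)
        next
          case False
          then obtain l where l: "l \<in> {..<m}-{i}" "digit n m b l \<noteq> 0" by blast
          hence "f l (digit n m b l) = 0" by (simp add: f_def)
          hence "(\<Prod>l\<in>{..<m}-{i}. f l (digit n m b l)) = 0" using l(1) by (intro prod_zero) auto
          thus ?thesis unfolding if_not_P[OF False] .
        qed
        finally have e: "(\<Prod>l<m. f l (digit n m b l)) = f i (digit n m b i) * (if \<forall>l\<in>{..<m}-{i}. digit n m b l = 0 then 1 else 0)" .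
        have b0: "b = 0 \<longleftrightarrow> (\<forall>l<m. digit n m b l = 0)" using digit_eq_iff[OF b[unfolded N_def] p0] by (auto simp: digit_zero)
        have bq: "b = q \<longleftrightarrow> (\<forall>l<m. digit n m b l = (if l = i then 1 else 0))"
          using digit_eq_iff[OF b[unfolded N_def] qN[unfolded N_def]] by (auto simp: dgq)
        show ?thesis
        proof (cases "\<forall>l\<in>{..<m}-{i}. digit n m b l = 0")
          case True
          have "b = 0 \<longleftrightarrow> digit n m b i = 0" "b = q \<longleftrightarrow> digit n m b i = 1" using b0 bq True i by auto
          thus ?thesis unfolding e using True by (simp add: f_def)
        next
          case False
          hence "b \<noteq> 0" "b \<noteq> q" using b0 bq by auto
          moreover have "(if \<forall>l\<in>{..<m}-{i}. digit n m b l = 0 then 1 else 0 :: complex) = 0" using False by (rule if_not_P)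
          ultimately show ?thesis unfolding e by simp
        qed
      qed
      hence "kronecker_prod m (\<lambda>l. diagm (n l) (f l)) = ?X"
        unfolding kp_diagm N_def by (intro diagm_cong) auto
      moreover have "carr m n (\<lambda>l. diagm (n l) (f l))" by (simp add: carr_def)
      ultimately show ?thesis using preserverD(4)[OF \<phi>] by metis
    qed
    moreover have "ky_fan_norm k ?X = min (real k) 2"
    proof -
      define g where "g b = (if b = 0 then 1 else if b = 1 then t else 0)" for b :: nat
      have "?X = diagm N (\<lambda>b. g (transpose 1 q b))" using q0 by (intro diagm_cong) (auto simp: g_def transpose_def)
      hence "ky_fan_norm k ?X = ky_fan_norm k (diagm N g)" using ky_fan_diagm_transpose[OF N2 qN, of k g] by simp
      also have "\<dots> = (\<Sum>b<k. cmod (g b))"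
        by (rule ky_fan_diagm) (use k t in \<open>auto simp: g_def N_def\<close>)
      also have "\<dots> = (\<Sum>b<k. if b < 2 then 1 else 0)" using t by (intro sum.cong) (auto simp: g_def)
      also have "\<dots> = (\<Sum>b<min k 2. 1)" by (intro sum.mono_neutral_cong_right) auto
      finally show ?thesis by simp
    qed
    ultimately show ?thesis by simp
  qed
  have "fro_sq N (\<lambda>a b. ?M z a b + 1 * ?M c a b) + fro_sq N (\<lambda>a b. ?M z a b + (- 1) * ?M c a b) = 2 * fro_sq N (?M z) + 2 * fro_sq N (?M c)"
  proof -
    have "(cmod (x + 1 * y))\<^sup>2 + (cmod (x + (- 1) * y))\<^sup>2 = 2 * (cmod x)\<^sup>2 + 2 * (cmod y)\<^sup>2" for x y :: complex
      by (simp add: cmod_power2) (simp add: power2_eq_square algebra_simps)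
    thus ?thesis unfolding fro_sq_def by (simp only: sum.distrib[symmetric] sum_distrib_left)
  qed
  \<comment> \<open>The parallelogram law turns the two values into 2 (min k 2)^2 = 4, but (min k
    2)^2 is 1 or 4.\<close>
  hence "(min (real k) 2)\<^sup>2 = 2" using frot[of 1] frot[of "-1"] fro1[OF vz] fro1[OF vc] by simp
  moreover have "min (real k) 2 = (if k = 1 then 1 else 2)" using k(1) by auto
  ultimately show False by (auto split: if_splits)
qed

text \<open>Index form of a partial transposition: the pair (a, b) goes to
  (\<open>colix n m \<tau> a b\<close>, \<open>colix n m \<tau> b a\<close>), with the digits of row
  and column exchanged in the transposed factors. The first component collects the digits on which
  the column factor of the image depends.\<close>

definition colix :: "(nat \<Rightarrow> nat) \<Rightarrow> nat \<Rightarrow> (nat \<Rightarrow> bool) \<Rightarrow> nat \<Rightarrow> nat \<Rightarrow> nat" where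
  "colix n m \<tau> a b = of_digits n m (\<lambda>i. if \<tau> i then digit n m a i else digit n m b i)"

lemma colix:
  assumes "a < prd n m" "b < prd n m"
  shows "colix n m \<tau> a b < prd n m" "i < m \<Longrightarrow> digit n m (colix n m \<tau> a b) i = (if \<tau> i then digit n m a i else digit n m b i)"
  unfolding colix_def using digit_less[OF assms(1)] digit_less[OF assms(2)] by (auto intro!: of_digits_less) (subst digit_of_digits; auto)+

lemma colix_colix:
  assumes "a < prd n m" "b < prd n m"
  shows "colix n m \<tau> (colix n m \<tau> a b) (colix n m \<tau> b a) = a"
proof -
  note ab = colix(1)[OF assms, of \<tau>] and ba = colix(1)[OF assms(2,1), of \<tau>]
  have "\<forall>i<m. digit n m (colix n m \<tau> (colix n m \<tau> a b) (colix n m \<tau> b a)) i = digit n m a i"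
    by (auto simp: colix(2)[OF ab ba] colix(2)[OF assms] colix(2)[OF assms(2,1)])
  thus ?thesis using digit_eq_iff[OF colix(1)[OF ab ba] assms(1)] by blast
qed

text \<open>Partial transposition of index pairs is an involution, hence permutes the terms.\<close>

lemma sum_colix:
  "(\<Sum>(a, b)\<in>{..<prd n m} \<times> {..<prd n m}. F (colix n m \<tau> a b) (colix n m \<tau> b a))
    = (\<Sum>(a, b)\<in>{..<prd n m} \<times> {..<prd n m}. F a b)"
  by (rule sum.reindex_bij_witness[of _ "\<lambda>(a, b). (colix n m \<tau> a b, colix n m \<tau> b a)" "\<lambda>(a, b). (colix n m \<tau> a b, colix n m \<tau> b a)"])
     (auto simp: colix_colix colix(1))

definition part_transpose :: "(nat \<Rightarrow> bool) \<Rightarrow> nat \<Rightarrow> complex mat \<Rightarrow> complex mat" where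
  "part_transpose \<tau> i = (if \<tau> i then (\<lambda>X. X) else transpose_mat)"

lemma carr_part_transpose: "carr m n A \<Longrightarrow> carr m n (\<lambda>i. part_transpose \<tau> i (A i))"
  by (auto simp: carr_def part_transpose_def)

lemma kp_part_transpose:
  assumes A: "carr m n A" and ab: "a < prd n m" "b < prd n m"
  shows "kronecker_prod m (\<lambda>i. part_transpose \<tau> i (A i)) $$ (colix n m \<tau> a b, colix n m \<tau> b a) = kronecker_prod m A $$ (a, b)"
  unfolding kp_index[OF A ab] kp_index[OF carr_part_transpose[OF A] colix(1)[OF ab] colix(1)[OF ab(2,1)]]
proof (rule prod.cong[OF refl])
  fix i assume "i \<in> {..<m}"
  hence i: "i < m" by simp
  show "part_transpose \<tau> i (A i) $$ (digit n m (colix n m \<tau> a b) i, digit n m (colix n m \<tau> b a) i) = A i $$ (digit n m a i, digit n m b i)"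
    using digit_less[OF ab(1) i] digit_less[OF ab(2) i] carrier_matD[OF carrD[OF A i]]
    by (simp add: colix(2)[OF ab i] colix(2)[OF ab(2,1) i] part_transpose_def)
qed

text \<open>After partial transposition the map is X goes to Y X Z, where the vectors
  \<open>p a\<close> are the columns of Y and the vectors \<open>q b\<close> the rows of Z.\<close>

lemma preserver_form:
  assumes \<phi>: "preserver m n k \<phi>" and k: "1 \<le> k" "k \<le> prd n m"
  shows "\<exists>\<tau> p q. \<forall>A. carr m n A \<longrightarrow> (\<forall>r<prd n m. \<forall>s<prd n m. \<phi> (kronecker_prod m A) $$ (r, s)
     = (\<Sum>(a, b)\<in>{..<prd n m} \<times> {..<prd n m}. kronecker_prod m (\<lambda>i. part_transpose \<tau> i (A i)) $$ (a, b) * (p a r * q b s)))"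
proof -
  interpret rank_one_family "2 * m" "slot_dim n m" "\<lambda>c. slot_img n m \<phi> (unit_slot c)" by (rule preserver_family[OF \<phi> k])
  let ?M = "\<lambda>c. slot_img n m \<phi> (unit_slot c)"
  obtain \<tau>0 where ty0: "typing \<tau>0" using typing_exists by blast
  \<comment> \<open>In a slot of dimension one any type is allowed. Column slots receive True and
    row slots False, so that the two slots of every factor have opposite types.\<close>
  define \<tau> where "\<tau> s = (if 2 \<le> slot_dim n m s then \<tau>0 s else s < m)" for s
  have ty: "typing \<tau>" unfolding typing_def
  proof (intro allI impI)
    fix c s q assume e: "edge c s q"
    hence "q < slot_dim n m s" "c s < slot_dim n m s" "q \<noteq> c s" by (auto simp: edge_def valid_def)
    hence "\<tau> s = \<tau>0 s" by (simp add: \<tau>_def)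
    thus "if \<tau> s then same_row (?M c) (?M (c(s := q))) else same_col (?M c) (?M (c(s := q)))"
      using ty0 e unfolding typing_def by simp
  qed
  have opp: "\<tau> (m + i) \<longleftrightarrow> \<not> \<tau> i" if i: "i < m" for i
    using opposite_types[OF \<phi> k i _ ty0] i by (auto simp: \<tau>_def slot_dim_def)
  obtain u v where uv: "\<And>c. valid c \<Longrightarrow> ?M c = outer (u (\<lambda>s. if \<tau> s then c s else 0)) (v (\<lambda>s. if \<tau> s then 0 else c s))"
    using factorisation[OF ty] by blast
  \<comment> \<open>The digits of one index of M_N written into the selected slots. By opposite
    types, exactly one of the two slots of each factor is selected by the typing and the other by
    its negation.\<close>
  define lift where "lift P a = (\<lambda>s. if s < 2 * m \<and> P s then digit n m a (if s < m then s else s - m) else 0)" for P a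
  define p where "p a = u (lift \<tau> a)" for a
  define q where "q a = v (lift (\<lambda>s. \<not> \<tau> s) a)" for a
  have img: "?M (slot_digit n m a b) = outer (p (colix n m \<tau> a b)) (q (colix n m \<tau> b a))" if ab: "a < prd n m" "b < prd n m" for a b
  proof -
    have val: "valid (slot_digit n m a b)"
      using digit_less[OF ab(1)] digit_less[OF ab(2)] by (auto simp: valid_def slot_digit_def slot_dim_def)
    have o: "\<tau> s \<longleftrightarrow> \<not> \<tau> (s - m)" if "m \<le> s" "s < 2 * m" for s using opp[of "s - m"] that by auto
    have "(\<lambda>s. if \<tau> s then slot_digit n m a b s else 0) = lift \<tau> (colix n m \<tau> a b)"
    proof
      fix s
      consider "s < m" | "m \<le> s" "s < 2 * m" | "2 * m \<le> s" by linarith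
      thus "(if \<tau> s then slot_digit n m a b s else 0) = lift \<tau> (colix n m \<tau> a b) s"
        by cases (use o[of s] in \<open>auto simp: lift_def slot_digit_def colix(2)[OF ab]\<close>)
    qed
    moreover have "(\<lambda>s. if \<tau> s then 0 else slot_digit n m a b s) = lift (\<lambda>s. \<not> \<tau> s) (colix n m \<tau> b a)"
    proof
      fix s
      consider "s < m" | "m \<le> s" "s < 2 * m" | "2 * m \<le> s" by linarith
      thus "(if \<tau> s then 0 else slot_digit n m a b s) = lift (\<lambda>s. \<not> \<tau> s) (colix n m \<tau> b a) s"
        by cases (use o[of s] in \<open>auto simp: lift_def slot_digit_def colix(2)[OF ab(2,1)]\<close>)
    qed
    ultimately show ?thesis unfolding uv[OF val] p_def q_def by simp
  qed
  have "\<phi> (kronecker_prod m A) $$ (r, s) = (\<Sum>(a, b)\<in>{..<prd n m} \<times> {..<prd n m}. kronecker_prod m (\<lambda>i. part_transpose \<tau> i (A i)) $$ (a, b) * (p a r * q b s))"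
    if A: "carr m n A" and rs: "r < prd n m" "s < prd n m" for A r s
  proof -
    let ?I = "{..<prd n m} \<times> {..<prd n m}"
    define E where "E t = kronecker_prod m (slot_fac n m (unit_slot (slot_digit n m (fst t) (snd t))))" for t
    have Ec: "E t \<in> carrier_mat (prd n m) (prd n m)" for t unfolding E_def by (rule kp_carrier[OF carr_slot_fac])
    \<comment> \<open>Expansion in matrix units, whose images have known factors.\<close>
    have "kronecker_prod m A = mat (prd n m) (prd n m) (\<lambda>x. \<Sum>t\<in>?I. kronecker_prod m A $$ t * E t $$ x)"
    proof (intro eq_matI)
      fix x y assume "x < dim_row (mat (prd n m) (prd n m) (\<lambda>x. \<Sum>t\<in>?I. kronecker_prod m A $$ t * E t $$ x))"
        "y < dim_col (mat (prd n m) (prd n m) (\<lambda>x. \<Sum>t\<in>?I. kronecker_prod m A $$ t * E t $$ x))"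
      hence xy: "x < prd n m" "y < prd n m" by auto
      have "(\<Sum>t\<in>?I. kronecker_prod m A $$ t * E t $$ (x, y)) = (\<Sum>t\<in>?I. if t = (x, y) then kronecker_prod m A $$ (x, y) else 0)"
        using xy by (intro sum.cong) (auto simp: E_def kp_unit_slot split: if_splits)
      also have "\<dots> = kronecker_prod m A $$ (x, y)" using xy by (subst sum.delta) auto
      finally show "kronecker_prod m A $$ (x, y) = mat (prd n m) (prd n m) (\<lambda>x. \<Sum>t\<in>?I. kronecker_prod m A $$ t * E t $$ x) $$ (x, y)"
        using xy by simp
    qed (use carrier_matD[OF kp_carrier[OF A]] in auto)
    hence "\<phi> (kronecker_prod m A) $$ (r, s) = \<phi> (mat (prd n m) (prd n m) (\<lambda>x. \<Sum>t\<in>?I. kronecker_prod m A $$ t * E t $$ x)) $$ (r, s)"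
      by (rule arg_cong)
    also have "\<dots> = (\<Sum>t\<in>?I. kronecker_prod m A $$ t * \<phi> (E t) $$ (r, s))"
      by (rule preserver_sum[OF \<phi> _ Ec rs]) simp
    also have "\<dots> = (\<Sum>(a, b)\<in>?I. kronecker_prod m (\<lambda>i. part_transpose \<tau> i (A i)) $$ (colix n m \<tau> a b, colix n m \<tau> b a)
        * (p (colix n m \<tau> a b) r * q (colix n m \<tau> b a) s))"
    proof (rule sum.cong[OF refl])
      fix t assume "t \<in> ?I"
      then obtain a b where t: "t = (a, b)" "a < prd n m" "b < prd n m" by auto
      have "\<phi> (E t) $$ (r, s) = ?M (slot_digit n m a b) r s" using rs by (simp add: slot_img_def E_def t)
      also have "\<dots> = p (colix n m \<tau> a b) r * q (colix n m \<tau> b a) s" unfolding img[OF t(2,3)] by (simp add: outer_def)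
      finally show "kronecker_prod m A $$ t * \<phi> (E t) $$ (r, s) = (case t of (a, b) \<Rightarrow> kronecker_prod m (\<lambda>i. part_transpose \<tau> i (A i)) $$ (colix n m \<tau> a b, colix n m \<tau> b a)
        * (p (colix n m \<tau> a b) r * q (colix n m \<tau> b a) s))"
        by (simp add: t kp_part_transpose[OF A])
    qed
    also have "\<dots> = (\<Sum>(a, b)\<in>?I. kronecker_prod m (\<lambda>i. part_transpose \<tau> i (A i)) $$ (a, b) * (p a r * q b s))"
      by (rule sum_colix)
    finally show ?thesis .
  qed
  note form = this
  show ?thesis by (rule exI[of _ \<tau>], rule exI[of _ p], rule exI[of _ q]) (use form in blast)
qed

section \<open>Unitarity of the two factors and the equivalence\<close>

lemma product_isometry_gram:
  assumes iso: "\<And>x. (\<Sum>r<prd n m. (cmod (\<Sum>a<prd n m. w a r * (\<Prod>i<m. x i (digit n m a i))))\<^sup>2) = g * (\<Prod>i<m. \<Sum>p<n i. (cmod (x i p))\<^sup>2)"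
    and ab: "a < prd n m" "b < prd n m"
  shows "(\<Sum>r<prd n m. cnj (w a r) * w b r) = (if a = b then of_real g else 0)"
proof -
  define N where "N = prd n m"
  \<comment> \<open>The Gram matrix of the vectors w a minus g times the identity. Its quadratic
    form vanishes on product vectors, which by polarisation is enough for it to vanish.\<close>
  define H where "H a b = (\<Sum>r<N. cnj (w a r) * w b r) - (if a = b then of_real g else 0)" for a b
  have "H a b = 0"
  proof (rule product_polarisation[OF _ ab])
    fix x :: "nat \<Rightarrow> nat \<Rightarrow> complex"
    define X where "X a = (\<Prod>i<m. x i (digit n m a i))" for a
    have nX: "(\<Prod>i<m. \<Sum>p<n i. (cmod (x i p))\<^sup>2) = (\<Sum>a<N. (cmod (X a))\<^sup>2)"
      unfolding X_def N_def prod_norm[symmetric] prod_power_distrib by (rule sum_prd_digits[symmetric])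
    have "(\<Sum>a<N. \<Sum>b<N. cnj (X a) * X b * H a b)
        = (\<Sum>a<N. \<Sum>b<N. \<Sum>r<N. cnj (w a r * X a) * (w b r * X b)) - (\<Sum>a<N. \<Sum>b<N. if b = a then of_real g * (cnj (X a) * X a) else 0)"
      unfolding H_def sum_subtractf[symmetric] right_diff_distrib sum_distrib_left
      by (intro sum.cong refl) (auto intro!: sum.cong simp: mult_ac)
    also have "(\<Sum>a<N. \<Sum>b<N. if b = a then of_real g * (cnj (X a) * X a) else 0) = of_real (g * (\<Sum>a<N. (cmod (X a))\<^sup>2))"
      by (simp add: sum_distrib_left complex_norm_square mult.commute del: of_real_power)
    also have "(\<Sum>a<N. \<Sum>b<N. \<Sum>r<N. cnj (w a r * X a) * (w b r * X b)) = (\<Sum>r<N. \<Sum>a<N. \<Sum>b<N. cnj (w a r * X a) * (w b r * X b))"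
      by (subst sum.swap[of _ "{..<N}" "{..<N}"], subst (2) sum.swap) (rule refl)
    also have "\<dots> = (\<Sum>r<N. cnj (\<Sum>a<N. w a r * X a) * (\<Sum>b<N. w b r * X b))"
      unfolding cnj_sum sum_product ..
    also have "\<dots> = of_real (\<Sum>r<N. (cmod (\<Sum>a<N. w a r * X a))\<^sup>2)"
      unfolding of_real_sum complex_norm_square by (simp add: mult.commute)
    finally show "(\<Sum>a<prd n m. \<Sum>b<prd n m. cnj (\<Prod>i<m. x i (digit n m a i)) * (\<Prod>i<m. x i (digit n m b i)) * H a b) = 0"
      using iso[of x] nX unfolding X_def N_def by simp
  qed
  thus ?thesis by (simp add: H_def N_def)
qed

lemma product_isometry_unitary:
  assumes iso: "\<And>x. (\<Sum>r<prd n m. (cmod (\<Sum>a<prd n m. w a r * (\<Prod>i<m. x i (digit n m a i))))\<^sup>2) = g * (\<Prod>i<m. \<Sum>p<n i. (cmod (x i p))\<^sup>2)"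
    and g: "g > 0"
  shows "unitary_mat (prd n m) (mat (prd n m) (prd n m) (\<lambda>(r, a). of_real (1 / sqrt g) * w a r))"
proof (rule unitary_matI)
  define t where "t = 1 / sqrt g"
  have t: "t * t * g = 1" using g by (simp add: t_def)
  let ?U = "mat (prd n m) (prd n m) (\<lambda>(r, a). of_real (1 / sqrt g) * w a r)"
  show "mat_adjoint ?U * ?U = 1\<^sub>m (prd n m)"
  proof (intro eq_matI)
    fix a b assume "a < dim_row (1\<^sub>m (prd n m) :: complex mat)" "b < dim_col (1\<^sub>m (prd n m) :: complex mat)"
    hence ab: "a < prd n m" "b < prd n m" by auto
    have "(mat_adjoint ?U * ?U) $$ (a, b) = (\<Sum>r<prd n m. mat_adjoint ?U $$ (a, r) * ?U $$ (r, b))"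
      using ab by (intro mult_mat_index[of _ "prd n m" "prd n m" _ "prd n m"]) auto
    also have "\<dots> = (\<Sum>r<prd n m. of_real (t * t) * (cnj (w a r) * w b r))"
      using ab by (intro sum.cong) (auto simp: t_def[symmetric] mult_ac)
    also have "\<dots> = of_real (t * t) * (if a = b then of_real g else 0)"
      unfolding sum_distrib_left[symmetric] product_isometry_gram[OF iso ab] ..
    also have "\<dots> = (if a = b then of_real (t * t * g) else 0)" by simp
    finally show "(mat_adjoint ?U * ?U) $$ (a, b) = 1\<^sub>m (prd n m) $$ (a, b)" using ab t by simp
  qed auto
qed simp

lemma preserver_structure:
  assumes \<phi>: "preserver m n k \<phi>" and k: "1 \<le> k" "k \<le> prd n m"
  shows "\<exists>U V \<psi>. unitary_mat (prd n m) U \<and> unitary_mat (prd n m) V \<and>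
    (\<forall>s<m. \<psi> s = (\<lambda>X. X) \<or> \<psi> s = transpose_mat) \<and>
    (\<forall>A. carr m n A \<longrightarrow> \<phi> (kronecker_prod m A) = U * kronecker_prod m (\<lambda>i. \<psi> i (A i)) * V)"
proof -
  define N where "N = prd n m"
  have p0: "0 < prd n m" using k by linarith
  obtain \<tau> p q where form: "\<And>A r s. \<lbrakk>carr m n A; r < N; s < N\<rbrakk> \<Longrightarrow> \<phi> (kronecker_prod m A) $$ (r, s)
     = (\<Sum>(a, b)\<in>{..<N} \<times> {..<N}. kronecker_prod m (\<lambda>i. part_transpose \<tau> i (A i)) $$ (a, b) * (p a r * q b s))"
    using preserver_form[OF \<phi> k] unfolding N_def by blast
  define X where "X x a = (\<Prod>i<m. x i (digit n m a i))" for x :: "nat \<Rightarrow> nat \<Rightarrow> complex" and a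
  define nr where "nr x = (\<Prod>i<m. \<Sum>p<n i. (cmod (x i p))\<^sup>2)" for x :: "nat \<Rightarrow> nat \<Rightarrow> complex"
  define gp where "gp x = (\<Sum>r<N. (cmod (\<Sum>a<N. p a r * X x a))\<^sup>2)" for x
  define gq where "gq y = (\<Sum>s<N. (cmod (\<Sum>b<N. q b s * X y b))\<^sup>2)" for y
  have gg: "gp x * gq y = nr x * nr y" for x y
  proof -
    \<comment> \<open>The two vectors of a transposed factor are put into exchanged slots, so that
      partial transposition turns factor i into x_i y_i^t.\<close>
    define z where "z s = (if s < m then (if \<tau> s then x s else y s) else (if \<tau> (s - m) then y (s - m) else x (s - m)))" for s
    have pz: "part_transpose \<tau> i (slot_fac n m z i) = mat (n i) (n i) (\<lambda>(a, b). x i a * y i b)" if "i < m" for i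
      using that by (intro eq_matI) (auto simp: part_transpose_def slot_fac_def z_def)
    have cz: "carr m n (slot_fac n m z)" by (rule carr_slot_fac)
    have kpz: "kronecker_prod m (\<lambda>i. part_transpose \<tau> i (slot_fac n m z i)) $$ (a, b) = X x a * X y b" if ab: "a < N" "b < N" for a b
    proof -
      note ab' = ab[unfolded N_def]
      have "kronecker_prod m (\<lambda>i. part_transpose \<tau> i (slot_fac n m z i)) $$ (a, b) = (\<Prod>i<m. x i (digit n m a i) * y i (digit n m b i))"
        unfolding kp_index[OF carr_part_transpose[OF cz] ab'] using digit_less[OF ab'(1)] digit_less[OF ab'(2)]
        by (intro prod.cong) (auto simp: pz)
      thus ?thesis by (simp add: X_def prod.distrib)
    qed
    have "\<phi> (kronecker_prod m (slot_fac n m z)) $$ (r, s) = (\<Sum>a<N. p a r * X x a) * (\<Sum>b<N. q b s * X y b)" if "r < N" "s < N" for r s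
    proof -
      have "\<phi> (kronecker_prod m (slot_fac n m z)) $$ (r, s) = (\<Sum>(a, b)\<in>{..<N} \<times> {..<N}. (p a r * X x a) * (q b s * X y b))"
        unfolding form[OF cz that] using kpz by (intro sum.cong) (auto simp: mult_ac)
      thus ?thesis unfolding sum_product sum.cartesian_product .
    qed
    hence "fro_sq N (slot_img n m \<phi> z) = (\<Sum>r<N. \<Sum>s<N. (cmod (\<Sum>a<N. p a r * X x a))\<^sup>2 * (cmod (\<Sum>b<N. q b s * X y b))\<^sup>2)"
      unfolding fro_sq_def by (intro sum.cong refl) (simp add: slot_img_def N_def norm_mult power_mult_distrib)
    also have "\<dots> = gp x * gq y" unfolding gp_def gq_def sum_product ..
    finally have "gp x * gq y = (\<Prod>s<2 * m. \<Sum>p<slot_dim n m s. (cmod (z s p))\<^sup>2)"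
      unfolding N_def slot_img_fro_sq[OF \<phi> k] by simp
    also have "\<dots> = nr x * nr y"
      unfolding prod_two_slots nr_def prod.distrib[symmetric] by (intro prod.cong) (auto simp: slot_dim_def z_def)
    finally show ?thesis .
  qed
  \<comment> \<open>A reference product vector of norm 1. Inserting it for x or y splits the product
    identity into two proportionalities.\<close>
  define e where "e = (\<lambda>(i :: nat) (j :: nat). if j = 0 then 1 else 0 :: complex)"
  have ne: "nr e = 1"
  proof -
    have "(\<Sum>j<n i. (cmod (e i j))\<^sup>2) = 1" if "i < m" for i
    proof -
      have "(\<Sum>j<n i. (cmod (e i j))\<^sup>2) = (\<Sum>j<n i. if j = 0 then 1 else 0)" by (intro sum.cong) (auto simp: e_def)
      thus ?thesis using prd_pos[OF p0 that] by simp
    qed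
    thus ?thesis by (simp add: nr_def)
  qed
  define g where "g = gp e"
  define h where "h = gq e"
  have gh: "g * h = 1" using gg[of e e] ne by (simp add: g_def h_def)
  have "g \<ge> 0" "h \<ge> 0" by (auto simp: g_def h_def gp_def gq_def intro!: sum_nonneg)
  hence pos: "g > 0" "h > 0" using gh by (metis less_eq_real_def mult_zero_left zero_neq_one, metis less_eq_real_def mult_zero_right zero_neq_one)
  have gpx: "gp x = g * nr x" for x
  proof -
    have "gp x * h = nr x" using gg[of x e] ne by (simp add: h_def)
    hence "gp x * (g * h) = g * nr x" by (simp add: mult_ac)
    thus ?thesis using gh by simp
  qed
  have gqx: "gq x = h * nr x" for x
  proof -
    have "g * gq x = nr x" using gg[of e x] ne by (simp add: g_def)
    hence "gq x * (g * h) = h * nr x" by (simp add: mult_ac)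
    thus ?thesis using gh by simp
  qed
  define U where "U = mat N N (\<lambda>(r, a). of_real (1 / sqrt g) * p a r)"
  define W where "W = mat N N (\<lambda>(r, a). of_real (1 / sqrt h) * q a r)"
  have U: "unitary_mat N U" unfolding U_def N_def
    by (rule product_isometry_unitary[OF _ pos(1)]) (use gpx in \<open>simp add: gp_def nr_def X_def N_def\<close>)
  have W: "unitary_mat N W" unfolding W_def N_def
    by (rule product_isometry_unitary[OF _ pos(2)]) (use gqx in \<open>simp add: gq_def nr_def X_def N_def\<close>)
  have V: "unitary_mat N (transpose_mat W)" by (rule unitary_transpose[OF W])
  \<comment> \<open>The reciprocal constants g and h let the two normalisations cancel, so no scalar
    remains beside U and V.\<close>
  have gh1: "1 / sqrt g * (1 / sqrt h) = 1" using gh by (simp flip: real_sqrt_mult)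
  have "\<phi> (kronecker_prod m A) = U * kronecker_prod m (\<lambda>i. part_transpose \<tau> i (A i)) * transpose_mat W" if A: "carr m n A" for A
  proof (intro eq_matI)
    let ?B = "kronecker_prod m (\<lambda>i. part_transpose \<tau> i (A i))"
    have B: "?B \<in> carrier_mat N N" unfolding N_def by (rule kp_carrier[OF carr_part_transpose[OF A]])
    note c = unitary_matD(1)[OF U] unitary_matD(1)[OF V] B
    have cp: "\<phi> (kronecker_prod m A) \<in> carrier_mat N N" using preserverD(1)[OF \<phi> kp_carrier[OF A]] by (simp add: N_def)
    have cr: "U * ?B * transpose_mat W \<in> carrier_mat N N" using c by simp
    show "dim_row (\<phi> (kronecker_prod m A)) = dim_row (U * ?B * transpose_mat W)"
      "dim_col (\<phi> (kronecker_prod m A)) = dim_col (U * ?B * transpose_mat W)"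
      using carrier_matD[OF cp] carrier_matD[OF cr] by simp_all
    fix r s assume "r < dim_row (U * ?B * transpose_mat W)" "s < dim_col (U * ?B * transpose_mat W)"
    hence rs: "r < N" "s < N" using carrier_matD[OF cr] by auto
    have "(U * ?B * transpose_mat W) $$ (r, s) = (\<Sum>b<N. (U * ?B) $$ (r, b) * transpose_mat W $$ (b, s))"
      using c rs by (intro mult_mat_index) auto
    also have "\<dots> = (\<Sum>b<N. \<Sum>a<N. ?B $$ (a, b) * (p a r * q b s))"
    proof (rule sum.cong[OF refl])
      fix b assume "b \<in> {..<N}"
      hence b: "b < N" by simp
      have "(U * ?B) $$ (r, b) = (\<Sum>a<N. U $$ (r, a) * ?B $$ (a, b))" using c rs b by (intro mult_mat_index) auto
      also have "\<dots> * transpose_mat W $$ (b, s) = (\<Sum>a<N. of_real (1 / sqrt g * (1 / sqrt h)) * (?B $$ (a, b) * (p a r * q b s)))"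
        unfolding sum_distrib_right using rs b by (intro sum.cong) (auto simp: U_def W_def mult_ac)
      finally show "(U * ?B) $$ (r, b) * transpose_mat W $$ (b, s) = (\<Sum>a<N. ?B $$ (a, b) * (p a r * q b s))"
        unfolding gh1 by simp
    qed
    also have "\<dots> = (\<Sum>a<N. \<Sum>b<N. ?B $$ (a, b) * (p a r * q b s))" by (rule sum.swap)
    also have "\<dots> = \<phi> (kronecker_prod m A) $$ (r, s)" unfolding form[OF A rs] sum.cartesian_product ..
    finally show "\<phi> (kronecker_prod m A) $$ (r, s) = (U * ?B * transpose_mat W) $$ (r, s)" by simp
  qed
  moreover have "\<forall>s<m. part_transpose \<tau> s = (\<lambda>X. X) \<or> part_transpose \<tau> s = transpose_mat" by (auto simp: part_transpose_def)
  ultimately show ?thesis using U V unfolding N_def by blast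
qed

theorem theorem3p1:
  fixes m k N :: nat and n :: "nat \<Rightarrow> nat" and \<phi> :: "complex mat \<Rightarrow> complex mat"
  assumes "m \<ge> 2"
    and "\<And>i. i < m \<Longrightarrow> n i \<ge> 1"
    and "N = (\<Prod>i<m. n i)"
    and "1 \<le> k" and "k \<le> N"
    and "linear_map class_ring (module_mat TYPE(complex) N N) (module_mat TYPE(complex) N N) \<phi>"
  shows "(\<forall>A. (\<forall>i<m. A i \<in> carrier_mat (n i) (n i)) \<longrightarrow>
            ky_fan_norm k (\<phi> (kronecker_prod m A)) = ky_fan_norm k (kronecker_prod m A))
     \<longleftrightarrow> (\<exists>U V \<psi>. unitary_mat N U \<and> unitary_mat N V \<and>
            (\<forall>s<m. \<psi> s = (\<lambda>X. X) \<or> \<psi> s = transpose_mat) \<and>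
            (\<forall>A. (\<forall>i<m. A i \<in> carrier_mat (n i) (n i)) \<longrightarrow>
               \<phi> (kronecker_prod m A) = U * kronecker_prod m (\<lambda>i. \<psi> i (A i)) * V))"
    (is "?L \<longleftrightarrow> ?R")
proof
  assume L: ?L
  have "mod_hom class_ring (module_mat TYPE(complex) N N) (module_mat TYPE(complex) N N) \<phi>"
    using assms(6) by (simp add: linear_map_def)
  from mod_hom.f_hom[OF this] have "preserver m n k \<phi>"
    using L unfolding preserver_def module_hom_def carr_def
    by (auto simp: module_mat_simps assms(3) LinearCombinations.module_hom_def)
  from preserver_structure[OF this] show ?R using assms(4,5) unfolding carr_def assms(3) by blast
next
  assume ?R
  then obtain U V \<psi> where U: "unitary_mat N U" and V: "unitary_mat N V"
    and \<psi>: "\<And>s. s < m \<Longrightarrow> \<psi> s = (\<lambda>X. X) \<or> \<psi> s = transpose_mat"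
    and eq: "\<And>A. (\<forall>i<m. A i \<in> carrier_mat (n i) (n i)) \<Longrightarrow> \<phi> (kronecker_prod m A) = U * kronecker_prod m (\<lambda>i. \<psi> i (A i)) * V" by blast
  show ?L
  proof (intro allI impI)
    fix A :: "nat \<Rightarrow> complex mat" assume A: "\<forall>i<m. A i \<in> carrier_mat (n i) (n i)"
    hence c: "carr m n A" by (simp add: carr_def)
    have "carr m n (\<lambda>i. \<psi> i (A i))" unfolding carr_def
    proof (intro allI impI)
      fix i assume "i < m"
      thus "\<psi> i (A i) \<in> carrier_mat (n i) (n i)" using \<psi>[of i] A by auto
    qed
    from kp_carrier[OF this] have "kronecker_prod m (\<lambda>i. \<psi> i (A i)) \<in> carrier_mat N N" by (simp add: assms(3))
    hence "ky_fan_norm k (\<phi> (kronecker_prod m A)) = ky_fan_norm k (kronecker_prod m (\<lambda>i. \<psi> i (A i)))"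
      unfolding eq[OF A] by (rule ky_fan_unitary[OF U V])
    also have "\<dots> = ky_fan_norm k (kronecker_prod m A)" by (rule kp_transpose_norm[OF c \<psi>])
    finally show "ky_fan_norm k (\<phi> (kronecker_prod m A)) = ky_fan_norm k (kronecker_prod m A)" .
  qed
qed

end
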